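(* $\mathbf{W}(\pi)=v(\pi)$ for all $\pi\in\Delta(K\times L)$, where $\mathbf{W}$ is the value of the continuous-time game with incomplete information with matrices $(G^{k\ell})_{(k,\ell)\in K\times L}$ and $v$ is the asymptotic value of the corresponding repeated game with incomplete information.
   Context: Data. $K,L,I,J$ are finite sets; $\Delta(X)$ is the set of probability distributions on a finite (or countable) set $X$. $U=\Delta(I)$, $V=\Delta(J)$. For each $(k,\ell)\in K\times L$, $G^{k\ell}:I\times J\to\mathbb{R}$ is a matrix game, extended bilinearly to $U\times V$. Repeated game. For $\pi\in\Delta(K\times L)$ and $\theta\in\Delta(\mathbb{N}^* )$: a pair $(k,\ell)$ is drawn according to $\pi$; player 1 is informed of $k$, player 2 of $\ell$. At every stage $m\ge1$, knowing the past actions, the players choose actions $(i_m,j_m)\in I\times J$. Player 1 maximizes (player 2 minimizes) the expectation of $\sum_{m\ge1}\theta_mG^{k\ell}(i_m,j_m)$. The value $v_\theta(\pi)$ exists. As $\|\theta\|:=\max_{m\ge1}\theta_m\to0$, $v_\theta(\pi)$ converges (known result); the limit is the asymptotic value $v(\pi)$. It is also known that $v$ is the unique solution of the Mertens–Zamir system $$w(\pi)=\mathrm{Cav}_{\Delta(K)}\min\{u_K,w_K\}(\pi^K,\pi^{L|K}),\qquad w(\pi)=\mathrm{Vex}_{\Delta(L)}\max\{u_L,w_L\}(\pi^L,\pi^{K|L}),$$ where $u(\pi)=\max_{a\in U}\min_{b\in V}\sum_{(k,\ell)}\pi^{k\ell}G^{k\ell}(a,b)$; $\pi^K,\pi^L$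 are the marginals and $\pi^{L|K}\in\Delta(L)^K,\pi^{K|L}\in\Delta(K)^L$ the conditionals of $\pi$; $\varphi_K(p,Q)=\varphi(p\otimes Q)$ with $(p\otimes Q)(k,\ell)=p(k)Q(\ell|k)$ and $\varphi_L(P,q)=\varphi(q\otimes P)$ with $(q\otimes P)(k,\ell)=q(\ell)P(k|\ell)$; and $\mathrm{Cav}_{\Delta(K)}$ (resp. $\mathrm{Vex}_{\Delta(L)}$) is the smallest concave majorant with respect to $p\in\Delta(K)$ (resp. largest convex minorant with respect to $q\in\Delta(L)$), the conditionals being fixed. Continuous-time game. A pair $(k,\ell)$ is drawn according to $\pi\in\Delta(K\times L)$; player 1 (maximizer) is informed of $k$, player 2 (minimizer) of $\ell$; they then play on $[0,1]$ with running payoff $G^{k\ell}$ and no state variable. Let $\mathcal{U}$ (resp. $\mathcal{V}$) be the set of Lebesgue-measurable maps $[0,1]\to U$ (resp. $V$), with the $L^1$ topology. Let $\mathcal{S}=\{([0,1]^m,\mathcal{B}([0,1]^m),\mathcal{L}_m): m\ge1\}$ (Borel sets and Lebesgue measure). A random strategy $\alpha\in\mathcal{A}_r$ of player 1 is a pair consisting of a probability space $(\Omega_\alpha,\mathcal{F}_\alpha,\mathbb{P}_\alpha)\in\mathcal{S}$ and a measurable map $\alpha:\Omega_\alpha\times\mathcal{V}\to\mathcal{U}$ (Borel $\sigma$-fields on $\mathcal{U},\mathcal{V}$) for which there is a finite partition $0=s_0<\dots<s_N=1$ such that for all $0\le m<N$, $\omega\in\Omega_\alpha$, $\mathbf{v}_1,\mathbf{v}_2\in\mathcal{V}$: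 $\mathbf{v}_1=\mathbf{v}_2$ a.e. on $[s_0,s_m]$ implies $\alpha(\omega,\mathbf{v}_1)=\alpha(\omega,\mathbf{v}_2)$ a.e. on $[s_0,s_{m+1}]$. $\mathcal{B}_r$ is defined symmetrically for player 2. For $(\alpha,\beta)\in\mathcal{A}_r\times\mathcal{B}_r$ and $\omega=(\omega_1,\omega_2)\in\Omega_\alpha\times\Omega_\beta$ there is a unique pair $(\mathbf{u}_\omega,\mathbf{v}_\omega)\in\mathcal{U}\times\mathcal{V}$ (up to a.e. equality) with $\alpha(\omega_1,\mathbf{v}_\omega)=\mathbf{u}_\omega$, $\beta(\omega_2,\mathbf{u}_\omega)=\mathbf{v}_\omega$. For $\hat\alpha=(\hat\alpha^k)_k\in\mathcal{A}_r^K$ and $\hat\beta=(\hat\beta^\ell)_\ell\in\mathcal{B}_r^L$ the payoff is $$\sum_{(k,\ell)}\pi^{k\ell}\int_{\Omega_{\hat\alpha^k}\times\Omega_{\hat\beta^\ell}}\int_0^1G^{k\ell}(\mathbf{u}_\omega(s),\mathbf{v}_\omega(s))\,ds\;d\,\mathbb{P}_{\hat\alpha^k}\otimes\mathbb{P}_{\hat\beta^\ell}(\omega),$$ where $(\mathbf{u}_\omega,\mathbf{v}_\omega)$ is the pair induced by $(\hat\alpha^k,\hat\beta^\ell)$ at $\omega$. $\mathbf{W}(\pi)$ is the value of this game, i.e. the common value of $\sup_{\hat\alpha}\inf_{\hat\beta}$ and $\inf_{\hat\beta}\sup_{\hat\alpha}$ of this payoff (it exists). *)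

theory Defs
  imports "HOL-Probability.Probability"
begin

section \<open>Values of zero-sum games\<close>

text \<open>
  All payoff functions below are bounded, so that the real-valued suprema and infima
  are the genuine ones.
\<close>

definition is_value :: "'a set \<Rightarrow> 'b set \<Rightarrow> ('a \<Rightarrow> 'b \<Rightarrow> real) \<Rightarrow> real \<Rightarrow> bool" where
  "is_value A B g w \<longleftrightarrow>
     (SUP a\<in>A. INF b\<in>B. g a b) = w \<and> (INF b\<in>B. SUP a\<in>A. g a b) = w"

definition has_value :: "'a set \<Rightarrow> 'b set \<Rightarrow> ('a \<Rightarrow> 'b \<Rightarrow> real) \<Rightarrow> bool" where
  "has_value A B g \<longleftrightarrow> (\<exists>w. is_value A B g w)"

definition game_value :: "'a set \<Rightarrow> 'b set \<Rightarrow> ('a \<Rightarrow> 'b \<Rightarrow> real) \<Rightarrow> real" where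
  "game_value A B g = (THE w. is_value A B g w)"

text \<open>
  Throughout, \<open>K\<close>, \<open>L\<close>, \<open>I\<close>, \<open>J\<close> are finite types and \<open>\<Delta>(X)\<close> is the type of probability
  mass functions on \<open>X\<close>.
\<close>

definition mixed_payoff :: "('i::finite \<Rightarrow> 'j::finite \<Rightarrow> real) \<Rightarrow> 'i pmf \<Rightarrow> 'j pmf \<Rightarrow> real" where
  "mixed_payoff g a b = (\<Sum>i\<in>UNIV. \<Sum>j\<in>UNIV. pmf a i * pmf b j * g i j)"


section \<open>The repeated game with incomplete information\<close>

text \<open>
  Stages are numbered from \<open>0\<close> instead of \<open>1\<close>; stage \<open>m\<close> has weight \<^term>\<open>pmf \<theta> m\<close> and
  actions \<open>x m\<close>. A strategy of player 1 of type \<open>k\<close> is a behaviour strategy \<open>\<sigma> k\<close>, which assigns a mixed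
  action to each finite history of past action pairs (oldest first).
\<close>

definition stage_kernel ::
  "(('i \<times> 'j) list \<Rightarrow> 'i pmf) \<Rightarrow> (('i \<times> 'j) list \<Rightarrow> 'j pmf) \<Rightarrow> nat \<Rightarrow>
   (nat \<Rightarrow> 'i \<times> 'j) \<Rightarrow> ('i \<times> 'j) measure" where
  "stage_kernel s t n x =
     measure_pmf (pair_pmf (s (map x [0..<n])) (t (map x [0..<n])))"

lemma Ionescu_Tulcea_stage_kernel:
  fixes s :: "('i::finite \<times> 'j::finite) list \<Rightarrow> 'i pmf" and t :: "('i \<times> 'j) list \<Rightarrow> 'j pmf"
  shows "Ionescu_Tulcea (stage_kernel s t) (\<lambda>_. count_space UNIV)"
proof (rule Ionescu_Tulcea.intro)
  fix n :: nat
  let ?M = "PiM {0..<n} (\<lambda>_. count_space UNIV) :: (nat \<Rightarrow> 'i \<times> 'j) measure"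
  have hist: "(\<lambda>x. map x [0..<n]) \<in> measurable ?M (count_space UNIV)"
  proof (rule measurable_count_space_eq2_countable[THEN iffD2], intro conjI ballI)
    fix h :: "('i \<times> 'j) list"
    have comp: "{x \<in> space ?M. x m = c} \<in> sets ?M" if "m \<in> {0..<n}" for m and c :: "'i \<times> 'j"
    proof -
      have "(\<lambda>x. x m) -` {c} \<inter> space ?M \<in> sets ?M"
        by (rule measurable_sets[OF measurable_component_singleton[OF that]]) simp
      also have "(\<lambda>x. x m) -` {c} \<inter> space ?M = {x \<in> space ?M. x m = c}"
        by blast
      finally show ?thesis .
    qed
    show "(\<lambda>x. map x [0..<n]) -` {h} \<inter> space ?M \<in> sets ?M"
    proof (cases "length h = n")
      case True
      have "(map x [0..<n] = h) = (\<forall>m\<in>{0..<n}. x m = h ! m)" for x :: "nat \<Rightarrow> 'i \<times> 'j"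
        using True by (simp add: list_eq_iff_nth_eq Ball_def)
      then have "(\<lambda>x. map x [0..<n]) -` {h} \<inter> space ?M =
          {x \<in> space ?M. \<forall>m\<in>{0..<n}. x m = h ! m}"
        by blast
      also have "\<dots> \<in> sets ?M"
        by (intro sets.sets_Collect_finite_All comp) simp_all
      finally show ?thesis .
    next
      case False
      then have "(\<lambda>x. map x [0..<n]) -` {h} \<inter> space ?M = {}"
        by auto
      then show ?thesis
        by (metis sets.empty_sets)
    qed
  qed (simp_all)
  have ker: "(\<lambda>h. measure_pmf (pair_pmf (s h) (t h)))
      \<in> measurable (count_space UNIV) (subprob_algebra (count_space UNIV))"
    by (auto simp: space_subprob_algebra intro!: prob_space_imp_subprob_space
          measure_pmf.prob_space_axioms)
  show "stage_kernel s t n \<in> measurable ?M (subprob_algebra (count_space UNIV))"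
    using measurable_compose[OF hist ker] by (simp add: stage_kernel_def[abs_def])
  show "prob_space (stage_kernel s t n x)" for x :: "nat \<Rightarrow> 'i \<times> 'j"
    by (simp add: stage_kernel_def measure_pmf.prob_space_axioms)
qed

text \<open>The law of the infinite play, obtained from the stage kernels by Ionescu-Tulcea.\<close>

definition play_measure ::
  "(('i::finite \<times> 'j::finite) list \<Rightarrow> 'i pmf) \<Rightarrow> (('i \<times> 'j) list \<Rightarrow> 'j pmf) \<Rightarrow>
   (nat \<Rightarrow> 'i \<times> 'j) measure" where
  "play_measure s t =
     projective_family.lim UNIV
       (Ionescu_Tulcea.CI (stage_kernel s t) (\<lambda>_. count_space UNIV)) (\<lambda>_. count_space UNIV)"

definition repeated_payoff ::
  "('k::finite \<Rightarrow> 'l::finite \<Rightarrow> 'i::finite \<Rightarrow> 'j::finite \<Rightarrow> real) \<Rightarrow> ('k \<times> 'l) pmf \<Rightarrow> nat pmf \<Rightarrow>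
   ('k \<Rightarrow> ('i \<times> 'j) list \<Rightarrow> 'i pmf) \<Rightarrow> ('l \<Rightarrow> ('i \<times> 'j) list \<Rightarrow> 'j pmf) \<Rightarrow> real" where
  "repeated_payoff G \<pi> \<theta> \<sigma> \<tau> =
     (\<Sum>(k, l)\<in>UNIV. pmf \<pi> (k, l) *
        (\<integral>x. (\<Sum>m. pmf \<theta> m * G k l (fst (x m)) (snd (x m))) \<partial>play_measure (\<sigma> k) (\<tau> l)))"

definition repeated_has_value ::
  "('k::finite \<Rightarrow> 'l::finite \<Rightarrow> 'i::finite \<Rightarrow> 'j::finite \<Rightarrow> real) \<Rightarrow> ('k \<times> 'l) pmf \<Rightarrow> nat pmf \<Rightarrow> bool"
  where
  "repeated_has_value G \<pi> \<theta> \<longleftrightarrow> has_value UNIV UNIV (repeated_payoff G \<pi> \<theta>)"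

definition repeated_value ::
  "('k::finite \<Rightarrow> 'l::finite \<Rightarrow> 'i::finite \<Rightarrow> 'j::finite \<Rightarrow> real) \<Rightarrow> ('k \<times> 'l) pmf \<Rightarrow> nat pmf \<Rightarrow> real"
  where
  "repeated_value G \<pi> \<theta> = game_value UNIV UNIV (repeated_payoff G \<pi> \<theta>)"

text \<open>The supremum is attained, because the weights are summable.\<close>

definition weight_norm :: "nat pmf \<Rightarrow> real" where
  "weight_norm \<theta> = (SUP m. pmf \<theta> m)"

definition vanishing_weights :: "nat pmf filter" where
  "vanishing_weights = filtercomap weight_norm (nhds 0)"

definition asymptotic_value ::
  "('k::finite \<Rightarrow> 'l::finite \<Rightarrow> 'i::finite \<Rightarrow> 'j::finite \<Rightarrow> real) \<Rightarrow> ('k \<times> 'l) pmf \<Rightarrow> real" where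
  "asymptotic_value G \<pi> = Lim vanishing_weights (repeated_value G \<pi>)"


section \<open>The continuous-time game with incomplete information\<close>

text \<open>
  Controls are represented by maps on the whole line, of which only the restriction to \<open>[0,1]\<close>
  matters: the \<open>L\<^sup>1\<close> (pseudo-)distance, and hence every open and every Borel set of controls, does
  not see values outside \<open>[0,1]\<close> or on null sets.
\<close>

definition controls :: "(real \<Rightarrow> 'a::finite pmf) set" where
  "controls = {u. \<forall>a. (\<lambda>s. pmf (u s) a) \<in> borel_measurable (lebesgue_on {0..1})}"

definition L1_dist :: "(real \<Rightarrow> 'a::finite pmf) \<Rightarrow> (real \<Rightarrow> 'a pmf) \<Rightarrow> real" where
  "L1_dist u u' = (\<integral>s. (\<Sum>a\<in>UNIV. \<bar>pmf (u s) a - pmf (u' s) a\<bar>) \<partial>lebesgue_on {0..1})"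

definition L1_open :: "(real \<Rightarrow> 'a::finite pmf) set \<Rightarrow> bool" where
  "L1_open S \<longleftrightarrow> S \<subseteq> controls \<and>
     (\<forall>u\<in>S. \<exists>e>0. \<forall>u'\<in>controls. L1_dist u u' < e \<longrightarrow> u' \<in> S)"

text \<open>The measurable space of controls with its Borel sets; the measure itself plays no role.\<close>

definition control_space :: "(real \<Rightarrow> 'a::finite pmf) measure" where
  "control_space = sigma controls {S. L1_open S}"

definition cube :: "nat \<Rightarrow> (nat \<Rightarrow> real) measure" where
  "cube m = PiM {..<m} (\<lambda>_. restrict_space lborel {0..1})"

text \<open>
  A random strategy is a pair \<open>(m, \<alpha>)\<close> with \<open>\<Omega> = [0,1]\<^sup>m\<close>. It maps controls of the opponent
  (with actions in \<open>'b\<close>) to controls of the player (with actions in \<open>'a\<close>), so the two instances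
  \<open>('j, 'i)\<close> and \<open>('i, 'j)\<close> of the type give the strategies of players 1 and 2.
\<close>

type_synonym ('b, 'a) strategy =
  "nat \<times> ((nat \<Rightarrow> real) \<Rightarrow> (real \<Rightarrow> 'b pmf) \<Rightarrow> (real \<Rightarrow> 'a pmf))"

definition nonanticipative_with_delay ::
  "(nat \<Rightarrow> real) set \<Rightarrow> ((nat \<Rightarrow> real) \<Rightarrow> (real \<Rightarrow> 'b::finite pmf) \<Rightarrow> (real \<Rightarrow> 'a::finite pmf)) \<Rightarrow> bool"
  where
  "nonanticipative_with_delay \<Omega> \<alpha> \<longleftrightarrow>
     (\<exists>(N::nat) (s::nat \<Rightarrow> real). s 0 = 0 \<and> s N = 1 \<and> (\<forall>m<N. s m < s (Suc m)) \<and>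
        (\<forall>m<N. \<forall>\<omega>\<in>\<Omega>. \<forall>v\<^sub>1\<in>controls. \<forall>v\<^sub>2\<in>controls.
           (AE r in lebesgue_on {s 0..s m}. v\<^sub>1 r = v\<^sub>2 r) \<longrightarrow>
           (AE r in lebesgue_on {s 0..s (Suc m)}. \<alpha> \<omega> v\<^sub>1 r = \<alpha> \<omega> v\<^sub>2 r)))"

definition random_strategies :: "('b::finite, 'a::finite) strategy set" where
  "random_strategies = {(m, \<alpha>). m \<ge> 1 \<and>
     (\<lambda>(\<omega>, v). \<alpha> \<omega> v) \<in> measurable (cube m \<Otimes>\<^sub>M control_space) control_space \<and>
     nonanticipative_with_delay (space (cube m)) \<alpha>}"

text \<open>The pair of controls is unique only up to a.e. equality, which the payoff does not see.\<close>

definition induced_controls ::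
  "('j::finite, 'i::finite) strategy \<Rightarrow> ('i, 'j) strategy \<Rightarrow> (nat \<Rightarrow> real) \<Rightarrow> (nat \<Rightarrow> real) \<Rightarrow>
   (real \<Rightarrow> 'i pmf) \<times> (real \<Rightarrow> 'j pmf)" where
  "induced_controls \<alpha> \<beta> \<omega>\<^sub>1 \<omega>\<^sub>2 =
     (SOME (u, v). u \<in> controls \<and> v \<in> controls \<and>
        (AE s in lebesgue_on {0..1}. snd \<alpha> \<omega>\<^sub>1 v s = u s) \<and>
        (AE s in lebesgue_on {0..1}. snd \<beta> \<omega>\<^sub>2 u s = v s))"

definition running_payoff ::
  "('i::finite \<Rightarrow> 'j::finite \<Rightarrow> real) \<Rightarrow> (real \<Rightarrow> 'i pmf) \<times> (real \<Rightarrow> 'j pmf) \<Rightarrow> real" where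
  "running_payoff g = (\<lambda>(u, v). \<integral>s. mixed_payoff g (u s) (v s) \<partial>lebesgue_on {0..1})"

definition ct_payoff ::
  "('k::finite \<Rightarrow> 'l::finite \<Rightarrow> 'i::finite \<Rightarrow> 'j::finite \<Rightarrow> real) \<Rightarrow> ('k \<times> 'l) pmf \<Rightarrow>
   ('k \<Rightarrow> ('j, 'i) strategy) \<Rightarrow> ('l \<Rightarrow> ('i, 'j) strategy) \<Rightarrow> real" where
  "ct_payoff G \<pi> \<alpha> \<beta> =
     (\<Sum>(k, l)\<in>UNIV. pmf \<pi> (k, l) *
        (\<integral>\<omega>. running_payoff (G k l) (induced_controls (\<alpha> k) (\<beta> l) (fst \<omega>) (snd \<omega>))
           \<partial>(cube (fst (\<alpha> k)) \<Otimes>\<^sub>M cube (fst (\<beta> l)))))"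

definition ct_has_value ::
  "('k::finite \<Rightarrow> 'l::finite \<Rightarrow> 'i::finite \<Rightarrow> 'j::finite \<Rightarrow> real) \<Rightarrow> ('k \<times> 'l) pmf \<Rightarrow> bool" where
  "ct_has_value G \<pi> \<longleftrightarrow>
     has_value {\<alpha>. \<forall>k. \<alpha> k \<in> random_strategies} {\<beta>. \<forall>l. \<beta> l \<in> random_strategies} (ct_payoff G \<pi>)"

definition ct_value ::
  "('k::finite \<Rightarrow> 'l::finite \<Rightarrow> 'i::finite \<Rightarrow> 'j::finite \<Rightarrow> real) \<Rightarrow> ('k \<times> 'l) pmf \<Rightarrow> real" where
  "ct_value G \<pi> =
     game_value {\<alpha>. \<forall>k. \<alpha> k \<in> random_strategies} {\<beta>. \<forall>l. \<beta> l \<in> random_strategies} (ct_payoff G \<pi>)"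

end

theory Submission
  imports Defs
begin

text \<open>
  A strategy of the repeated game is turned into one of the continuous-time game. Cut \<open>[0,1]\<close> into
  blocks whose lengths are approximately the stage weights. The player simulates a play of the
  repeated game with his own randomness: at the end of a block he draws his action from his
  behaviour strategy and the opponent's action from the average of the opponent's control on the
  block. During the block itself he must not play the drawn action, to which the opponent could
  react, nor his behaviour strategy, which would reveal his type; he plays the Bayesian mixture,
  over a uniform prior on his types, of the behaviour strategies at the simulated history. What the
  opponent sees is then a function of the simulated history, so his answer is a strategy of the
  repeated game. The squared distances between behaviour strategy and mixture have bounded
  expected sum over the stages, as for any bounded martingale, so the loss is of order the square
  root of the largest stage weight. Thus either player can guarantee in continuous time the value
  of the repeated game up to such an error, which forces both games to have the same limit value,
  without any use of the Mertens-Zamir system.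
\<close>


section \<open>Minimax without topology\<close>

text \<open>A type of the opponent meets all types of the player with one and the same strategy.
  Since the mixture depends on the player's type only through the simulated history, a single
  strategy of the repeated game describes the answer to all of them. Drawing the opponent's action
  too keeps the law of the history a product of two likelihoods. Averages suffice because the
  mixture is constant on a block and payoffs are bilinear. The prior is uniform, not derived from
  \<pi>, because the loss must be bounded for each type separately; the opponent's likelihood
  cancels from the posterior. Splitting each stage loss by
  \<open>a * b \<le> a^2 / (2 * \<kappa>) + \<kappa> * b^2 / 2\<close> leaves
  \<open>1 / (2 * \<kappa>)\<close> for the whole game plus \<kappa>/2 times the number of types
  times the sum of the squared block lengths. That sum is at most about the largest weight, and a
  suitable \<kappa> produces the square root. Near-optimal strategies to start from exist because
  the repeated game has a value, which is proved here by a minimax argument.\<close>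

lemma sup_inf_le_inf_sup:
  fixes g :: "'a \<Rightarrow> 'b \<Rightarrow> real"
  assumes "A \<noteq> {}" "B \<noteq> {}" and bd: "\<And>a b. a \<in> A \<Longrightarrow> b \<in> B \<Longrightarrow> \<bar>g a b\<bar> \<le> C"
  shows "(SUP a\<in>A. INF b\<in>B. g a b) \<le> (INF b\<in>B. SUP a\<in>A. g a b)"
proof (intro cSUP_least[OF assms(1)] cINF_greatest[OF assms(2)])
  fix a b assume ab: "a \<in> A" "b \<in> B"
  have "(INF b\<in>B. g a b) \<le> g a b"
    using bd ab by (intro cINF_lower bdd_belowI2[where m="-C"]) (auto simp: abs_le_iff minus_le_iff)
  also have "\<dots> \<le> (SUP a\<in>A. g a b)"
    using bd ab by (intro cSUP_upper bdd_aboveI2[where M=C]) (auto simp: abs_le_iff)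
  finally show "(INF b\<in>B. g a b) \<le> (SUP a\<in>A. g a b)" .
qed

lemma game_value_eq:
  assumes "is_value A B g w"
  shows "has_value A B g" "game_value A B g = w"
proof -
  show "has_value A B g"
    using assms by (auto simp: has_value_def)
  show "game_value A B g = w"
    unfolding game_value_def by (rule the_equality) (use assms in \<open>auto simp: is_value_def\<close>)
qed

lemma guarantee_le_sup_inf:
  fixes g :: "'a \<Rightarrow> 'b \<Rightarrow> real"
  assumes bd: "\<And>a b. a \<in> A \<Longrightarrow> b \<in> B \<Longrightarrow> \<bar>g a b\<bar> \<le> C"
    and "a \<in> A" "B \<noteq> {}" and le: "\<And>b. b \<in> B \<Longrightarrow> r \<le> g a b"
  shows "r \<le> (SUP a\<in>A. INF b\<in>B. g a b)"
proof -
  obtain b where b: "b \<in> B"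
    using assms by auto
  have "r \<le> (INF b\<in>B. g a b)"
    by (intro cINF_greatest assms)
  also have "\<dots> \<le> (SUP a\<in>A. INF b\<in>B. g a b)"
  proof (intro cSUP_upper assms bdd_aboveI2[where M=C])
    fix a assume a: "a \<in> A"
    have "(INF b\<in>B. g a b) \<le> g a b"
      using bd a b by (intro cINF_lower bdd_belowI2[where m="-C"]) (auto simp: abs_le_iff minus_le_iff)
    then show "(INF b\<in>B. g a b) \<le> C"
      using bd[OF a b] by linarith
  qed
  finally show ?thesis .
qed

text \<open>Ky Fan's notion: a convex combination only has to be dominated by some strategy, so the
  strategy set carries no linear structure. Pointwise mixing of behaviour strategies would not make
  payoffs affine.\<close>

definition concavelike :: "'a set \<Rightarrow> 'b set \<Rightarrow> ('a \<Rightarrow> 'b \<Rightarrow> real) \<Rightarrow> bool" where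
  "concavelike A B g \<longleftrightarrow> (\<forall>a\<in>A. \<forall>a'\<in>A. \<forall>\<mu>\<in>{0..1}. \<exists>a''\<in>A. \<forall>b\<in>B.
     \<mu> * g a b + (1 - \<mu>) * g a' b \<le> g a'' b)"

lemma convex_bound_gt:
  fixes c :: real
  assumes "c < x" "c < y" "0 \<le> u" "0 \<le> v" "u + v = 1"
  shows "c < u * x + v * y"
  using convex_bound_lt[of "-x" "-c" "-y" u v] assms by simp

text \<open>Separation in the plane: by \<open>comb\<close> not only the points
  \<open>(f x, g x)\<close> but also their mixtures avoid the open positive quadrant. A point with
  \<open>0 < g x\<close> bounds the weight \<mu> from below, one with \<open>0 < f x\<close> bounds
  it from above, and the supremum of the lower bounds works.\<close>

lemma concavelike_two:
  fixes f g :: "'a \<Rightarrow> real"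
  assumes comb: "\<And>x x' \<mu>. x \<in> A \<Longrightarrow> x' \<in> A \<Longrightarrow> 0 \<le> \<mu> \<Longrightarrow> \<mu> \<le> 1 \<Longrightarrow>
      \<exists>x''\<in>A. \<mu> * f x + (1 - \<mu>) * f x' \<le> f x'' \<and> \<mu> * g x + (1 - \<mu>) * g x' \<le> g x''"
    and le: "\<And>x. x \<in> A \<Longrightarrow> f x \<le> 0 \<or> g x \<le> 0"
  obtains \<mu> where "0 \<le> \<mu>" "\<mu> \<le> 1" "\<And>x. x \<in> A \<Longrightarrow> \<mu> * f x + (1 - \<mu>) * g x \<le> 0"
proof -
  \<comment> \<open>The quotients are the lower bounds on the weight; \<open>0\<close> keeps the set
    nonempty and the supremum nonnegative.\<close>
  define R where "R = insert 0 ((\<lambda>x. g x / (g x - f x)) ` {x \<in> A. 0 < g x})"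
  have R1: "r \<le> 1" if "r \<in> R" for r
    using that le by (fastforce simp: R_def divide_simps)
  have bdd: "bdd_above R"
    by (rule bdd_aboveI[of _ 1]) (rule R1)
  have cross: "g x * f x' \<le> f x * g x'" if x: "x \<in> A" "0 < g x" and x': "x' \<in> A" "0 < f x'" for x x'
  proof (rule ccontr)
    assume neg: "\<not> g x * f x' \<le> f x * g x'"
    have sg: "f x \<le> 0" "g x' \<le> 0"
      using le[OF x(1)] le[OF x'(1)] x x' by auto
    define D where "D = (f x' - g x') + (g x - f x)"
    \<comment> \<open>The weight at which the segment between the two points crosses the diagonal;
      both coordinates there equal the cross difference over \<open>D\<close>, which is positive by
      \<open>neg\<close>.\<close>
    define \<mu> where "\<mu> = (f x' - g x') / D"
    have D: "D > 0"
      using sg x x' by (simp add: D_def)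
    have \<mu>: "0 \<le> \<mu>" "\<mu> \<le> 1" "1 - \<mu> = (g x - f x) / D"
      using sg x x' D by (auto simp: \<mu>_def field_simps D_def)
    obtain x'' where x'': "x'' \<in> A" "\<mu> * f x + (1 - \<mu>) * f x' \<le> f x''" "\<mu> * g x + (1 - \<mu>) * g x' \<le> g x''"
      using comb[OF x(1) x'(1) \<mu>(1,2)] by auto
    have "\<mu> * f x + (1 - \<mu>) * f x' = (g x * f x' - f x * g x') / D"
      "\<mu> * g x + (1 - \<mu>) * g x' = (g x * f x' - f x * g x') / D"
      unfolding \<mu>(3) unfolding \<mu>_def by (auto simp: algebra_simps simp flip: add_divide_distrib)
    then have "0 < f x''" "0 < g x''"
      using x''(2,3) neg D by (metis diff_gt_0_iff_gt divide_pos_pos not_le order_less_le_trans)+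
    with le[OF x''(1)] show False
      by auto
  qed
  show thesis
  proof
    show nn: "0 \<le> Sup R"
      by (intro cSup_upper bdd) (simp add: R_def)
    show le1: "Sup R \<le> 1"
      by (intro cSup_least R1) (auto simp: R_def)
    fix x assume x: "x \<in> A"
    show "Sup R * f x + (1 - Sup R) * g x \<le> 0"
    proof (cases "0 < g x")
      case True
      then have "f x \<le> 0"
        using le[OF x] by auto
      have "g x / (g x - f x) \<le> Sup R"
        using True x by (intro cSup_upper bdd) (auto simp: R_def)
      then show ?thesis
        using True \<open>f x \<le> 0\<close> by (auto simp: field_simps)
    next
      case gx: False
      show ?thesis
      proof (cases "0 < f x")
        case True
        have "r \<le> - g x / (f x - g x)" if r: "r \<in> R" for r
        proof -
          consider "r = 0" | z where "z \<in> A" "0 < g z" "r = g z / (g z - f z)"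
            using r by (auto simp: R_def)
          then show ?thesis
          proof cases
            case 1 with True gx show ?thesis by (simp add: field_simps)
          next
            case 2
            have "g z - f z > 0" "f x - g x > 0"
              using le[OF \<open>z \<in> A\<close>] 2 True gx by auto
            then have "g z / (g z - f z) \<le> - g x / (f x - g x) \<longleftrightarrow> g z * (f x - g x) \<le> - g x * (g z - f z)"
              by (simp add: field_simps)
            with cross[OF 2(1,2) x True] 2 show ?thesis
              by (simp add: algebra_simps)
          qed
        qed
        then have "Sup R \<le> - g x / (f x - g x)"
          by (intro cSup_least) (auto simp: R_def)
        moreover have "f x - g x > 0"
          using True gx by auto
        ultimately show ?thesis
          by (simp add: field_simps)
      next
        case False
        then show ?thesis
          using gx nn le1 by (intro add_nonpos_nonpos mult_nonneg_nonpos) auto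
      qed
    qed
  qed
qed

text \<open>A theorem of the alternative, by induction on the columns. On the rows where a new
  column \<open>z\<close> pays more than \<open>c\<close>, the induction hypothesis supplies a
  mixture of the old columns. Every row is then kept below \<open>c\<close> by that mixture or by
  \<open>z\<close>, and the planar case merges the two.\<close>

lemma concavelike_finite:
  fixes g :: "'a \<Rightarrow> 'b \<Rightarrow> real"
  assumes "finite F" "F \<noteq> {}" "concavelike A F g" "\<And>x. x \<in> A \<Longrightarrow> \<exists>y\<in>F. g x y \<le> c"
  shows "\<exists>p. (\<forall>y\<in>F. 0 \<le> p y) \<and> sum p F = 1 \<and> (\<forall>x\<in>A. (\<Sum>y\<in>F. p y * g x y) \<le> c)"
  using assms
proof (induction F arbitrary: A rule: finite_ne_induct)
  case (singleton y)
  then show ?case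
    by (intro exI[of _ "\<lambda>_. 1"]) auto
next
  case (insert z F)
  \<comment> \<open>The strict inequality survives convex combinations and domination, so
    concavelikeness passes to \<open>B\<close>.\<close>
  define B where "B = {x \<in> A. c < g x z}"
  have "concavelike B F g"
    unfolding concavelike_def
  proof (intro ballI)
    fix x x' \<mu> assume x: "x \<in> B" "x' \<in> B" and \<mu>: "\<mu> \<in> {0..1::real}"
    then obtain x'' where x'': "x'' \<in> A" "\<And>y. y \<in> insert z F \<Longrightarrow> \<mu> * g x y + (1 - \<mu>) * g x' y \<le> g x'' y"
      using insert.prems(1)[unfolded concavelike_def, rule_format, of x x' \<mu>] by (auto simp: B_def)
    have "c < \<mu> * g x z + (1 - \<mu>) * g x' z"
      using convex_bound_gt[of c "g x z" "g x' z" \<mu> "1 - \<mu>"] x \<mu> by (simp add: B_def)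
    then have "x'' \<in> B"
      using x'' by (fastforce simp: B_def)
    then show "\<exists>a''\<in>B. \<forall>b\<in>F. \<mu> * g x b + (1 - \<mu>) * g x' b \<le> g a'' b"
      using x'' by auto
  qed
  moreover have "\<exists>y\<in>F. g x y \<le> c" if "x \<in> B" for x
    using that insert.prems(2)[of x] by (auto simp: B_def)
  ultimately obtain p where p: "\<And>y. y \<in> F \<Longrightarrow> 0 \<le> p y" "sum p F = 1"
      "\<And>x. x \<in> B \<Longrightarrow> (\<Sum>y\<in>F. p y * g x y) \<le> c"
    using insert.IH by blast
  let ?f = "\<lambda>x. (\<Sum>y\<in>F. p y * g x y) - c" and ?g = "\<lambda>x. g x z - c"
  have comb: "\<exists>x''\<in>A. \<mu> * ?f x + (1 - \<mu>) * ?f x' \<le> ?f x'' \<and> \<mu> * ?g x + (1 - \<mu>) * ?g x' \<le> ?g x''"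
    if x: "x \<in> A" "x' \<in> A" "0 \<le> \<mu>" "\<mu> \<le> 1" for x x' \<mu>
  proof -
    obtain x'' where x'': "x'' \<in> A" "\<And>y. y \<in> insert z F \<Longrightarrow> \<mu> * g x y + (1 - \<mu>) * g x' y \<le> g x'' y"
      using insert.prems(1)[unfolded concavelike_def, rule_format, of x x' \<mu>] x by auto
    have "\<mu> * (\<Sum>y\<in>F. p y * g x y) + (1 - \<mu>) * (\<Sum>y\<in>F. p y * g x' y)
        = (\<Sum>y\<in>F. p y * (\<mu> * g x y + (1 - \<mu>) * g x' y))"
      by (simp add: sum_distrib_left algebra_simps flip: sum.distrib)
    also have "\<dots> \<le> (\<Sum>y\<in>F. p y * g x'' y)"
      using p x'' by (intro sum_mono mult_left_mono) auto
    finally show ?thesis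
      using x'' by (intro bexI[of _ x'']) (auto simp: algebra_simps)
  qed
  obtain \<mu> where \<mu>: "0 \<le> \<mu>" "\<mu> \<le> 1" "\<And>x. x \<in> A \<Longrightarrow> \<mu> * ?f x + (1 - \<mu>) * ?g x \<le> 0"
  proof (rule concavelike_two[of A ?f ?g])
    show "?f x \<le> 0 \<or> ?g x \<le> 0" if "x \<in> A" for x
      using p(3)[of x] that by (auto simp: B_def)
  qed (use comb in auto)
  define q where "q y = (if y = z then 1 - \<mu> else \<mu> * p y)" for y
  have q: "(\<Sum>y\<in>insert z F. q y * h y) = (1 - \<mu>) * h z + \<mu> * (\<Sum>y\<in>F. p y * h y)" for h
  proof -
    have "(\<Sum>y\<in>F. q y * h y) = (\<Sum>y\<in>F. \<mu> * (p y * h y))"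
      using insert.hyps by (intro sum.cong) (auto simp: q_def)
    then show ?thesis
      using insert.hyps by (simp add: q_def sum_distrib_left)
  qed
  show ?case
  proof (intro exI[of _ q] conjI ballI)
    show "0 \<le> q y" if "y \<in> insert z F" for y
      using that \<mu> p by (auto simp: q_def)
    show "sum q (insert z F) = 1"
      using q[of "\<lambda>_. 1"] p by simp
    show "(\<Sum>y\<in>insert z F. q y * g x y) \<le> c" if "x \<in> A" for x
      using \<mu>(3)[OF that] by (simp add: q algebra_simps)
  qed
qed

text \<open>Two-point domination iterates: one point is split off, the rest is renormalized and
  dominated by induction, and the two are combined.\<close>

lemma concavelike_sum:
  fixes g :: "'a \<Rightarrow> 'b \<Rightarrow> real"
  assumes "finite F" "F \<noteq> {}" "F \<subseteq> A" "concavelike A B g"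
    and "\<And>x. x \<in> F \<Longrightarrow> 0 \<le> p x" "sum p F = 1"
  shows "\<exists>x\<in>A. \<forall>y\<in>B. (\<Sum>a\<in>F. p a * g a y) \<le> g x y"
  using assms
proof (induction F arbitrary: p rule: finite_ne_induct)
  case (singleton x)
  then show ?case by auto
next
  case (insert z F)
  show ?case
  proof (cases "p z = 1")
    case True
    then have "sum p F = 0"
      using insert by simp
    then have "\<forall>x\<in>F. p x = 0"
      using insert by (subst (asm) sum_nonneg_eq_0_iff) auto
    then show ?thesis
      using True insert by (intro bexI[of _ z]) auto
  next
    case False
    have s: "sum p F = 1 - p z"
      using insert by simp
    moreover have "0 \<le> sum p F"
      using insert by (intro sum_nonneg) auto
    ultimately have lt: "p z < 1"
      using False by simp
    obtain x where x: "x \<in> A" "\<forall>y\<in>B. (\<Sum>a\<in>F. p a / (1 - p z) * g a y) \<le> g x y"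
      using insert.IH[of "\<lambda>a. p a / (1 - p z)"] insert.prems lt s
      by (auto simp flip: sum_divide_distrib)
    have zA: "z \<in> A" and pz: "p z \<in> {0..1}"
      using insert.prems lt by auto
    obtain w where w: "w \<in> A" "\<forall>y\<in>B. p z * g z y + (1 - p z) * g x y \<le> g w y"
      using insert.prems(2) zA x(1) pz unfolding concavelike_def by blast
    have "(\<Sum>a\<in>insert z F. p a * g a y) \<le> g w y" if y: "y \<in> B" for y
    proof -
      have "(\<Sum>a\<in>insert z F. p a * g a y) = p z * g z y + (1 - p z) * (\<Sum>a\<in>F. p a / (1 - p z) * g a y)"
        using insert.hyps lt by (simp add: sum_distrib_left)
      also have "\<dots> \<le> p z * g z y + (1 - p z) * g x y"
        using x(2) y lt by (intro add_left_mono mult_left_mono) auto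
      also have "\<dots> \<le> g w y"
        using w y by auto
      finally show ?thesis .
    qed
    with w show ?thesis by auto
  qed
qed

text \<open>A finite net of columns, uniform over the rows, replaces compactness. The finite
  alternative yields a mixture on the net, convexity on the column side collapses it to one column,
  and the cost \<open>e\<close> of the net is arbitrary.\<close>

theorem minimax_concavelike:
  fixes g :: "'a \<Rightarrow> 'b \<Rightarrow> real"
  assumes ne: "A \<noteq> {}" "B \<noteq> {}" and bd: "\<And>a b. a \<in> A \<Longrightarrow> b \<in> B \<Longrightarrow> \<bar>g a b\<bar> \<le> C"
    and conc: "concavelike A B g" and conv: "concavelike B A (\<lambda>b a. - g a b)"
    and net: "\<And>e. e > 0 \<Longrightarrow> \<exists>F. finite F \<and> F \<subseteq> B \<and> (\<forall>b\<in>B. \<exists>b'\<in>F. \<forall>a\<in>A. \<bar>g a b - g a b'\<bar> \<le> e)"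
  shows "has_value A B g"
proof -
  let ?lo = "SUP a\<in>A. INF b\<in>B. g a b" and ?up = "INF b\<in>B. SUP a\<in>A. g a b"
  have "?up \<le> ?lo + e" if e: "e > 0" for e
  proof -
    obtain F where F: "finite F" "F \<subseteq> B" "\<And>b. b \<in> B \<Longrightarrow> \<exists>b'\<in>F. \<forall>a\<in>A. \<bar>g a b - g a b'\<bar> \<le> e"
      using net[OF e] by blast
    have "F \<noteq> {}"
      using F(3) ne by blast
    \<comment> \<open>Otherwise the row \<open>x\<close> would guarantee more than
      \<open>?lo\<close> against every column, each being \<open>e\<close>-close to one in
      \<open>F\<close>.\<close>
    have "\<exists>y\<in>F. g x y \<le> ?lo + e" if x: "x \<in> A" for x
    proof (rule ccontr)
      assume "\<not> (\<exists>y\<in>F. g x y \<le> ?lo + e)"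
      then have gt: "?lo + e < g x y" if "y \<in> F" for y
        using that by force
      define r where "r = Min ((\<lambda>y. g x y) ` F)"
      have r: "?lo + e < r"
        using gt F(1) \<open>F \<noteq> {}\<close> by (auto simp: r_def)
      have "r - e \<le> ?lo"
      proof (rule guarantee_le_sup_inf[OF bd x ne(2)])
        fix b assume "b \<in> B"
        then obtain b' where "b' \<in> F" "\<bar>g x b - g x b'\<bar> \<le> e"
          using F(3) x by blast
        moreover have "r \<le> g x b'"
          using \<open>b' \<in> F\<close> F(1) by (auto simp: r_def)
        ultimately show "r - e \<le> g x b"
          by linarith
      qed
      with r show False by simp
    qed
    moreover have "concavelike A F g"
      using conc F(2) unfolding concavelike_def by (meson subsetD)
    ultimately obtain p where p: "\<forall>y\<in>F. 0 \<le> p y" "sum p F = 1" "\<forall>x\<in>A. (\<Sum>y\<in>F. p y * g x y) \<le> ?lo + e"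
      using concavelike_finite[OF F(1) \<open>F \<noteq> {}\<close>, of A g "?lo + e"] by blast
    \<comment> \<open>With the sign reversed and the players exchanged, domination turns the mixture
      \<open>p\<close> into a single column.\<close>
    obtain y where y: "y \<in> B" "\<forall>x\<in>A. (\<Sum>b\<in>F. p b * - g x b) \<le> - g x y"
      using concavelike_sum[OF F(1) \<open>F \<noteq> {}\<close> F(2) conv, of p] p by blast
    have "?up \<le> (SUP a\<in>A. g a y)"
    proof (intro cINF_lower y bdd_belowI2[where m="-C"])
      obtain a where a: "a \<in> A"
        using ne by auto
      fix b assume b: "b \<in> B"
      have "-C \<le> g a b"
        using bd[OF a b] by linarith
      also have "\<dots> \<le> (SUP a\<in>A. g a b)"
        using bd a b by (intro cSUP_upper bdd_aboveI2[where M=C]) (auto simp: abs_le_iff)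
      finally show "-C \<le> (SUP a\<in>A. g a b)" .
    qed
    also have "\<dots> \<le> ?lo + e"
    proof (intro cSUP_least ne)
      fix a assume "a \<in> A"
      then show "g a y \<le> ?lo + e"
        using y p by (fastforce simp: sum_negf)
    qed
    finally show ?thesis .
  qed
  then have "?up \<le> ?lo"
    by (rule field_le_epsilon)
  then have "?up = ?lo"
    using sup_inf_le_inf_sup[of A B g C] ne bd by (intro antisym) auto
  then show ?thesis
    by (simp add: has_value_def is_value_def)
qed


section \<open>Law of the histories\<close>

definition hist :: "nat \<Rightarrow> 'c list set" where
  "hist n = {h. length h = n}"

lemma finite_hist [simp]: "finite (hist n :: 'c::finite list set)"
  using finite_lists_length_eq[of "UNIV :: 'c set" n] by (simp add: hist_def)

lemma hist_0 [simp]: "hist 0 = {[]}"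
  by (auto simp: hist_def)

lemma sum_hist_Suc:
  fixes f :: "'c::finite list \<Rightarrow> real"
  shows "(\<Sum>h\<in>hist (Suc n). f h) = (\<Sum>h\<in>hist n. \<Sum>c\<in>UNIV. f (h @ [c]))"
proof -
  have "(\<Sum>h\<in>hist (Suc n). f h) = (\<Sum>(h, c)\<in>hist n \<times> UNIV. f (h @ [c]))"
    by (rule sum.reindex_bij_witness[where i="\<lambda>(h, c). h @ [c]" and j="\<lambda>h. (butlast h, last h)"])
      (auto simp: hist_def simp flip: length_0_conv)
  then show ?thesis
    by (simp add: sum.cartesian_product)
qed

text \<open>The realization weight that a behaviour strategy puts on a history; \<open>f\<close> selects the player's own actions.\<close>

definition lik :: "('c \<Rightarrow> 'a) \<Rightarrow> ('c list \<Rightarrow> 'a pmf) \<Rightarrow> 'c list \<Rightarrow> real" where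
  "lik f s h = (\<Prod>m<length h. pmf (s (take m h)) (f (h ! m)))"

lemma lik_Nil [simp]: "lik f s [] = 1"
  by (simp add: lik_def)

lemma lik_snoc [simp]: "lik f s (h @ [c]) = lik f s h * pmf (s h) (f c)"
  by (simp add: lik_def nth_append)

lemma lik_nonneg [simp]: "0 \<le> lik f s h"
  by (simp add: lik_def prod_nonneg)

lemma lik_le_1: "lik f s h \<le> 1"
  unfolding lik_def by (intro prod_le_1) (auto simp: pmf_le_1)

lemma sum_pmf_UNIV [simp]: "(\<Sum>a\<in>UNIV. pmf p a) = 1" for p :: "'a::finite pmf"
  by (rule sum_pmf_eq_1) auto

lemma sum_UNIV_prod: "(\<Sum>c\<in>UNIV. f c) = (\<Sum>a\<in>UNIV. \<Sum>b\<in>UNIV. f (a, b))"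
  for f :: "'a::finite \<times> 'b::finite \<Rightarrow> real"
  by (simp add: sum.cartesian_product flip: UNIV_Times_UNIV)

lemma sum_lik_lik:
  fixes s :: "('i::finite \<times> 'j::finite) list \<Rightarrow> 'i pmf"
  shows "(\<Sum>h\<in>hist n. lik fst s h * lik snd t h) = 1"
proof (induction n)
  case (Suc n)
  have "(\<Sum>c\<in>UNIV. lik fst s (h @ [c]) * lik snd t (h @ [c])) = lik fst s h * lik snd t h" for h
  proof -
    have "(\<Sum>c\<in>UNIV. lik fst s (h @ [c]) * lik snd t (h @ [c]))
        = (\<Sum>a\<in>UNIV. lik fst s h * lik snd t h * pmf (s h) a * (\<Sum>b\<in>UNIV. pmf (t h) b))"
      unfolding sum_UNIV_prod sum_distrib_left by (intro sum.cong) (auto simp: mult_ac)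
    then show ?thesis
      by (simp flip: sum_distrib_left)
  qed
  with Suc show ?case
    by (simp add: sum_hist_Suc)
qed simp

definition stage_payoff ::
  "('i::finite \<Rightarrow> 'j::finite \<Rightarrow> real) \<Rightarrow> (('i \<times> 'j) list \<Rightarrow> 'i pmf) \<Rightarrow> (('i \<times> 'j) list \<Rightarrow> 'j pmf) \<Rightarrow> nat \<Rightarrow> real"
  where "stage_payoff g s t m = (\<Sum>h\<in>hist m. lik fst s h * lik snd t h * mixed_payoff g (s h) (t h))"

text \<open>Evaluated at the drawn pair instead of the mixed actions, the payoff becomes linear in
  each player's \<open>lik\<close>. Mixtures of strategies and the continuity estimate are handled
  in this form.\<close>

lemma stage_payoff_last:
  "stage_payoff g s t m = (\<Sum>h\<in>hist (Suc m). lik fst s h * lik snd t h * g (fst (last h)) (snd (last h)))"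
  unfolding stage_payoff_def sum_hist_Suc mixed_payoff_def
  by (simp add: sum_UNIV_prod sum_distrib_left sum_distrib_right mult_ac)

lemma abs_mixed_payoff_le:
  fixes g :: "'i::finite \<Rightarrow> 'j::finite \<Rightarrow> real"
  assumes "\<And>i j. \<bar>g i j\<bar> \<le> B"
  shows "\<bar>mixed_payoff g a b\<bar> \<le> B"
proof -
  have "\<bar>mixed_payoff g a b\<bar> \<le> (\<Sum>i\<in>UNIV. \<Sum>j\<in>UNIV. pmf a i * (pmf b j * B))"
    unfolding mixed_payoff_def
    by (intro order_trans[OF sum_abs] sum_mono)
      (auto simp: abs_mult mult.assoc intro!: mult_left_mono assms)
  also have "\<dots> = B"
    by (simp flip: sum_distrib_left sum_distrib_right)
  finally show ?thesis .
qed

lemma abs_stage_payoff_le: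
  assumes "\<And>i j. \<bar>g i j\<bar> \<le> B"
  shows "\<bar>stage_payoff g s t m\<bar> \<le> B"
proof -
  have "\<bar>stage_payoff g s t m\<bar> \<le> (\<Sum>h\<in>hist m. lik fst s h * lik snd t h * B)"
    unfolding stage_payoff_def
    by (intro order_trans[OF sum_abs] sum_mono)
      (auto simp: abs_mult intro!: mult_left_mono abs_mixed_payoff_le assms)
  also have "\<dots> = B"
    by (simp add: sum_lik_lik flip: sum_distrib_right)
  finally show ?thesis .
qed

context
  fixes s :: "('i::finite \<times> 'j::finite) list \<Rightarrow> 'i pmf" and t :: "('i \<times> 'j) list \<Rightarrow> 'j pmf"
begin

interpretation IT: Ionescu_Tulcea "stage_kernel s t" "\<lambda>_. count_space UNIV"
  by (rule Ionescu_Tulcea_stage_kernel)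

lemma sets_PiM_singleton:
  fixes f :: "nat \<Rightarrow> 'i \<times> 'j"
  assumes "f \<in> space (PiM {0..<n} (\<lambda>_. count_space UNIV))"
  shows "{f} \<in> sets (PiM {0..<n} (\<lambda>_. count_space UNIV))"
proof -
  have "PiE {0..<n} (\<lambda>i. {f i}) \<in> sets (PiM {0..<n} (\<lambda>_. count_space UNIV))"
    by (intro sets_PiM_I_finite) auto
  also have "PiE {0..<n} (\<lambda>i. {f i}) = {f}"
    using assms PiE_singleton[of f "{0..<n}"] by (simp add: space_PiM PiE_iff)
  finally show ?thesis .
qed

text \<open>All coordinates are discrete, so the law of the first \<open>n\<close> pairs is known
  from its atoms, and these multiply along the kernels.\<close>

lemma emeasure_C_singleton:
  assumes "f \<in> space (PiM {0..<n} (\<lambda>_. count_space UNIV))"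
  shows "emeasure (IT.C 0 n (\<lambda>_. undefined)) {f} =
    ennreal (lik fst s (map f [0..<n]) * lik snd t (map f [0..<n]))"
  using assms
proof (induction n arbitrary: f)
  case 0
  then have "f = (\<lambda>_. undefined)"
    by (auto simp: space_PiM)
  then show ?case
    by (auto simp: PiM_empty)
next
  case (Suc n)
  let ?u = "\<lambda>_. undefined :: 'i \<times> 'j" and ?M = "\<lambda>n. PiM {0..<n} (\<lambda>_. count_space UNIV) :: (nat \<Rightarrow> 'i \<times> 'j) measure"
  let ?r = "restrict f {0..<n}" and ?h = "map f [0..<n]"
  have u: "?u \<in> space (?M 0)"
    by (auto simp: space_PiM)
  have r: "?r \<in> space (?M n)"
    by (auto simp: space_PiM)
  have fS: "{f} \<in> sets (?M (Suc n))"
    by (rule sets_PiM_singleton[OF Suc.prems])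
  interpret C: prob_space "IT.C 0 n ?u"
    by (rule IT.prob_space_C[OF u])
  \<comment> \<open>Appending a pair to \<open>x\<close> gives \<open>f\<close> only if
    \<open>x\<close> is the restriction of \<open>f\<close>, hence the indicator; the factor is the
    conditional probability of the last pair.\<close>
  have eq: "emeasure (IT.eP n x) {f} = ennreal (pmf (s ?h) (fst (f n)) * pmf (t ?h) (snd (f n))) * indicator {?r} x"
    if x: "x \<in> space (?M n)" for x
  proof -
    have "emeasure (IT.eP n x) {f} = emeasure (stage_kernel s t n x) ((\<lambda>c. x(n := c)) -` {f})"
      using IT.emeasure_eP[OF x fS] by simp
    also have "(\<lambda>c. x(n := c)) -` {f} = (if x = ?r then {f n} else {})"
    proof -
      have "x(n := c) = f \<longleftrightarrow> x = ?r \<and> c = f n" for c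
      proof
        assume "x(n := c) = f"
        then have "f n = c" "\<And>i. i \<noteq> n \<Longrightarrow> f i = x i"
          by auto
        then show "x = ?r \<and> c = f n"
          using x by (auto simp: space_PiM PiE_iff extensional_def fun_eq_iff)
      next
        assume "x = ?r \<and> c = f n"
        then show "x(n := c) = f"
          using Suc.prems by (auto simp: space_PiM PiE_iff extensional_def fun_eq_iff)
      qed
      then show ?thesis
        by (simp add: vimage_def del: atLeastLessThanSuc split: if_split)
    qed
    also have "emeasure (stage_kernel s t n x) \<dots> =
        ennreal (pmf (s ?h) (fst (f n)) * pmf (t ?h) (snd (f n))) * indicator {?r} x"
    proof (cases "x = ?r")
      case True
      have "map x [0..<n] = ?h"
        unfolding True by (intro map_cong) auto
      with True show ?thesis
        by (cases "f n") (simp add: stage_kernel_def emeasure_pmf_single pmf_pair del: map_eq_conv)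
    qed simp
    finally show ?thesis .
  qed
  have "emeasure (IT.C 0 (Suc n) ?u) {f} = (\<integral>\<^sup>+x. emeasure (IT.eP n x) {f} \<partial>IT.C 0 n ?u)"
  proof -
    have "IT.eP n \<in> measurable (IT.C 0 n ?u) (subprob_algebra (?M (Suc n)))"
      using IT.measurable_eP[of n] IT.sets_C[OF u, of n] by (simp cong: measurable_cong_sets)
    then show ?thesis
      using fS C.not_empty by (simp add: emeasure_bind)
  qed
  also have "\<dots> = (\<integral>\<^sup>+x. ennreal (pmf (s ?h) (fst (f n)) * pmf (t ?h) (snd (f n))) * indicator {?r} x \<partial>IT.C 0 n ?u)"
    using IT.space_C[OF u, of n] by (intro nn_integral_cong eq) auto
  also have "\<dots> = ennreal (pmf (s ?h) (fst (f n)) * pmf (t ?h) (snd (f n))) * emeasure (IT.C 0 n ?u) {?r}"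
    using sets_PiM_singleton[OF r] IT.sets_C[OF u, of n] by (intro nn_integral_cmult_indicator) auto
  also have "\<dots> = ennreal (lik fst s (map f [0..<Suc n]) * lik snd t (map f [0..<Suc n]))"
  proof -
    have "map ?r [0..<n] = ?h"
      by (intro map_cong) auto
    note IH = Suc.IH[OF r, unfolded this]
    show ?thesis
      by (simp add: IH mult_ac flip: ennreal_mult)
  qed
  finally show ?case .
qed

lemma play_measure_eq: "play_measure s t = IT.PF.lim"
  by (simp add: play_measure_def)

lemma prob_space_play_measure: "prob_space (play_measure s t)"
proof -
  \<comment> \<open>The total mass is read off the cylinder over no coordinates, whose base is the
    single point \<open>\<lambda>_. undefined\<close>.\<close>
  have u: "(\<lambda>_. undefined :: 'i \<times> 'j) \<in> space (PiM {0..<0::nat} (\<lambda>_. count_space UNIV))"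
    by (auto simp: space_PiM)
  have X: "{\<lambda>_. undefined :: 'i \<times> 'j} \<in> sets (PiM {0..<0::nat} (\<lambda>_. count_space UNIV))"
    using sets_PiM_singleton[OF u] .
  have "emeasure IT.PF.lim (prod_emb UNIV (\<lambda>_. count_space UNIV) {0..<0::nat} {\<lambda>_. undefined}) = 1"
    using IT.lim[OF _ X] IT.emeasure_CI[of "{0..<0::nat}" 0, OF _ X] emeasure_C_singleton[OF u]
    by (simp add: prod_emb_def PiM_empty space_PiM)
  moreover have "prod_emb UNIV (\<lambda>_. count_space UNIV) {0..<0::nat} {\<lambda>_. undefined} = space IT.PF.lim"
    by (auto simp: prod_emb_def space_PiM)
  ultimately show ?thesis
    by (auto simp: play_measure_eq intro: prob_spaceI)
qed

lemma space_play_measure [simp]: "space (play_measure s t) = UNIV"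
  by (simp add: play_measure_eq space_PiM)

lemma cylinder_play_measure:
  "{x. map x [0..<length h] = h} \<in> sets (play_measure s t)"
  "measure (play_measure s t) {x. map x [0..<length h] = h} = lik fst s h * lik snd t h"
proof -
  let ?n = "length h"
  let ?f = "restrict (\<lambda>i. h ! i) {0..<?n}"
  have f: "?f \<in> space (PiM {0..<?n} (\<lambda>_. count_space UNIV))"
    by (auto simp: space_PiM)
  note X = sets_PiM_singleton[OF f]
  have emb: "prod_emb UNIV (\<lambda>_. count_space UNIV) {0..<?n} {?f} = {x. map x [0..<?n] = h}"
  proof -
    have "restrict x {0..<?n} = ?f \<longleftrightarrow> map x [0..<?n] = h" for x
    proof
      assume "restrict x {0..<?n} = ?f"
      then have "x i = h ! i" if "i < ?n" for i
        using that by (metis atLeastLessThan_iff restrict_apply' zero_le)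
      then show "map x [0..<?n] = h"
        by (intro nth_equalityI) auto
    next
      assume eq: "map x [0..<?n] = h"
      have "x i = h ! i" if "i < ?n" for i
        using that arg_cong[OF eq, of "\<lambda>l. l ! i"] by simp
      then show "restrict x {0..<?n} = ?f"
        by (intro restrict_ext) auto
    qed
    then show ?thesis
      by (auto simp: prod_emb_def space_PiM vimage_def)
  qed
  have "prod_emb UNIV (\<lambda>_. count_space UNIV) {0..<?n} {?f} \<in> sets IT.PF.lim"
    using measurable_prod_emb[OF _ X, of UNIV] by simp
  then show "{x. map x [0..<?n] = h} \<in> sets (play_measure s t)"
    by (simp add: emb play_measure_eq)
  have "prod_emb {0..<?n} (\<lambda>_. count_space UNIV) {0..<?n} {?f} = {?f}"
    using sets.sets_into_space[OF X] by (intro prod_emb_id) (auto simp: space_PiM)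
  then have "emeasure IT.PF.lim {x. map x [0..<?n] = h} = ennreal (lik fst s (map ?f [0..<?n]) * lik snd t (map ?f [0..<?n]))"
    using IT.lim[OF _ X] IT.emeasure_CI[OF _ X, of ?n] emeasure_C_singleton[OF f] emb by simp
  also have "map ?f [0..<?n] = h"
    by (intro nth_equalityI) auto
  finally show "measure (play_measure s t) {x. map x [0..<?n] = h} = lik fst s h * lik snd t h"
    by (simp add: measure_def play_measure_eq)
qed

end


section \<open>Payoffs of the repeated game\<close>

text \<open>The payoff of stage \<open>m\<close> is a finite step function over the cylinders of
  length \<open>Suc m\<close>, whose masses are products of likelihoods.\<close>

lemma integral_play_measure:
  fixes s :: "('i::finite \<times> 'j::finite) list \<Rightarrow> 'i pmf" and g :: "'i \<Rightarrow> 'j \<Rightarrow> real"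
  shows "integrable (play_measure s t) (\<lambda>x. g (fst (x m)) (snd (x m)))"
    and "(\<integral>x. g (fst (x m)) (snd (x m)) \<partial>play_measure s t) = stage_payoff g s t m"
proof -
  interpret prob_space "play_measure s t"
    by (rule prob_space_play_measure)
  let ?Z = "\<lambda>h. {x :: nat \<Rightarrow> 'i \<times> 'j. map x [0..<Suc m] = h}"
  have Z: "?Z h \<in> sets (play_measure s t)" "measure (play_measure s t) (?Z h) = lik fst s h * lik snd t h"
    if "h \<in> hist (Suc m)" for h
    using cylinder_play_measure(1)[of h s t] cylinder_play_measure(2)[of s t h] that by (auto simp: hist_def)
  have eq: "g (fst (x m)) (snd (x m)) = (\<Sum>h\<in>hist (Suc m). g (fst (last h)) (snd (last h)) * indicator (?Z h) x)" for x
  proof -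
    have "(\<Sum>h\<in>hist (Suc m). g (fst (last h)) (snd (last h)) * indicator (?Z h) x) =
        (\<Sum>h\<in>{map x [0..<Suc m]}. g (fst (last h)) (snd (last h)) * indicator (?Z h) x)"
      by (intro sum.mono_neutral_right finite_hist) (auto simp: hist_def)
    then show ?thesis by simp
  qed
  have int: "integrable (play_measure s t) (\<lambda>x. g (fst (last h)) (snd (last h)) * indicator (?Z h) x)"
    if "h \<in> hist (Suc m)" for h
    using Z(1)[OF that] by (intro integrable_mult_right integrable_real_indicator) (simp_all add: emeasure_eq_measure)
  show "integrable (play_measure s t) (\<lambda>x. g (fst (x m)) (snd (x m)))"
    unfolding eq using int by (rule Bochner_Integration.integrable_sum)
  have "(\<integral>x. g (fst (x m)) (snd (x m)) \<partial>play_measure s t)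
      = (\<Sum>h\<in>hist (Suc m). \<integral>x. g (fst (last h)) (snd (last h)) * indicator (?Z h) x \<partial>play_measure s t)"
    unfolding eq using int by (rule Bochner_Integration.integral_sum)
  also have "\<dots> = stage_payoff g s t m"
    unfolding stage_payoff_last
    by (intro sum.cong refl) (simp add: Z mult_ac del: upt_Suc)
  finally show "(\<integral>x. g (fst (x m)) (snd (x m)) \<partial>play_measure s t) = stage_payoff g s t m" .
qed

lemma summable_weighted:
  fixes w a :: "nat \<Rightarrow> real"
  assumes "summable w" "\<And>m. 0 \<le> w m" "\<And>m. \<bar>a m\<bar> \<le> B"
  shows "summable (\<lambda>m. \<bar>w m * a m\<bar>)" "summable (\<lambda>m. w m * a m)"
proof -
  show "summable (\<lambda>m. \<bar>w m * a m\<bar>)"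
    using assms by (intro summable_comparison_test'[OF summable_mult2[OF assms(1), of B]])
      (auto simp: abs_mult intro!: mult_left_mono)
  then show "summable (\<lambda>m. w m * a m)"
    by (rule summable_rabs_cancel)
qed

text \<open>General summable weights, so that truncated weights and block lengths can stand in for
  \<theta>.\<close>

definition weighted_payoff ::
  "('k::finite \<Rightarrow> 'l::finite \<Rightarrow> 'i::finite \<Rightarrow> 'j::finite \<Rightarrow> real) \<Rightarrow> ('k \<times> 'l) pmf \<Rightarrow> (nat \<Rightarrow> real) \<Rightarrow>
   ('k \<Rightarrow> ('i \<times> 'j) list \<Rightarrow> 'i pmf) \<Rightarrow> ('l \<Rightarrow> ('i \<times> 'j) list \<Rightarrow> 'j pmf) \<Rightarrow> real" where
  "weighted_payoff G \<pi> w \<sigma> \<tau> =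
     (\<Sum>(k, l)\<in>UNIV. pmf \<pi> (k, l) * (\<Sum>m. w m * stage_payoff (G k l) (\<sigma> k) (\<tau> l) m))"

lemma ex_payoff_bound:
  fixes G :: "'k::finite \<Rightarrow> 'l::finite \<Rightarrow> 'i::finite \<Rightarrow> 'j::finite \<Rightarrow> real"
  obtains B where "0 \<le> B" "\<And>k l i j. \<bar>G k l i j\<bar> \<le> B"
proof
  let ?B = "\<Sum>(k, l, i, j)\<in>UNIV. \<bar>G k l i j\<bar>"
  show "0 \<le> ?B"
    by (intro sum_nonneg) auto
  show "\<bar>G k l i j\<bar> \<le> ?B" for k l i j
    using member_le_sum[of "(k, l, i, j)" UNIV "\<lambda>(k, l, i, j). \<bar>G k l i j\<bar>"] by auto
qed

lemma pmf_nat_sums: "pmf (\<theta> :: nat pmf) sums 1"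
proof -
  have "(\<lambda>m. measure (measure_pmf \<theta>) {m}) sums measure (measure_pmf \<theta>) (\<Union>m. {m})"
    by (rule measure_pmf.finite_measure_UNION) (auto simp: disjoint_family_on_def)
  then show ?thesis
    by (simp add: measure_pmf_single)
qed

lemma repeated_payoff_eq: "repeated_payoff G \<pi> \<theta> \<sigma> \<tau> = weighted_payoff G \<pi> (pmf \<theta>) \<sigma> \<tau>"
proof -
  obtain B where B: "0 \<le> B" "\<And>k l i j. \<bar>G k l i j\<bar> \<le> B"
    using ex_payoff_bound by blast
  note sm = sums_summable[OF pmf_nat_sums[of \<theta>]]
  have "(\<integral>x. (\<Sum>m. pmf \<theta> m * G k l (fst (x m)) (snd (x m))) \<partial>play_measure (\<sigma> k) (\<tau> l)) =
      (\<Sum>m. pmf \<theta> m * stage_payoff (G k l) (\<sigma> k) (\<tau> l) m)" for k l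
  proof -
    interpret prob_space "play_measure (\<sigma> k) (\<tau> l)"
      by (rule prob_space_play_measure)
    note I = integral_play_measure[of "\<sigma> k" "\<tau> l" "G k l"]
    have "(\<integral>x. (\<Sum>m. pmf \<theta> m * G k l (fst (x m)) (snd (x m))) \<partial>play_measure (\<sigma> k) (\<tau> l)) =
        (\<Sum>m. \<integral>x. pmf \<theta> m * G k l (fst (x m)) (snd (x m)) \<partial>play_measure (\<sigma> k) (\<tau> l))"
    proof (rule integral_suminf)
      show "integrable (play_measure (\<sigma> k) (\<tau> l)) (\<lambda>x. pmf \<theta> m * G k l (fst (x m)) (snd (x m)))" for m
        using I(1) by (rule integrable_mult_right)
      show "AE x in play_measure (\<sigma> k) (\<tau> l). summable (\<lambda>m. norm (pmf \<theta> m * G k l (fst (x m)) (snd (x m))))"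
        using summable_weighted(1)[OF sm _ B(2)] by simp
      show "summable (\<lambda>m. \<integral>x. norm (pmf \<theta> m * G k l (fst (x m)) (snd (x m))) \<partial>play_measure (\<sigma> k) (\<tau> l))"
      proof (rule summable_comparison_test'[OF summable_mult2[OF sm, of B]])
        fix m :: nat
        have "(\<integral>x. norm (pmf \<theta> m * G k l (fst (x m)) (snd (x m))) \<partial>play_measure (\<sigma> k) (\<tau> l)) \<le> pmf \<theta> m * B"
          using I(1)[of m] by (intro integral_le_const integrable_norm integrable_mult_right)
            (auto simp: abs_mult intro!: mult_left_mono B)
        then show "norm (\<integral>x. norm (pmf \<theta> m * G k l (fst (x m)) (snd (x m))) \<partial>play_measure (\<sigma> k) (\<tau> l)) \<le> pmf \<theta> m * B"
          by simp
      qed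
    qed
    then show ?thesis
      by (simp add: I(2))
  qed
  then show ?thesis
    by (simp add: repeated_payoff_def weighted_payoff_def)
qed

lemma abs_sum_pmf_le:
  fixes \<pi> :: "('k::finite \<times> 'l::finite) pmf"
  assumes "\<And>k l. \<bar>a k l\<bar> \<le> B"
  shows "\<bar>\<Sum>(k, l)\<in>UNIV. pmf \<pi> (k, l) * a k l\<bar> \<le> B"
proof -
  have "\<bar>\<Sum>(k, l)\<in>UNIV. pmf \<pi> (k, l) * a k l\<bar> \<le> (\<Sum>x\<in>UNIV. pmf \<pi> x * B)"
    by (intro order_trans[OF sum_abs] sum_mono) (auto simp: abs_mult intro!: mult_left_mono assms)
  also have "\<dots> = B"
    by (simp flip: sum_distrib_right)
  finally show ?thesis .
qed

lemma abs_weighted_suminf_le: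
  fixes w a :: "nat \<Rightarrow> real"
  assumes "summable (\<lambda>m. \<bar>w m\<bar>)" "\<And>m. \<bar>a m\<bar> \<le> B"
  shows "\<bar>\<Sum>m. w m * a m\<bar> \<le> B * (\<Sum>m. \<bar>w m\<bar>)"
proof -
  have "summable (\<lambda>m. \<bar>\<bar>w m\<bar> * a m\<bar>)"
    by (rule summable_weighted(1)[OF assms(1) _ assms(2)]) simp
  then have s: "summable (\<lambda>m. \<bar>w m * a m\<bar>)"
    by (simp add: abs_mult)
  have "\<bar>\<Sum>m. w m * a m\<bar> \<le> (\<Sum>m. \<bar>w m * a m\<bar>)"
    using s by (rule summable_rabs)
  also have "\<dots> \<le> (\<Sum>m. B * \<bar>w m\<bar>)"
    using assms by (intro suminf_le s summable_mult) (auto simp: abs_mult mult.commute[of B] intro!: mult_left_mono)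
  also have "\<dots> = B * (\<Sum>m. \<bar>w m\<bar>)"
    using assms(1) by (rule suminf_mult)
  finally show ?thesis .
qed

lemma weighted_payoff_diff_le:
  assumes "\<And>k l i j. \<bar>G k l i j\<bar> \<le> B" "summable w" "\<And>m. 0 \<le> w m" "summable w'" "\<And>m. 0 \<le> w' m"
  shows "\<bar>weighted_payoff G \<pi> w \<sigma> \<tau> - weighted_payoff G \<pi> w' \<sigma> \<tau>\<bar> \<le> B * (\<Sum>m. \<bar>w m - w' m\<bar>)"
proof -
  have st: "\<bar>stage_payoff (G k l) (\<sigma> k) (\<tau> l) m\<bar> \<le> B" for k l m
    by (intro abs_stage_payoff_le assms)
  have s: "summable (\<lambda>m. \<bar>w m - w' m\<bar>)"
    using assms by (intro summable_comparison_test'[OF summable_add[OF assms(2,4)]])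
      (auto intro: order_trans[OF abs_triangle_ineq4])
  have "weighted_payoff G \<pi> w \<sigma> \<tau> - weighted_payoff G \<pi> w' \<sigma> \<tau> =
      (\<Sum>(k, l)\<in>UNIV. pmf \<pi> (k, l) * (\<Sum>m. (w m - w' m) * stage_payoff (G k l) (\<sigma> k) (\<tau> l) m))"
    unfolding weighted_payoff_def sum_subtractf[symmetric]
    by (intro sum.cong)
      (auto simp: left_diff_distrib suminf_diff[OF summable_weighted(2)[OF assms(2,3) st] summable_weighted(2)[OF assms(4,5) st], symmetric] right_diff_distrib)
  then show ?thesis
    using abs_weighted_suminf_le[OF s st] by (auto intro!: abs_sum_pmf_le)
qed

lemma abs_weighted_payoff_le:
  assumes "\<And>k l i j. \<bar>G k l i j\<bar> \<le> B" "summable w" "\<And>m. 0 \<le> w m"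
  shows "\<bar>weighted_payoff G \<pi> w \<sigma> \<tau>\<bar> \<le> B * (\<Sum>m. w m)"
  using weighted_payoff_diff_le[OF assms, where w'="\<lambda>_. 0" and \<pi>=\<pi> and \<sigma>=\<sigma> and \<tau>=\<tau>] assms(3)
  by (simp add: weighted_payoff_def case_prod_unfold)

section \<open>Mixtures of behaviour strategies and the value of the repeated game\<close>

text \<open>The posterior average of the \<open>p k\<close>. The multiplied form stays meaningful
  when the total weight vanishes, where any \<open>q\<close> will do.\<close>

lemma mixture_pmf_exists:
  fixes w :: "'k::finite \<Rightarrow> real" and p :: "'k \<Rightarrow> 'a::finite pmf"
  assumes "\<And>k. 0 \<le> w k"
  shows "\<exists>q. \<forall>a. (\<Sum>k\<in>UNIV. w k) * pmf q a = (\<Sum>k\<in>UNIV. w k * pmf (p k) a)"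
proof (cases "(\<Sum>k\<in>UNIV. w k) = 0")
  case True
  then have "\<forall>k. w k = 0"
    using assms by (subst (asm) sum_nonneg_eq_0_iff) auto
  then show ?thesis by simp
next
  case False
  let ?S = "\<Sum>k\<in>UNIV. w k"
  let ?f = "\<lambda>a. (\<Sum>k\<in>UNIV. w k * pmf (p k) a) / ?S"
  have S: "?S > 0"
    using False assms by (simp add: less_le sum_nonneg)
  have nn: "0 \<le> ?f a" for a
    using assms S by (intro divide_nonneg_pos sum_nonneg) auto
  have "(\<Sum>a\<in>UNIV. ?f a) = (\<Sum>a\<in>UNIV. \<Sum>k\<in>UNIV. w k * pmf (p k) a) / ?S"
    by (rule sum_divide_distrib[symmetric])
  also have "(\<Sum>a\<in>UNIV. \<Sum>k\<in>UNIV. w k * pmf (p k) a) = (\<Sum>k\<in>UNIV. \<Sum>a\<in>UNIV. w k * pmf (p k) a)"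
    by (rule sum.swap)
  also have "\<dots> = ?S"
    by (simp flip: sum_distrib_left)
  finally have "(\<integral>\<^sup>+a. ennreal (?f a) \<partial>count_space UNIV) = 1"
    using S nn by (subst nn_integral_count_space_finite) (simp_all add: sum_ennreal)
  then have "pmf (embed_pmf ?f) a = ?f a" for a
    using nn by (simp add: pmf_embed_pmf)
  with False show ?thesis
    by (intro exI[of _ "embed_pmf ?f"]) simp
qed

text \<open>This convexity of realization plans takes the place of Kuhn's theorem.\<close>

lemma behaviour_mixture_exists:
  fixes s s' :: "'c list \<Rightarrow> 'a::finite pmf"
  assumes \<mu>: "0 \<le> \<mu>" "\<mu> \<le> 1"
  shows "\<exists>s''. \<forall>h. lik f s'' h = \<mu> * lik f s h + (1 - \<mu>) * lik f s' h"
proof -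
  \<comment> \<open>The booleans index the two strategies; \<open>w h b\<close> is prior times
    likelihood, so \<open>s''\<close> plays their posterior average. The total weight after
    \<open>h\<close> is by induction \<open>lik f s'' h\<close>, which makes the recursion
    close.\<close>
  define w where "w h b = (if b then \<mu> * lik f s h else (1 - \<mu>) * lik f s' h)" for h b
  have "\<forall>h. \<exists>q. \<forall>a. (\<Sum>b\<in>UNIV. w h b) * pmf q a = (\<Sum>b\<in>UNIV. w h b * pmf (if b then s h else s' h) a)"
    using \<mu> by (intro allI mixture_pmf_exists) (auto simp: w_def)
  then obtain s'' where s'': "\<And>h a. (\<Sum>b\<in>UNIV. w h b) * pmf (s'' h) a = (\<Sum>b\<in>UNIV. w h b * pmf (if b then s h else s' h) a)"
    by metis
  have "lik f s'' h = \<mu> * lik f s h + (1 - \<mu>) * lik f s' h" for h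
  proof (induction h rule: rev_induct)
    case (snoc c h)
    have "(\<Sum>b\<in>UNIV. w h b) = lik f s'' h"
      by (simp add: UNIV_bool w_def snoc)
    then show ?case
      using s''[of h "f c"] by (simp add: UNIV_bool w_def)
  qed simp
  then show ?thesis by blast
qed

text \<open>Total boundedness by rounding: only finitely many vectors of floors occur, and one
  representative of each is kept.\<close>

lemma finite_grid:
  fixes \<phi> :: "'b \<Rightarrow> 'e \<Rightarrow> real"
  assumes "finite E" "\<And>b e. 0 \<le> \<phi> b e" "\<And>b e. \<phi> b e \<le> 1" "0 < \<delta>"
  shows "\<exists>F. finite F \<and> (\<forall>b. \<exists>b'\<in>F. \<forall>e\<in>E. \<bar>\<phi> b e - \<phi> b' e\<bar> \<le> \<delta>)"
proof -
  let ?c = "\<lambda>b. restrict (\<lambda>e. \<lfloor>\<phi> b e / \<delta>\<rfloor>) E"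
  have "\<lfloor>\<phi> b e / \<delta>\<rfloor> \<in> {0..\<lfloor>1 / \<delta>\<rfloor>}" for b e
    using assms floor_mono[OF divide_right_mono[of "\<phi> b e" 1 \<delta>]] by auto
  then have "range ?c \<subseteq> PiE E (\<lambda>_. {0..\<lfloor>1 / \<delta>\<rfloor>})"
    by (intro image_subsetI PiE_I) (auto simp del: atLeastAtMost_iff)
  moreover have "finite (PiE E (\<lambda>_. {0..\<lfloor>1 / \<delta>\<rfloor>}))"
    using assms(1) by (intro finite_PiE) simp_all
  ultimately have "finite (range ?c)"
    by (rule finite_subset)
  then obtain F where F: "finite F" "range ?c = ?c ` F"
    using finite_subset_image[of "range ?c" ?c UNIV] by auto
  have "\<exists>b'\<in>F. \<forall>e\<in>E. \<bar>\<phi> b e - \<phi> b' e\<bar> \<le> \<delta>" for b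
  proof -
    obtain b' where b': "b' \<in> F" "?c b = ?c b'"
      using F(2) by blast
    have "\<bar>\<phi> b e - \<phi> b' e\<bar> \<le> \<delta>" if "e \<in> E" for e
    proof -
      have "\<lfloor>\<phi> b e / \<delta>\<rfloor> = \<lfloor>\<phi> b' e / \<delta>\<rfloor>"
        using fun_cong[OF b'(2), of e] that by simp
      then have "\<bar>\<phi> b e / \<delta> - \<phi> b' e / \<delta>\<bar> \<le> 1"
        by linarith
      then show ?thesis
        using \<open>0 < \<delta>\<close> by (simp add: abs_le_iff field_simps)
    qed
    with b'(1) show ?thesis by blast
  qed
  with F(1) show ?thesis by blast
qed

lemma stage_payoff_mixture1:
  assumes "\<And>h. lik fst s'' h = \<mu> * lik fst s h + (1 - \<mu>) * lik fst s' h"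
  shows "stage_payoff g s'' t m = \<mu> * stage_payoff g s t m + (1 - \<mu>) * stage_payoff g s' t m"
  unfolding stage_payoff_last assms
  by (simp add: sum_distrib_left algebra_simps flip: sum.distrib)

lemma stage_payoff_mixture2:
  assumes "\<And>h. lik snd t'' h = \<mu> * lik snd t h + (1 - \<mu>) * lik snd t' h"
  shows "stage_payoff g s t'' m = \<mu> * stage_payoff g s t m + (1 - \<mu>) * stage_payoff g s t' m"
  unfolding stage_payoff_last assms
  by (simp add: sum_distrib_left algebra_simps flip: sum.distrib)

lemma weighted_payoff_mixture:
  assumes "summable w" "\<And>m. 0 \<le> w m"
    and st: "\<And>k l m. stage_payoff (G k l) (\<sigma>'' k) (\<tau>'' l) m =
      \<mu> * stage_payoff (G k l) (\<sigma> k) (\<tau> l) m + (1 - \<mu>) * stage_payoff (G k l) (\<sigma>' k) (\<tau>' l) m"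
  shows "weighted_payoff G \<pi> w \<sigma>'' \<tau>'' = \<mu> * weighted_payoff G \<pi> w \<sigma> \<tau> + (1 - \<mu>) * weighted_payoff G \<pi> w \<sigma>' \<tau>'"
proof -
  obtain B where B: "0 \<le> B" "\<And>k l i j. \<bar>G k l i j\<bar> \<le> B"
    using ex_payoff_bound by blast
  note sm = summable_weighted(2)[OF assms(1,2) abs_stage_payoff_le[OF B(2)]]
  have "(\<Sum>m. w m * stage_payoff (G k l) (\<sigma>'' k) (\<tau>'' l) m) =
      \<mu> * (\<Sum>m. w m * stage_payoff (G k l) (\<sigma> k) (\<tau> l) m) + (1 - \<mu>) * (\<Sum>m. w m * stage_payoff (G k l) (\<sigma>' k) (\<tau>' l) m)"
    for k l
  proof -
    have "(\<Sum>m. w m * stage_payoff (G k l) (\<sigma>'' k) (\<tau>'' l) m) =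
        (\<Sum>m. \<mu> * (w m * stage_payoff (G k l) (\<sigma> k) (\<tau> l) m) + (1 - \<mu>) * (w m * stage_payoff (G k l) (\<sigma>' k) (\<tau>' l) m))"
      by (intro suminf_cong) (simp add: st algebra_simps)
    then show ?thesis
      by (simp add: sm suminf_mult summable_mult flip: suminf_add)
  qed
  note eq = this
  show ?thesis
    unfolding weighted_payoff_def sum_distrib_left sum.distrib[symmetric]
    by (intro sum.cong) (auto simp: eq algebra_simps)
qed

lemma stage_payoff_diff_le:
  fixes g :: "'i::finite \<Rightarrow> 'j::finite \<Rightarrow> real"
  assumes "\<And>i j. \<bar>g i j\<bar> \<le> B" "\<And>h. h \<in> hist (Suc m) \<Longrightarrow> \<bar>lik snd t h - lik snd t' h\<bar> \<le> \<delta>"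
  shows "\<bar>stage_payoff g s t m - stage_payoff g s t' m\<bar> \<le> real (card (hist (Suc m) :: ('i \<times> 'j) list set)) * (B * \<delta>)"
proof -
  have eq: "stage_payoff g s t m - stage_payoff g s t' m =
      (\<Sum>h\<in>hist (Suc m). lik fst s h * (g (fst (last h)) (snd (last h)) * (lik snd t h - lik snd t' h)))"
    unfolding stage_payoff_last by (simp add: algebra_simps flip: sum_subtractf)
  have "\<bar>stage_payoff g s t m - stage_payoff g s t' m\<bar> \<le> (\<Sum>h\<in>(hist (Suc m) :: ('i \<times> 'j) list set). B * \<delta>)"
    unfolding eq
  proof (intro order_trans[OF sum_abs] sum_mono)
    fix h :: "('i \<times> 'j) list" assume h: "h \<in> hist (Suc m)"
    have "\<bar>lik fst s h * (g (fst (last h)) (snd (last h)) * (lik snd t h - lik snd t' h))\<bar>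
        \<le> 1 * (B * \<delta>)"
      unfolding abs_mult
      using assms(1)[of "fst (last h)" "snd (last h)"] assms(2)[OF h] lik_le_1[of fst s h]
      by (intro mult_mono mult_nonneg_nonneg) auto
    then show "\<bar>lik fst s h * (g (fst (last h)) (snd (last h)) * (lik snd t h - lik snd t' h))\<bar> \<le> B * \<delta>"
      by simp
  qed
  then show ?thesis by simp
qed

text \<open>Concavity and convexity come from mixing realization weights. The net exists because, up
  to a small tail of the weights, the payoff depends on finitely many likelihoods, all between 0 and
  1.\<close>

theorem weighted_payoff_has_value:
  fixes G :: "'k::finite \<Rightarrow> 'l::finite \<Rightarrow> 'i::finite \<Rightarrow> 'j::finite \<Rightarrow> real"
  assumes w: "summable w" "\<And>m. 0 \<le> w m"
  shows "has_value UNIV UNIV (weighted_payoff G \<pi> w)"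
proof -
  obtain B where B: "0 \<le> B" "\<And>k l i j. \<bar>G k l i j\<bar> \<le> B"
    using ex_payoff_bound by blast
  show ?thesis
  proof (rule minimax_concavelike)
    show "\<bar>weighted_payoff G \<pi> w \<sigma> \<tau>\<bar> \<le> B * (\<Sum>m. w m)" for \<sigma> \<tau>
      by (rule abs_weighted_payoff_le[OF B(2) w])
    show "concavelike UNIV UNIV (weighted_payoff G \<pi> w)"
      unfolding concavelike_def
    proof (intro ballI)
      fix \<sigma> \<sigma>' :: "'k \<Rightarrow> ('i \<times> 'j) list \<Rightarrow> 'i pmf" and \<mu> :: real
      assume "\<mu> \<in> {0..1}"
      then have "\<forall>k. \<exists>s''. \<forall>h. lik fst s'' h = \<mu> * lik fst (\<sigma> k) h + (1 - \<mu>) * lik fst (\<sigma>' k) h"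
        by (intro allI behaviour_mixture_exists) auto
      then obtain \<sigma>'' where "\<And>k h. lik fst (\<sigma>'' k) h = \<mu> * lik fst (\<sigma> k) h + (1 - \<mu>) * lik fst (\<sigma>' k) h"
        by metis
      then have "weighted_payoff G \<pi> w \<sigma>'' \<tau> = \<mu> * weighted_payoff G \<pi> w \<sigma> \<tau> + (1 - \<mu>) * weighted_payoff G \<pi> w \<sigma>' \<tau>" for \<tau>
        by (intro weighted_payoff_mixture w stage_payoff_mixture1)
      then show "\<exists>\<sigma>''\<in>UNIV. \<forall>\<tau>\<in>UNIV. \<mu> * weighted_payoff G \<pi> w \<sigma> \<tau> + (1 - \<mu>) * weighted_payoff G \<pi> w \<sigma>' \<tau> \<le> weighted_payoff G \<pi> w \<sigma>'' \<tau>"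
        by (intro bexI[of _ \<sigma>'']) auto
    qed
    show "concavelike UNIV UNIV (\<lambda>\<tau> \<sigma>. - weighted_payoff G \<pi> w \<sigma> \<tau>)"
      unfolding concavelike_def
    proof (intro ballI)
      fix \<tau> \<tau>' :: "'l \<Rightarrow> ('i \<times> 'j) list \<Rightarrow> 'j pmf" and \<mu> :: real
      assume "\<mu> \<in> {0..1}"
      then have "\<forall>l. \<exists>t''. \<forall>h. lik snd t'' h = \<mu> * lik snd (\<tau> l) h + (1 - \<mu>) * lik snd (\<tau>' l) h"
        by (intro allI behaviour_mixture_exists) auto
      then obtain \<tau>'' where "\<And>l h. lik snd (\<tau>'' l) h = \<mu> * lik snd (\<tau> l) h + (1 - \<mu>) * lik snd (\<tau>' l) h"
        by metis
      then have "weighted_payoff G \<pi> w \<sigma> \<tau>'' = \<mu> * weighted_payoff G \<pi> w \<sigma> \<tau> + (1 - \<mu>) * weighted_payoff G \<pi> w \<sigma> \<tau>'" for \<sigma>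
        by (intro weighted_payoff_mixture w stage_payoff_mixture2)
      then show "\<exists>\<tau>''\<in>UNIV. \<forall>\<sigma>\<in>UNIV. \<mu> * - weighted_payoff G \<pi> w \<sigma> \<tau> + (1 - \<mu>) * - weighted_payoff G \<pi> w \<sigma> \<tau>' \<le> - weighted_payoff G \<pi> w \<sigma> \<tau>''"
        by (intro bexI[of _ \<tau>'']) auto
    qed
    fix e :: real assume e: "e > 0"
    \<comment> \<open>The error splits as \<open>B * e' + e' + B * e'\<close>: truncating the
      weights costs \<open>B * e'\<close> for either strategy, and the grid costs \<open>e'\<close>
      in between.\<close>
    define e' where "e' = e / (2 * B + 1)"
    have e': "e' > 0"
      using e B(1) by (simp add: e'_def)
    obtain N where N: "norm (\<Sum>m. w (m + N)) < e'"
      using suminf_exist_split[OF e' w(1)] by blast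
    define w' where "w' m = (if m < N then w m else 0)" for m
    have w': "summable w'" "\<And>m. 0 \<le> w' m"
      using w summable_finite[of "{..<N}" w'] by (auto simp: w'_def)
    have "summable (\<lambda>m. \<bar>w m - w' m\<bar>)"
      by (rule summable_comparison_test'[OF w(1)]) (auto simp: w'_def w)
    then have "(\<Sum>m. \<bar>w m - w' m\<bar>) = (\<Sum>m. \<bar>w (m + N) - w' (m + N)\<bar>) + (\<Sum>m<N. \<bar>w m - w' m\<bar>)"
      by (rule suminf_split_initial_segment)
    also have "\<dots> = (\<Sum>m. w (m + N))"
      using w by (simp add: w'_def)
    finally have tail: "(\<Sum>m. \<bar>w m - w' m\<bar>) \<le> e'"
      using N by simp
    let ?c = "\<lambda>m. real (card (hist (Suc m) :: ('i \<times> 'j) list set))"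
    define D where "D = (\<Sum>m<N. w m * (?c m * B))"
    have D: "D \<ge> 0"
      unfolding D_def using w B by (intro sum_nonneg mult_nonneg_nonneg) auto
    define \<delta> where "\<delta> = e' / (D + 1)"
    have \<delta>: "\<delta> > 0" "D * \<delta> \<le> e'"
      using e' D by (auto simp: \<delta>_def field_simps)
    \<comment> \<open>Length \<open>N\<close> is included because stage \<open>m\<close> is paid at
      histories of length \<open>Suc m\<close>.\<close>
    let ?E = "UNIV \<times> (\<Union>m\<le>N. hist m) :: ('l \<times> ('i \<times> 'j) list) set"
    have "finite ?E" by simp
    then obtain F where F: "finite F" "\<And>\<tau> :: 'l \<Rightarrow> ('i \<times> 'j) list \<Rightarrow> 'j pmf. \<exists>\<tau>'\<in>F. \<forall>e\<in>?E.
        \<bar>(case e of (l, h) \<Rightarrow> lik snd (\<tau> l) h) - (case e of (l, h) \<Rightarrow> lik snd (\<tau>' l) h)\<bar> \<le> \<delta>"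
      using finite_grid[of ?E "\<lambda>(\<tau> :: 'l \<Rightarrow> ('i \<times> 'j) list \<Rightarrow> 'j pmf) e. case e of (l, h) \<Rightarrow> lik snd (\<tau> l) h" \<delta>] \<delta>(1)
      by (auto simp: lik_le_1)
    have "\<exists>\<tau>'\<in>F. \<forall>\<sigma>. \<bar>weighted_payoff G \<pi> w \<sigma> \<tau> - weighted_payoff G \<pi> w \<sigma> \<tau>'\<bar> \<le> e" for \<tau>
    proof -
      obtain \<tau>' where \<tau>': "\<tau>' \<in> F" "\<And>l h m. m \<le> N \<Longrightarrow> h \<in> hist m \<Longrightarrow> \<bar>lik snd (\<tau> l) h - lik snd (\<tau>' l) h\<bar> \<le> \<delta>"
        using F(2)[of \<tau>] by fastforce
      have "\<bar>weighted_payoff G \<pi> w \<sigma> \<tau> - weighted_payoff G \<pi> w \<sigma> \<tau>'\<bar> \<le> e" for \<sigma>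
      proof -
        have fin: "(\<Sum>m. w' m * a m) = (\<Sum>m<N. w m * a m)" for a
          by (subst suminf_finite[of "{..<N}"]) (auto simp: w'_def)
        have "\<bar>(\<Sum>m<N. w m * stage_payoff (G k l) (\<sigma> k) (\<tau> l) m) - (\<Sum>m<N. w m * stage_payoff (G k l) (\<sigma> k) (\<tau>' l) m)\<bar> \<le> D * \<delta>" for k l
        proof -
          have "\<bar>\<Sum>m<N. w m * (stage_payoff (G k l) (\<sigma> k) (\<tau> l) m - stage_payoff (G k l) (\<sigma> k) (\<tau>' l) m)\<bar>
              \<le> (\<Sum>m<N. w m * (?c m * (B * \<delta>)))"
            using w
            by (intro order_trans[OF sum_abs] sum_mono)
              (auto simp: abs_mult intro!: mult_left_mono stage_payoff_diff_le B \<tau>'(2)[of "Suc _"])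
          also have "\<dots> = D * \<delta>"
            unfolding D_def sum_distrib_right by (intro sum.cong) (auto simp: mult_ac)
          finally show ?thesis
            by (simp add: right_diff_distrib sum_subtractf)
        qed
        note d = this
        have eq: "weighted_payoff G \<pi> w' \<sigma> \<tau> - weighted_payoff G \<pi> w' \<sigma> \<tau>' =
          (\<Sum>(k, l)\<in>UNIV. pmf \<pi> (k, l) * ((\<Sum>m<N. w m * stage_payoff (G k l) (\<sigma> k) (\<tau> l) m) - (\<Sum>m<N. w m * stage_payoff (G k l) (\<sigma> k) (\<tau>' l) m)))"
          unfolding weighted_payoff_def fin sum_subtractf[symmetric]
          by (intro sum.cong) (auto simp: right_diff_distrib sum_subtractf)
        have "\<bar>weighted_payoff G \<pi> w' \<sigma> \<tau> - weighted_payoff G \<pi> w' \<sigma> \<tau>'\<bar> \<le> D * \<delta>"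
          unfolding eq by (rule abs_sum_pmf_le) (rule d)
        then have 1: "\<bar>weighted_payoff G \<pi> w' \<sigma> \<tau> - weighted_payoff G \<pi> w' \<sigma> \<tau>'\<bar> \<le> e'"
          using \<delta>(2) by linarith
        have 2: "\<bar>weighted_payoff G \<pi> w \<sigma> \<rho> - weighted_payoff G \<pi> w' \<sigma> \<rho>\<bar> \<le> B * e'" for \<rho>
          using weighted_payoff_diff_le[OF B(2) w w'] mult_left_mono[OF tail B(1)] by (rule order_trans)
        have "e = B * e' + e' + B * e'"
          using B(1) by (simp add: e'_def field_simps add_nonneg_eq_0_iff)
        with 1 2[of \<tau>] 2[of \<tau>'] show ?thesis
          by linarith
      qed
      with \<tau>'(1) show ?thesis by blast
    qed
    then show "\<exists>F. finite F \<and> F \<subseteq> UNIV \<and> (\<forall>\<tau>\<in>UNIV. \<exists>\<tau>'\<in>F. \<forall>\<sigma>\<in>UNIV. \<bar>weighted_payoff G \<pi> w \<sigma> \<tau> - weighted_payoff G \<pi> w \<sigma> \<tau>'\<bar> \<le> e)"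
      using F(1) by auto
  qed simp_all
qed

section \<open>The price of hiding the type behind the Bayesian mixture\<close>

text \<open>With \<open>A = a * \<bar>p - x\<bar>\<close> and \<open>T = S * x\<close> this is
  \<open>d * A \<le> A^2 / (2 * \<kappa> * T) + \<kappa> * d^2 * T / 2\<close>. The quotient
  \<open>A^2 / T\<close> is written out so that summing over actions gives an increment of the
  potential. If \<open>T\<close> vanishes, so does \<open>a * p\<close>, and division by zero gives
  \<open>0\<close>.\<close>

lemma chi_square_step:
  fixes a S p x d \<kappa> :: real
  assumes "0 \<le> a" "a \<le> S" "0 \<le> p" "0 \<le> x" "a * p \<le> S * x" "0 < \<kappa>"
  shows "d * (a * \<bar>p - x\<bar>) \<le> (1 / (2 * \<kappa>)) * ((a * p)\<^sup>2 / (S * x) - 2 * (a\<^sup>2 / S) * p + (a\<^sup>2 / S) * x) + \<kappa> / 2 * d\<^sup>2 * S * x"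
proof (cases "S * x = 0")
  case True
  moreover have "a * p = 0"
    using assms True by (metis mult_nonneg_nonneg order_antisym)
  ultimately show ?thesis
    using assms by (auto simp: mult_eq_0_iff)
next
  case False
  then have pos: "S > 0" "x > 0"
    using assms by (auto simp: less_le)
  define A T where "A = a * \<bar>p - x\<bar>" and "T = S * x"
  have T: "T > 0"
    using pos by (simp add: T_def)
  have "(a * p)\<^sup>2 / (S * x) - 2 * (a\<^sup>2 / S) * p + (a\<^sup>2 / S) * x = A\<^sup>2 / T"
    using pos by (simp add: A_def T_def field_simps power2_eq_square)
  moreover have "d * A \<le> (1 / (2 * \<kappa>)) * (A\<^sup>2 / T) + \<kappa> / 2 * d\<^sup>2 * T"
  proof -
    have "0 \<le> (A - \<kappa> * d * T)\<^sup>2 / (2 * \<kappa> * T)"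
      using T assms by (intro divide_nonneg_pos) auto
    also have "\<dots> = (1 / (2 * \<kappa>)) * (A\<^sup>2 / T) + \<kappa> / 2 * d\<^sup>2 * T - d * A"
      using T assms by (simp add: field_simps power2_eq_square)
    finally show ?thesis by simp
  qed
  ultimately show ?thesis
    by (simp add: A_def T_def mult.assoc)
qed

text \<open>Histories follow \<open>s\<close>, while the payoff is that of \<open>x\<close>: the
  simulation draws from the type's own strategy but plays the mixture.\<close>

definition public_payoff ::
  "('i::finite \<Rightarrow> 'j::finite \<Rightarrow> real) \<Rightarrow> (('i \<times> 'j) list \<Rightarrow> 'i pmf) \<Rightarrow> (('i \<times> 'j) list \<Rightarrow> 'i pmf) \<Rightarrow>
    (('i \<times> 'j) list \<Rightarrow> 'j pmf) \<Rightarrow> nat \<Rightarrow> real"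
  where "public_payoff g s x t m = (\<Sum>h\<in>hist m. lik fst s h * lik snd t h * mixed_payoff g (x h) (t h))"

lemma abs_mixed_payoff_diff_le:
  fixes g :: "'i::finite \<Rightarrow> 'j::finite \<Rightarrow> real"
  assumes "\<And>i j. \<bar>g i j\<bar> \<le> B"
  shows "\<bar>mixed_payoff g a b - mixed_payoff g a' b\<bar> \<le> B * (\<Sum>i\<in>UNIV. \<bar>pmf a i - pmf a' i\<bar>)"
proof -
  have "mixed_payoff g a b - mixed_payoff g a' b = (\<Sum>i\<in>UNIV. (pmf a i - pmf a' i) * (\<Sum>j\<in>UNIV. pmf b j * g i j))"
    unfolding mixed_payoff_def
    by (simp add: sum_distrib_left algebra_simps flip: sum_subtractf)
  also have "\<bar>\<dots>\<bar> \<le> (\<Sum>i\<in>UNIV. \<bar>pmf a i - pmf a' i\<bar> * B)"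
  proof (intro order_trans[OF sum_abs] sum_mono)
    fix i
    have "\<bar>\<Sum>j\<in>UNIV. pmf b j * g i j\<bar> \<le> (\<Sum>j\<in>UNIV. pmf b j * B)"
      by (intro order_trans[OF sum_abs] sum_mono) (auto simp: abs_mult intro!: mult_left_mono assms)
    also have "\<dots> = B"
      by (simp flip: sum_distrib_right)
    finally show "\<bar>(pmf a i - pmf a' i) * (\<Sum>j\<in>UNIV. pmf b j * g i j)\<bar> \<le> \<bar>pmf a i - pmf a' i\<bar> * B"
      by (auto simp: abs_mult intro: mult_left_mono)
  qed
  also have "\<dots> = B * (\<Sum>i\<in>UNIV. \<bar>pmf a i - pmf a' i\<bar>)"
    by (simp add: sum_distrib_left mult.commute)
  finally show ?thesis .
qed

text \<open>Only likelihoods of own actions enter, so the mixture does not refer to the opponent's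
  strategy. The multiplied form leaves \<open>x\<close> free at histories that no type
  reaches.\<close>

definition bayes_mixture :: "('k::finite \<Rightarrow> ('i::finite \<times> 'j) list \<Rightarrow> 'i pmf) \<Rightarrow> (('i \<times> 'j) list \<Rightarrow> 'i pmf) \<Rightarrow> bool" where
  "bayes_mixture \<sigma> x \<longleftrightarrow>
    (\<forall>h i. (\<Sum>k\<in>UNIV. lik fst (\<sigma> k) h) * pmf (x h) i = (\<Sum>k\<in>UNIV. lik fst (\<sigma> k) h * pmf (\<sigma> k h) i))"

lemma bayes_mixture_exists: "\<exists>x. bayes_mixture \<sigma> x"
proof -
  have "\<forall>h. \<exists>q. \<forall>i. (\<Sum>k\<in>UNIV. lik fst (\<sigma> k) h) * pmf q i = (\<Sum>k\<in>UNIV. lik fst (\<sigma> k) h * pmf (\<sigma> k h) i)"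
    by (intro allI mixture_pmf_exists) simp
  then show ?thesis
    unfolding bayes_mixture_def by metis
qed

text \<open>
  The potential is the squared likelihood of the true type over the total likelihood; its expected
  increments dominate the squared distances between the type's action and the mixture.
\<close>

lemma bayes_mixture_regret:
  fixes \<sigma> :: "'k::finite \<Rightarrow> ('i::finite \<times> 'j::finite) list \<Rightarrow> 'i pmf"
  assumes x: "bayes_mixture \<sigma> x" and "0 < \<kappa>"
  shows "(\<Sum>m<N. d m * (\<Sum>h\<in>hist m. lik fst (\<sigma> k) h * lik snd t h * (\<Sum>i\<in>UNIV. \<bar>pmf (\<sigma> k h) i - pmf (x h) i\<bar>)))
    \<le> 1 / (2 * \<kappa>) + \<kappa> / 2 * real CARD('k) * (\<Sum>m<N. (d m)\<^sup>2)"
proof -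
  define S where "S h = (\<Sum>k\<in>UNIV. lik fst (\<sigma> k) h)" for h
  define \<Phi> where "\<Phi> h = (lik fst (\<sigma> k) h)\<^sup>2 / S h" for h
  define A where "A m = (\<Sum>h\<in>hist m. lik snd t h * \<Phi> h)" for m
  \<comment> \<open>Thus \<open>S\<close> is \<open>CARD('k)\<close> times the likelihood of the
    player's actions under \<open>x\<close>.\<close>
  have x': "S h * pmf (x h) i = S (h @ [(i, j)])" for h i j
    using x by (simp add: bayes_mixture_def S_def)
  have le_S: "lik fst (\<sigma> k) h \<le> S h" for h
    unfolding S_def by (rule member_le_sum) auto
  \<comment> \<open>Summed over the actions, the bracket of \<open>chi_square_step\<close> becomes
    the increment of \<Phi>, since both mixed actions have mass one. The opponent's entry can be
    \<open>undefined\<close> because \<Phi> reads own actions only.\<close>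
  have step: "d m * (lik fst (\<sigma> k) h * (\<Sum>i\<in>UNIV. \<bar>pmf (\<sigma> k h) i - pmf (x h) i\<bar>))
      \<le> 1 / (2 * \<kappa>) * ((\<Sum>i\<in>UNIV. \<Phi> (h @ [(i, undefined)])) - \<Phi> h) + \<kappa> / 2 * (d m)\<^sup>2 * S h" for m h
  proof -
    let ?a = "lik fst (\<sigma> k) h" and ?p = "\<lambda>i. pmf (\<sigma> k h) i" and ?x = "\<lambda>i. pmf (x h) i"
    have "d m * (?a * (\<Sum>i\<in>UNIV. \<bar>?p i - ?x i\<bar>)) = (\<Sum>i\<in>UNIV. d m * (?a * \<bar>?p i - ?x i\<bar>))"
      by (simp add: sum_distrib_left)
    also have "\<dots> \<le> (\<Sum>i\<in>UNIV. (1 / (2 * \<kappa>)) * ((?a * ?p i)\<^sup>2 / (S h * ?x i) - 2 * (?a\<^sup>2 / S h) * ?p i + (?a\<^sup>2 / S h) * ?x i)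
        + \<kappa> / 2 * (d m)\<^sup>2 * S h * ?x i)"
    proof (intro sum_mono chi_square_step le_S)
      show "?a * ?p i \<le> S h * ?x i" for i
        using le_S[of "h @ [(i, undefined)]"] by (simp add: x'[of h i undefined])
    qed (use \<open>0 < \<kappa>\<close> in auto)
    also have "\<dots> = (1 / (2 * \<kappa>)) * ((\<Sum>i\<in>UNIV. (?a * ?p i)\<^sup>2 / (S h * ?x i)) - 2 * (?a\<^sup>2 / S h) * (\<Sum>i\<in>UNIV. ?p i)
        + (?a\<^sup>2 / S h) * (\<Sum>i\<in>UNIV. ?x i)) + \<kappa> / 2 * (d m)\<^sup>2 * S h * (\<Sum>i\<in>UNIV. ?x i)"
      by (simp only: sum.distrib sum_subtractf sum_distrib_left distrib_left right_diff_distrib)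
    also have "\<dots> = 1 / (2 * \<kappa>) * ((\<Sum>i\<in>UNIV. \<Phi> (h @ [(i, undefined)])) - \<Phi> h) + \<kappa> / 2 * (d m)\<^sup>2 * S h"
      by (simp add: \<Phi>_def x'[of h _ undefined])
    finally show ?thesis .
  qed
  have A_Suc: "A (Suc m) = (\<Sum>h\<in>hist m. lik snd t h * (\<Sum>i\<in>UNIV. \<Phi> (h @ [(i, undefined)])))" for m
  proof -
    have "\<Phi> (h @ [(i, j)]) = \<Phi> (h @ [(i, undefined)])" for h i j
      by (simp add: \<Phi>_def flip: x')
    then have "A (Suc m) = (\<Sum>h\<in>hist m. \<Sum>i\<in>UNIV. lik snd t h * \<Phi> (h @ [(i, undefined)]) * (\<Sum>j\<in>UNIV. pmf (t h) j))"
      unfolding A_def sum_hist_Suc sum_UNIV_prod sum_distrib_left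
      by (intro sum.cong) (auto simp: mult_ac)
    then show ?thesis
      by (simp add: sum_distrib_left)
  qed
  have S_sum: "(\<Sum>h\<in>hist m. lik snd t h * S h) = real CARD('k)" for m
  proof -
    have "(\<Sum>h\<in>hist m. lik snd t h * S h) = (\<Sum>k\<in>UNIV. \<Sum>h\<in>hist m. lik fst (\<sigma> k) h * lik snd t h)"
      unfolding S_def sum_distrib_left by (subst sum.swap) (simp add: mult.commute)
    then show ?thesis
      by (simp add: sum_lik_lik)
  qed
  have \<Phi>_bd: "0 \<le> \<Phi> h" "\<Phi> h \<le> lik fst (\<sigma> k) h" for h
  proof -
    have "0 \<le> S h"
      using le_S[of h] lik_nonneg order_trans by blast
    then show "0 \<le> \<Phi> h"
      by (simp add: \<Phi>_def)
    show "\<Phi> h \<le> lik fst (\<sigma> k) h"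
      using \<open>0 \<le> S h\<close> le_S[of h]
      by (cases "S h = 0") (auto simp: \<Phi>_def power2_eq_square divide_le_eq intro: mult_left_mono)
  qed
  have stage: "d m * (\<Sum>h\<in>hist m. lik fst (\<sigma> k) h * lik snd t h * (\<Sum>i\<in>UNIV. \<bar>pmf (\<sigma> k h) i - pmf (x h) i\<bar>))
      \<le> 1 / (2 * \<kappa>) * (A (Suc m) - A m) + \<kappa> / 2 * real CARD('k) * (d m)\<^sup>2" for m
  proof -
    have "d m * (\<Sum>h\<in>hist m. lik fst (\<sigma> k) h * lik snd t h * (\<Sum>i\<in>UNIV. \<bar>pmf (\<sigma> k h) i - pmf (x h) i\<bar>))
      = (\<Sum>h\<in>hist m. lik snd t h * (d m * (lik fst (\<sigma> k) h * (\<Sum>i\<in>UNIV. \<bar>pmf (\<sigma> k h) i - pmf (x h) i\<bar>))))"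
      by (simp only: sum_distrib_left[of "d m"] mult_ac)
    also have "\<dots> \<le> (\<Sum>h\<in>hist m. lik snd t h * (1 / (2 * \<kappa>) * ((\<Sum>i\<in>UNIV. \<Phi> (h @ [(i, undefined)])) - \<Phi> h) + \<kappa> / 2 * (d m)\<^sup>2 * S h))"
      by (intro sum_mono mult_left_mono step) auto
    also have "\<dots> = 1 / (2 * \<kappa>) * (A (Suc m) - A m) + \<kappa> / 2 * (d m)\<^sup>2 * (\<Sum>h\<in>hist m. lik snd t h * S h)"
      unfolding A_Suc unfolding A_def sum_subtractf[symmetric] sum_distrib_left[of "1 / (2 * \<kappa>)"] sum_distrib_left[of "\<kappa> / 2 * (d m)\<^sup>2"] sum.distrib[symmetric]
      by (intro sum.cong refl) (simp only: algebra_simps)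
    finally show ?thesis
      by (simp add: S_sum) (simp add: mult_ac)
  qed
  have "(\<Sum>m<N. d m * (\<Sum>h\<in>hist m. lik fst (\<sigma> k) h * lik snd t h * (\<Sum>i\<in>UNIV. \<bar>pmf (\<sigma> k h) i - pmf (x h) i\<bar>)))
    \<le> (\<Sum>m<N. 1 / (2 * \<kappa>) * (A (Suc m) - A m) + \<kappa> / 2 * real CARD('k) * (d m)\<^sup>2)"
    by (intro sum_mono stage)
  also have "\<dots> = 1 / (2 * \<kappa>) * (A N - A 0) + \<kappa> / 2 * real CARD('k) * (\<Sum>m<N. (d m)\<^sup>2)"
    by (simp only: sum.distrib sum_distrib_left[symmetric] sum_lessThan_telescope)
  \<comment> \<open>\<Phi> lies below the likelihood of type \<open>k\<close>, so \<open>A N\<close>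
    is at most one, whatever the number of stages.\<close>
  also have "1 / (2 * \<kappa>) * (A N - A 0) \<le> 1 / (2 * \<kappa>) * 1"
  proof (intro mult_left_mono)
    have "A N \<le> (\<Sum>h\<in>hist N. lik fst (\<sigma> k) h * lik snd t h)"
      unfolding A_def by (intro sum_mono) (auto simp: mult.commute[of "lik fst (\<sigma> k) _"] intro!: mult_left_mono \<Phi>_bd)
    moreover have "0 \<le> A 0"
      unfolding A_def by (intro sum_nonneg mult_nonneg_nonneg \<Phi>_bd) auto
    ultimately show "A N - A 0 \<le> 1"
      by (simp add: sum_lik_lik)
  qed (use \<open>0 < \<kappa>\<close> in auto)
  finally show ?thesis by simp
qed

lemma public_payoff_ge:
  fixes \<sigma> :: "'k::finite \<Rightarrow> ('i::finite \<times> 'j::finite) list \<Rightarrow> 'i pmf"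
  assumes x: "bayes_mixture \<sigma> x" and \<kappa>: "0 < \<kappa>" and B: "0 \<le> B" "\<And>i j. \<bar>g i j\<bar> \<le> B"
    and d: "\<And>m. 0 \<le> d m"
  shows "(\<Sum>m<N. d m * stage_payoff g (\<sigma> k) t m) - B * (1 / (2 * \<kappa>) + \<kappa> / 2 * real CARD('k) * (\<Sum>m<N. (d m)\<^sup>2))
    \<le> (\<Sum>m<N. d m * public_payoff g (\<sigma> k) x t m)"
proof -
  let ?r = "\<lambda>m. \<Sum>h\<in>hist m. lik fst (\<sigma> k) h * lik snd t h * (\<Sum>i\<in>UNIV. \<bar>pmf (\<sigma> k h) i - pmf (x h) i\<bar>)"
  have "stage_payoff g (\<sigma> k) t m - public_payoff g (\<sigma> k) x t m \<le> B * ?r m" for m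
  proof -
    have "stage_payoff g (\<sigma> k) t m - public_payoff g (\<sigma> k) x t m =
        (\<Sum>h\<in>hist m. lik fst (\<sigma> k) h * lik snd t h * (mixed_payoff g (\<sigma> k h) (t h) - mixed_payoff g (x h) (t h)))"
      unfolding stage_payoff_def public_payoff_def by (simp add: right_diff_distrib sum_subtractf)
    also have "\<dots> \<le> (\<Sum>h\<in>hist m. lik fst (\<sigma> k) h * lik snd t h * (B * (\<Sum>i\<in>UNIV. \<bar>pmf (\<sigma> k h) i - pmf (x h) i\<bar>)))"
      using abs_mixed_payoff_diff_le[of g B, OF B(2)] by (intro sum_mono mult_left_mono) (auto simp: abs_le_iff)
    also have "\<dots> = B * ?r m"
      by (subst sum_distrib_left) (simp add: mult_ac)
    finally show ?thesis .
  qed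
  then have "(\<Sum>m<N. d m * (stage_payoff g (\<sigma> k) t m - public_payoff g (\<sigma> k) x t m)) \<le> (\<Sum>m<N. d m * (B * ?r m))"
    using d by (intro sum_mono mult_left_mono) auto
  also have "\<dots> = B * (\<Sum>m<N. d m * ?r m)"
    by (subst sum_distrib_left) (simp add: mult.left_commute[of B])
  also have "\<dots> \<le> B * (1 / (2 * \<kappa>) + \<kappa> / 2 * real CARD('k) * (\<Sum>m<N. (d m)\<^sup>2))"
    by (intro mult_left_mono bayes_mixture_regret x \<kappa> B)
  finally show ?thesis
    by (simp add: right_diff_distrib sum_subtractf)
qed


section \<open>Controls and delayed strategies\<close>

abbreviation unit_lebesgue :: "real measure" where
  "unit_lebesgue \<equiv> lebesgue_on {0..1}"

lemma prob_space_unit_lebesgue: "prob_space unit_lebesgue"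
  by (rule prob_spaceI) (simp add: emeasure_restrict_space)

definition agree :: "real \<Rightarrow> (real \<Rightarrow> 'a) \<Rightarrow> (real \<Rightarrow> 'a) \<Rightarrow> bool" where
  "agree a u v \<longleftrightarrow> (AE r in lebesgue_on {0..a}. u r = v r)"

lemma agree_iff: "agree a u v \<longleftrightarrow> (AE r in lebesgue. r \<in> {0..a} \<longrightarrow> u r = v r)"
  unfolding agree_def by (simp add: AE_restrict_space_iff)

lemma agree_refl [simp]: "agree a u u"
  by (simp add: agree_iff)

lemma agree_sym:
  assumes "agree a u v"
  shows "agree a v u"
  using assms unfolding agree_def by eventually_elim simp

lemma agree_trans [trans]:
  assumes "agree a u v" "agree a v w"
  shows "agree a u w"
  using assms unfolding agree_iff by eventually_elim auto

lemma agree_mono: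
  assumes "agree b u v" "a \<le> b"
  shows "agree a u v"
  using assms(1) unfolding agree_iff by eventually_elim (use assms(2) in auto)

lemma agree_0 [simp]: "agree 0 u v"
proof -
  have "AE r in lebesgue. r \<notin> {0::real}"
    by (rule AE_not_in) (simp add: null_sets_completionI)
  then show ?thesis
    unfolding agree_iff by (rule AE_mp) auto
qed

text \<open>The right end may be left out, which suits half-open blocks.\<close>

lemma agree_pointwise: "(\<And>r. 0 \<le> r \<Longrightarrow> r < a \<Longrightarrow> u r = v r) \<Longrightarrow> agree a u v"
proof -
  assume eq: "\<And>r. 0 \<le> r \<Longrightarrow> r < a \<Longrightarrow> u r = v r"
  have "AE r in lebesgue. r \<notin> {a}"
    by (rule AE_not_in) (simp add: null_sets_completionI)
  then show ?thesis
    unfolding agree_iff by (rule AE_mp) (auto simp: eq)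
qed

section \<open>Delayed strategies and the pair of controls that they induce\<close>

text \<open>The section of a random strategy at a fixed seed. Preservation of
  \<open>controls\<close> is stated here; for random strategies it comes from measurability.\<close>

definition delayed :: "nat \<Rightarrow> (nat \<Rightarrow> real) \<Rightarrow> ((real \<Rightarrow> 'b::finite pmf) \<Rightarrow> (real \<Rightarrow> 'a::finite pmf)) \<Rightarrow> bool" where
  "delayed N s f \<longleftrightarrow> s 0 = 0 \<and> s N = 1 \<and> (\<forall>m<N. s m < s (Suc m)) \<and> (\<forall>v\<in>controls. f v \<in> controls) \<and>
     (\<forall>m<N. \<forall>v\<in>controls. \<forall>v'\<in>controls. agree (s m) v v' \<longrightarrow> agree (s (Suc m)) (f v) (f v'))"

lemma delayed_mono:
  assumes "delayed N s f" "m \<le> n" "n \<le> N"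
  shows "s m \<le> s n"
  using assms(2,3)
proof (induction n rule: dec_induct)
  case (step n)
  then have "s n < s (Suc n)"
    using assms(1) by (simp add: delayed_def)
  with step show ?case by simp
qed simp

text \<open>The two players use different grids, so agreement has to be transported at times off the
  own grid. With \<open>a\<close> in the grid interval from \<open>s m\<close> to
  \<open>s (Suc m)\<close>, agreement up to \<open>s m\<close> already yields agreement of the
  outputs up to \<open>s (Suc m)\<close>, hence up to \<open>a\<close>.\<close>

lemma delayed_causal:
  assumes f: "delayed N s f" and v: "v \<in> controls" "v' \<in> controls" and a: "0 \<le> a" "a \<le> 1" and agr: "agree a v v'"
  shows "agree a (f v) (f v')"
proof (cases "a = 0")
  case False
  define n where "n = (LEAST n. a \<le> s n)"
  have N: "a \<le> s N"
    using f a by (simp add: delayed_def)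
  have n: "a \<le> s n" "n \<le> N"
    unfolding n_def using N by (auto intro: LeastI Least_le)
  have "n \<noteq> 0"
  proof
    assume "n = 0"
    with n(1) f a False show False
      by (simp add: delayed_def)
  qed
  then obtain m where m: "n = Suc m"
    by (cases n) auto
  then have "s m < a"
    using not_less_Least[of m "\<lambda>n. a \<le> s n"] by (simp add: n_def)
  then have "agree (s m) v v'"
    using agr by (intro agree_mono[OF agr]) simp
  then have "agree (s n) (f v) (f v')"
    using f v n m by (simp add: delayed_def)
  then show ?thesis
    using n(1) by (rule agree_mono)
qed simp

definition consistent ::
  "((real \<Rightarrow> 'b::finite pmf) \<Rightarrow> (real \<Rightarrow> 'a::finite pmf)) \<Rightarrow> ((real \<Rightarrow> 'a pmf) \<Rightarrow> (real \<Rightarrow> 'b pmf)) \<Rightarrow>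
   (real \<Rightarrow> 'a pmf) \<Rightarrow> (real \<Rightarrow> 'b pmf) \<Rightarrow> bool"
  where "consistent f g u v \<longleftrightarrow> u \<in> controls \<and> v \<in> controls \<and> agree 1 (f v) u \<and> agree 1 (g u) v"

lemma const_controls: "(\<lambda>_. p) \<in> controls"
  by (simp add: controls_def)

text \<open>Iterate the composition of \<open>f\<close> and \<open>g\<close> from an arbitrary
  control. In each round the delay of \<open>f\<close> moves agreement of successive iterates one
  interval of its grid further, and causality of \<open>g\<close> keeps it; after \<open>N\<close>
  rounds time 1 is reached.\<close>

lemma consistent_exists:
  assumes f: "delayed N s f" and g: "delayed N' s' g"
  shows "\<exists>u v. consistent f g u v"
proof -
  define w where "w n = ((\<lambda>v. g (f v)) ^^ n) (\<lambda>_. undefined)" for n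
  have w_Suc: "w (Suc n) = g (f (w n))" for n
    by (simp add: w_def)
  have c: "w n \<in> controls" for n
    by (induction n) (use f g in \<open>auto simp: w_Suc delayed_def const_controls w_def[of 0]\<close>)
  have fc: "f (w n) \<in> controls" for n
    using f c by (simp add: delayed_def)
  have "agree (s n) (w n) (w (Suc n))" if "n \<le> N" for n
    using that
  proof (induction n)
    case 0
    then show ?case
      using f by (simp add: delayed_def)
  next
    case (Suc n)
    then have "agree (s (Suc n)) (f (w n)) (f (w (Suc n)))"
      using f c by (simp add: delayed_def)
    moreover have "0 \<le> s (Suc n)" "s (Suc n) \<le> 1"
      using delayed_mono[OF f, of 0 "Suc n"] delayed_mono[OF f, of "Suc n" N] Suc.prems f by (auto simp: delayed_def)
    ultimately have "agree (s (Suc n)) (g (f (w n))) (g (f (w (Suc n))))"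
      by (intro delayed_causal[OF g] fc)
    then show ?case
      by (simp only: w_Suc)
  qed
  from this[of N] have "agree 1 (w N) (w (Suc N))"
    using f by (simp add: delayed_def)
  from agree_sym[OF this] have "agree 1 (f (w (Suc N))) (f (w N))"
    by (intro delayed_causal[OF f] c) auto
  then have "consistent f g (f (w N)) (w (Suc N))"
    using c[of "Suc N"] fc[of N] by (simp add: consistent_def w_Suc)
  then show ?thesis by blast
qed

text \<open>The same induction along the grid of \<open>f\<close>: its delay advances the agreement,
  causality of \<open>g\<close> preserves it.\<close>

lemma consistent_unique:
  assumes f: "delayed N s f" and g: "delayed N' s' g"
    and uv: "consistent f g u v" "consistent f g u' v'"
  shows "agree 1 u u'" "agree 1 v v'"
proof -
  note c = uv[unfolded consistent_def]
  have fv: "agree a u u'" if "agree a (f v) (f v')" "a \<le> 1" for a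
    using that c agree_mono[of 1 _ _ a] by (meson agree_sym agree_trans)
  have gv: "agree a v v'" if "agree a u u'" "0 \<le> a" "a \<le> 1" for a
  proof -
    have "agree a (g u) (g u')"
      using that c by (intro delayed_causal[OF g]) auto
    then show ?thesis
      using that c agree_mono[of 1 _ _ a] by (meson agree_sym agree_trans)
  qed
  have "agree (s n) v v'" if "n \<le> N" for n
    using that
  proof (induction n)
    case 0
    then show ?case
      using f by (simp add: delayed_def)
  next
    case (Suc n)
    have "0 \<le> s (Suc n)" "s (Suc n) \<le> 1"
      using delayed_mono[OF f, of 0 "Suc n"] delayed_mono[OF f, of "Suc n" N] Suc.prems f by (auto simp: delayed_def)
    moreover have "agree (s (Suc n)) (f v) (f v')"
      using Suc c f by (simp add: delayed_def)
    ultimately show ?case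
      by (intro gv fv)
  qed
  from this[of N] show v: "agree 1 v v'"
    using f by (simp add: delayed_def)
  show "agree 1 u u'"
    using c by (intro fv delayed_causal[OF f] v) auto
qed

lemma space_control_space [simp]: "space control_space = controls"
  by (simp add: control_space_def space_measure_of_conv)

lemma random_strategies_delayed:
  assumes "(m, \<alpha>) \<in> random_strategies" "\<omega> \<in> space (cube m)"
  obtains N s where "delayed N s (\<alpha> \<omega>)"
proof -
  have "nonanticipative_with_delay (space (cube m)) \<alpha>"
    and meas: "(\<lambda>(\<omega>, v). \<alpha> \<omega> v) \<in> measurable (cube m \<Otimes>\<^sub>M control_space) control_space"
    using assms by (auto simp: random_strategies_def)
  then obtain N and s :: "nat \<Rightarrow> real" where s: "s 0 = 0" "s N = 1" "\<forall>m<N. s m < s (Suc m)"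
    and s': "\<forall>n<N. \<forall>\<omega>\<in>space (cube m). \<forall>v\<in>controls. \<forall>v'\<in>controls. (AE r in lebesgue_on {s 0..s n}. v r = v' r) \<longrightarrow>
      (AE r in lebesgue_on {s 0..s (Suc n)}. \<alpha> \<omega> v r = \<alpha> \<omega> v' r)"
    unfolding nonanticipative_with_delay_def by blast
  have "\<alpha> \<omega> v \<in> controls" if "v \<in> controls" for v
    using measurable_space[OF meas, of "(\<omega>, v)"] assms(2) that by (simp add: space_pair_measure)
  then have "delayed N s (\<alpha> \<omega>)"
    using s s'[unfolded s(1)] assms(2) by (simp add: delayed_def agree_def)
  then show ?thesis ..
qed

lemma consistent_induced_controls:
  assumes "\<alpha> \<in> random_strategies" "\<beta> \<in> random_strategies"
    and "\<omega>\<^sub>1 \<in> space (cube (fst \<alpha>))" "\<omega>\<^sub>2 \<in> space (cube (fst \<beta>))"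
  shows "case induced_controls \<alpha> \<beta> \<omega>\<^sub>1 \<omega>\<^sub>2 of (u, v) \<Rightarrow> consistent (snd \<alpha> \<omega>\<^sub>1) (snd \<beta> \<omega>\<^sub>2) u v"
proof -
  obtain N s N' s' where "delayed N s (snd \<alpha> \<omega>\<^sub>1)" "delayed N' s' (snd \<beta> \<omega>\<^sub>2)"
    using random_strategies_delayed[of "fst \<alpha>" "snd \<alpha>" \<omega>\<^sub>1] random_strategies_delayed[of "fst \<beta>" "snd \<beta>" \<omega>\<^sub>2] assms
    by (metis prod.collapse)
  then obtain u v where "consistent (snd \<alpha> \<omega>\<^sub>1) (snd \<beta> \<omega>\<^sub>2) u v"
    using consistent_exists by blast
  then have "\<exists>x. (case x of (u, v) \<Rightarrow> consistent (snd \<alpha> \<omega>\<^sub>1) (snd \<beta> \<omega>\<^sub>2) u v)"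
    by blast
  then show ?thesis
    unfolding induced_controls_def agree_def[symmetric] consistent_def[symmetric] by (rule someI_ex)
qed

lemma running_payoff_cong:
  assumes "agree 1 u u'" "agree 1 v v'" "u \<in> controls" "v \<in> controls" "u' \<in> controls" "v' \<in> controls"
  shows "running_payoff g (u, v) = running_payoff g (u', v')"
proof -
  have meas: "(\<lambda>r. mixed_payoff g (a r) (b r)) \<in> borel_measurable unit_lebesgue"
    if "a \<in> controls" "b \<in> controls" for a b
    using that unfolding controls_def mixed_payoff_def
    by (intro borel_measurable_sum borel_measurable_times borel_measurable_const) auto
  have "AE r in unit_lebesgue. mixed_payoff g (u r) (v r) = mixed_payoff g (u' r) (v' r)"
    using assms(1,2) unfolding agree_def by eventually_elim simp
  then show ?thesis
    unfolding running_payoff_def using assms by (auto intro!: integral_cong_AE meas)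
qed


section \<open>Averages of controls over time blocks\<close>

lemma sets_control_space: "sets control_space = sigma_sets controls {S. L1_open S}"
  unfolding control_space_def by (rule sets_measure_of) (auto simp: L1_open_def)

text \<open>Preimages of open sets are \<open>L1_open\<close>, hence among the generators of the
  Borel sets.\<close>

lemma L1_Lipschitz_measurable:
  fixes F :: "(real \<Rightarrow> 'a::finite pmf) \<Rightarrow> real"
  assumes F: "\<And>v v'. v \<in> controls \<Longrightarrow> v' \<in> controls \<Longrightarrow> \<bar>F v - F v'\<bar> \<le> L1_dist v v'"
  shows "F \<in> borel_measurable control_space"
proof (rule borel_measurableI)
  fix T :: "real set" assume T: "open T"
  have "L1_open (F -` T \<inter> controls)"
    unfolding L1_open_def
  proof (intro conjI ballI)
    fix v assume v: "v \<in> F -` T \<inter> controls"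
    then obtain e where e: "e > 0" "\<And>y. dist y (F v) < e \<Longrightarrow> y \<in> T"
      using T by (auto simp: open_dist)
    have "v' \<in> F -` T \<inter> controls" if "v' \<in> controls" "L1_dist v v' < e" for v'
      using F[of v v'] that v e(2)[of "F v'"] by (auto simp: dist_real_def abs_minus_commute)
    then show "\<exists>e>0. \<forall>v'\<in>controls. L1_dist v v' < e \<longrightarrow> v' \<in> F -` T \<inter> controls"
      using e(1) by blast
  qed simp
  then show "F -` T \<inter> space control_space \<in> sets control_space"
    unfolding sets_control_space by (auto intro: sigma_sets.Basic)
qed

lemma integrable_unit_bounded:
  fixes f :: "real \<Rightarrow> real"
  assumes "f \<in> borel_measurable unit_lebesgue" "\<And>r. \<bar>f r\<bar> \<le> B"
  shows "integrable unit_lebesgue f"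
proof -
  interpret prob_space unit_lebesgue
    by (rule prob_space_unit_lebesgue)
  show ?thesis
    using assms by (intro integrable_const_bound[of _ B]) auto
qed

lemma borel_measurable_unit_indicator [measurable]:
  "(indicator {a..<b} :: real \<Rightarrow> real) \<in> borel_measurable unit_lebesgue"
  by (intro measurable_restrict_space1 borel_measurable_indicator) simp

lemma controls_measurable [measurable_dest]:
  "v \<in> controls \<Longrightarrow> (\<lambda>r. pmf (v r) j) \<in> borel_measurable unit_lebesgue"
  by (simp add: controls_def)

lemma integrable_block:
  assumes "v \<in> controls"
  shows "integrable unit_lebesgue (\<lambda>r. indicator {a..<b} r * pmf (v r) j)"
  using assms
  by (intro integrable_unit_bounded[where B=1] borel_measurable_times controls_measurable borel_measurable_unit_indicator)
    (auto simp: pmf_le_1 split: split_indicator)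

lemma integral_unit_block:
  assumes "0 \<le> a" "a \<le> b" "b \<le> 1"
  shows "(\<integral>r. indicator {a..<b} r \<partial>unit_lebesgue) = (b - a :: real)"
proof -
  have sub: "{a..<b} \<subseteq> {0..1}"
    using assms by auto
  then have "measure unit_lebesgue {a..<b} = b - a"
    using assms by (subst measure_restrict_space) auto
  moreover have "{a..<b} \<inter> {0..1} = {a..<b}"
    using sub by auto
  ultimately show ?thesis
    by simp
qed

text \<open>By bilinearity, an action that is constant on the block sees only this average of the
  opponent's control.\<close>

definition block_avg :: "real \<Rightarrow> real \<Rightarrow> (real \<Rightarrow> 'a::finite pmf) \<Rightarrow> 'a pmf" where
  "block_avg a b v = embed_pmf (\<lambda>j. (\<integral>r. indicator {a..<b} r * pmf (v r) j \<partial>unit_lebesgue) / (b - a))"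

context
  fixes a b :: real
  assumes ab: "0 \<le> a" "a < b" "b \<le> 1"
begin

lemma pmf_block_avg:
  assumes v: "v \<in> controls"
  shows "pmf (block_avg a b v) j = (\<integral>r. indicator {a..<b} r * pmf (v r) j \<partial>unit_lebesgue) / (b - a)"
  unfolding block_avg_def
proof (rule pmf_embed_pmf)
  let ?f = "\<lambda>j. (\<integral>r. indicator {a..<b} r * pmf (v r) j \<partial>unit_lebesgue) / (b - a)"
  show nn: "0 \<le> ?f j" for j
    using ab by (intro divide_nonneg_pos integral_nonneg_AE) auto
  have "(\<Sum>j\<in>UNIV. ?f j) = (\<Sum>j\<in>UNIV. \<integral>r. indicator {a..<b} r * pmf (v r) j \<partial>unit_lebesgue) / (b - a)"
    by (rule sum_divide_distrib[symmetric])
  also have "(\<Sum>j\<in>UNIV. \<integral>r. indicator {a..<b} r * pmf (v r) j \<partial>unit_lebesgue) =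
      (\<integral>r. (\<Sum>j\<in>UNIV. indicator {a..<b} r * pmf (v r) j) \<partial>unit_lebesgue)"
    by (rule Bochner_Integration.integral_sum[symmetric]) (rule integrable_block[OF v])
  also have "\<dots> = (\<integral>r. indicator {a..<b} r \<partial>unit_lebesgue)"
    by (simp only: sum_distrib_left[symmetric] sum_pmf_UNIV mult_1_right)
  also have "\<dots> = b - a"
    using ab by (intro integral_unit_block) auto
  also have "(b - a) / (b - a) = 1"
    using ab by simp
  finally show "(\<integral>\<^sup>+j. ennreal (?f j) \<partial>count_space UNIV) = 1"
    using nn by (subst nn_integral_count_space_finite) (simp_all add: sum_ennreal)
qed

lemma block_avg_cong:
  assumes "agree b v v'" "v \<in> controls" "v' \<in> controls"
  shows "block_avg a b v = block_avg a b v'"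
proof -
  have "AE r in unit_lebesgue. r < b \<longrightarrow> v r = v' r"
    using assms(1) unfolding agree_iff by (simp add: AE_restrict_space_iff) (erule eventually_mono, auto)
  then have "AE r in unit_lebesgue. indicator {a..<b} r * pmf (v r) j = indicator {a..<b} r * pmf (v' r) j" for j
    by eventually_elim (auto split: split_indicator)
  then have "(\<integral>r. indicator {a..<b} r * pmf (v r) j \<partial>unit_lebesgue) = (\<integral>r. indicator {a..<b} r * pmf (v' r) j \<partial>unit_lebesgue)" for j
    using assms integrable_block by (intro integral_cong_AE) (auto intro: borel_measurable_integrable)
  then show ?thesis
    by (simp add: block_avg_def)
qed

text \<open>The integral over the block is 1-Lipschitz for \<open>L1_dist\<close>; the division by
  the block length is made afterwards.\<close>

lemma measurable_block_avg:
  "(\<lambda>v. pmf (block_avg a b v) j) \<in> borel_measurable control_space"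
proof -
  have "(\<lambda>v. \<integral>r. indicator {a..<b} r * pmf (v r) j \<partial>unit_lebesgue) \<in> borel_measurable control_space"
  proof (rule L1_Lipschitz_measurable)
    fix v v' :: "real \<Rightarrow> 'a pmf" assume v: "v \<in> controls" "v' \<in> controls"
    have int: "integrable unit_lebesgue (\<lambda>r. \<Sum>j\<in>UNIV. \<bar>pmf (v r) j - pmf (v' r) j\<bar>)"
      using v by (intro Bochner_Integration.integrable_sum integrable_unit_bounded[where B=1] controls_measurable
          borel_measurable_abs borel_measurable_diff) (auto simp: abs_le_iff pmf_le_1 add_increasing2 diff_le_eq)
    have "\<bar>(\<integral>r. indicator {a..<b} r * pmf (v r) j \<partial>unit_lebesgue) - (\<integral>r. indicator {a..<b} r * pmf (v' r) j \<partial>unit_lebesgue)\<bar>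
        = \<bar>\<integral>r. indicator {a..<b} r * pmf (v r) j - indicator {a..<b} r * pmf (v' r) j \<partial>unit_lebesgue\<bar>"
      using v by (simp add: integrable_block)
    also have "\<dots> \<le> (\<integral>r. \<bar>indicator {a..<b} r * pmf (v r) j - indicator {a..<b} r * pmf (v' r) j\<bar> \<partial>unit_lebesgue)"
      by (rule integral_abs_bound)
    also have "\<dots> \<le> L1_dist v v'"
      unfolding L1_dist_def
    proof (intro integral_mono int integrable_abs Bochner_Integration.integrable_diff integrable_block v)
      fix r
      have "\<bar>pmf (v r) j - pmf (v' r) j\<bar> \<le> (\<Sum>j\<in>UNIV. \<bar>pmf (v r) j - pmf (v' r) j\<bar>)"
        by (rule member_le_sum) auto
      then show "\<bar>indicator {a..<b} r * pmf (v r) j - indicator {a..<b} r * pmf (v' r) j\<bar> \<le> (\<Sum>j\<in>UNIV. \<bar>pmf (v r) j - pmf (v' r) j\<bar>)"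
        by (auto split: split_indicator intro: sum_nonneg)
    qed
    finally show "\<bar>(\<integral>r. indicator {a..<b} r * pmf (v r) j \<partial>unit_lebesgue) - (\<integral>r. indicator {a..<b} r * pmf (v' r) j \<partial>unit_lebesgue)\<bar> \<le> L1_dist v v'" .
  qed
  then have "(\<lambda>v. (\<integral>r. indicator {a..<b} r * pmf (v r) j \<partial>unit_lebesgue) / (b - a)) \<in> borel_measurable control_space"
    by (intro borel_measurable_divide borel_measurable_const)
  then show ?thesis
    by (subst measurable_cong[where g="\<lambda>v. (\<integral>r. indicator {a..<b} r * pmf (v r) j \<partial>unit_lebesgue) / (b - a)"])
      (simp_all add: pmf_block_avg)
qed

end

section \<open>Partition of the unit interval into stage blocks\<close>

locale time_blocks =
  fixes N :: nat and c :: "nat \<Rightarrow> real"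
  assumes c_0: "c 0 = 0" and c_N: "c N = 1" and c_less: "m < N \<Longrightarrow> c m < c (Suc m)"
begin

lemma c_mono: "m \<le> n \<Longrightarrow> n \<le> N \<Longrightarrow> c m \<le> c n"
proof (induction n rule: dec_induct)
  case (step n)
  then show ?case
    using c_less[of n] by simp
qed simp

lemma c_bounds: "m \<le> N \<Longrightarrow> 0 \<le> c m \<and> c m \<le> 1"
  using c_mono[of 0 m] c_mono[of m N] c_0 c_N by simp

lemma block_bounds: "m < N \<Longrightarrow> 0 \<le> c m" "m < N \<Longrightarrow> c m < c (Suc m)" "m < N \<Longrightarrow> c (Suc m) \<le> 1"
  using c_bounds[of m] c_bounds[of "Suc m"] c_less[of m] by auto

text \<open>Counting the interior cut points up to \<open>r\<close> makes measurability immediate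
  and keeps the index below \<open>N\<close> also at the right end.\<close>

definition blk :: "real \<Rightarrow> nat" where
  "blk r = (\<Sum>n\<in>{1..<N}. if c n \<le> r then 1 else 0)"

lemma blk_eq:
  assumes "m < N" "c m \<le> r" "r < c (Suc m)"
  shows "blk r = m"
proof -
  have "c n \<le> r \<longleftrightarrow> n \<le> m" if "n < N" for n
    using c_mono[of n m] c_mono[of "Suc m" n] that assms by (cases "n \<le> m") auto
  then have "blk r = (\<Sum>n\<in>{1..<N}. if n \<le> m then 1 else 0)"
    unfolding blk_def by (intro sum.cong) auto
  also have "\<dots> = card {n \<in> {1..<N}. n \<le> m}"
    by (simp add: sum.If_cases Int_def)
  also have "{n \<in> {1..<N}. n \<le> m} = {1..m}"
    using assms(1) by auto
  finally show ?thesis by simp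
qed

lemma blk_exists:
  assumes "0 \<le> r" "r < 1"
  obtains m where "m < N" "c m \<le> r" "r < c (Suc m)"
proof -
  define n where "n = (LEAST n. r < c n)"
  have n: "r < c n" "n \<le> N"
    unfolding n_def using c_N assms by (auto intro: LeastI[of _ N] Least_le)
  have "n \<noteq> 0"
  proof
    assume "n = 0"
    with n(1) c_0 assms show False by simp
  qed
  then obtain m where m: "n = Suc m"
    by (cases n) auto
  then have "c m \<le> r"
    using not_less_Least[of m "\<lambda>n. r < c n"] by (simp add: n_def not_less)
  with n m show ?thesis
    by (intro that[of m]) auto
qed

lemma blk_le:
  assumes "0 \<le> r" "r < c (Suc m)" "m < N"
  shows "blk r \<le> m"
proof -
  have "r < 1"
    using assms block_bounds(3)[of m] by simp
  then obtain n where n: "n < N" "c n \<le> r" "r < c (Suc n)"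
    using blk_exists assms by blast
  have "n \<le> m"
  proof (rule ccontr)
    assume "\<not> n \<le> m"
    then have "c (Suc m) \<le> c n"
      using n by (intro c_mono) auto
    with n assms show False by simp
  qed
  with blk_eq[OF n] show ?thesis by simp
qed

lemma measurable_blk: "blk \<in> measurable unit_lebesgue (count_space UNIV)"
proof -
  have "blk \<in> measurable borel (count_space UNIV)"
    unfolding blk_def[abs_def] by measurable
  then show ?thesis
    by (intro measurable_restrict_space1 measurable_completion) simp
qed

lemma step_control: "(\<lambda>r. a (blk r)) \<in> controls"
  unfolding controls_def
  by (intro CollectI allI measurable_compose[OF measurable_blk]) simp

text \<open>On each block the first control is constant, so bilinearity moves the integral onto the
  second. The time 1, which lies in no block, is a null set.\<close>

lemma running_payoff_step:
  fixes g :: "'i::finite \<Rightarrow> 'j::finite \<Rightarrow> real"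
  assumes v: "v \<in> controls"
  shows "running_payoff g (\<lambda>r. a (blk r), v) =
    (\<Sum>m<N. (c (Suc m) - c m) * mixed_payoff g (a m) (block_avg (c m) (c (Suc m)) v))"
proof -
  let ?I = "\<lambda>m. indicator {c m..<c (Suc m)} :: real \<Rightarrow> real"
  let ?f = "\<lambda>r. \<Sum>m<N. \<Sum>i\<in>UNIV. \<Sum>j\<in>UNIV. pmf (a m) i * g i j * (?I m r * pmf (v r) j)"
  have eq: "mixed_payoff g (a (blk r)) (v r) = ?f r" if r: "0 \<le> r" "r < 1" for r
  proof -
    obtain m where m: "m < N" "c m \<le> r" "r < c (Suc m)"
      using blk_exists[OF r] .
    have "?I n r = (if n = m then 1 else 0)" if "n < N" for n
    proof (cases "n = m")
      case False
      then have "\<not> (c n \<le> r \<and> r < c (Suc n))"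
        using blk_eq[OF m] blk_eq[OF that] by auto
      then show ?thesis
        using False by (simp add: indicator_def)
    qed (use m in simp)
    then have "?f r = (\<Sum>n<N. if n = m then (\<Sum>i\<in>UNIV. \<Sum>j\<in>UNIV. pmf (a n) i * g i j * pmf (v r) j) else 0)"
      by (intro sum.cong) auto
    then show ?thesis
      using m(1) by (simp add: blk_eq[OF m] mixed_payoff_def mult_ac)
  qed
  have "AE r in unit_lebesgue. mixed_payoff g (a (blk r)) (v r) = ?f r"
  proof -
    have "AE r in lebesgue. r \<notin> {1::real}"
      by (rule AE_not_in) (simp add: null_sets_completionI)
    then show ?thesis
      by (simp add: AE_restrict_space_iff) (erule eventually_mono, auto simp: eq)
  qed
  then have "running_payoff g (\<lambda>r. a (blk r), v) = (\<integral>r. ?f r \<partial>unit_lebesgue)"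
    unfolding running_payoff_def prod.case
  proof (rule integral_cong_AE[rotated 2])
    show "(\<lambda>r. mixed_payoff g (a (blk r)) (v r)) \<in> borel_measurable unit_lebesgue"
      unfolding mixed_payoff_def
      by (intro borel_measurable_sum borel_measurable_times borel_measurable_const controls_measurable v step_control)
    show "?f \<in> borel_measurable unit_lebesgue"
      by (intro borel_measurable_sum borel_measurable_times borel_measurable_const controls_measurable v borel_measurable_unit_indicator)
  qed
  also have "\<dots> = (\<Sum>m<N. \<Sum>i\<in>UNIV. \<Sum>j\<in>UNIV. pmf (a m) i * g i j * (\<integral>r. ?I m r * pmf (v r) j \<partial>unit_lebesgue))"
    using v by (simp add: Bochner_Integration.integral_sum Bochner_Integration.integrable_sum integrable_block integrable_mult_right)
  also have "\<dots> = (\<Sum>m<N. (c (Suc m) - c m) * mixed_payoff g (a m) (block_avg (c m) (c (Suc m)) v))"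
  proof (intro sum.cong refl)
    fix m assume "m \<in> {..<N}"
    then have m: "m < N" by simp
    have "(\<integral>r. ?I m r * pmf (v r) j \<partial>unit_lebesgue) = (c (Suc m) - c m) * pmf (block_avg (c m) (c (Suc m)) v) j" for j
      using block_bounds[OF m] by (subst pmf_block_avg[OF _ _ _ v]) auto
    then show "(\<Sum>i\<in>UNIV. \<Sum>j\<in>UNIV. pmf (a m) i * g i j * (\<integral>r. ?I m r * pmf (v r) j \<partial>unit_lebesgue)) =
        (c (Suc m) - c m) * mixed_payoff g (a m) (block_avg (c m) (c (Suc m)) v)"
      by (simp add: mixed_payoff_def sum_distrib_left mult_ac)
  qed
  finally show ?thesis .
qed

end


section \<open>Drawing actions from uniform variables\<close>

text \<open>Finite types come without an order; an arbitrary injection fixes the order in which the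
  slots are laid out.\<close>

definition action_rank :: "'a::finite \<Rightarrow> nat" where
  "action_rank = (SOME f. inj f)"

lemma inj_action_rank: "inj (action_rank :: 'a::finite \<Rightarrow> nat)"
proof -
  have "\<exists>f :: 'a \<Rightarrow> nat. inj f"
    using finite_imp_inj_to_nat_seg[of "UNIV :: 'a set"] by auto
  then show ?thesis
    unfolding action_rank_def by (rule someI_ex)
qed

definition cum_prob :: "'a::finite pmf \<Rightarrow> 'a \<Rightarrow> real" where
  "cum_prob p a = (\<Sum>b | action_rank b < action_rank a. pmf p b)"

definition draw_slot :: "'a::finite pmf \<Rightarrow> 'a \<Rightarrow> real set" where
  "draw_slot p a = {cum_prob p a..<cum_prob p a + pmf p a}"

text \<open>The slots cover exactly \<open>[0,1)\<close>; elsewhere the drawn action is junk.\<close>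

definition draw :: "'a::finite pmf \<Rightarrow> real \<Rightarrow> 'a" where
  "draw p x = (SOME a. x \<in> draw_slot p a)"

lemma draw_slot_disjoint:
  assumes "x \<in> draw_slot p a" "x \<in> draw_slot p b"
  shows "a = b"
proof -
  have le: "cum_prob p a + pmf p a \<le> cum_prob p b" if "action_rank a < action_rank b" for a b
  proof -
    have "cum_prob p a + pmf p a = (\<Sum>d\<in>insert a {d. action_rank d < action_rank a}. pmf p d)"
      by (simp add: cum_prob_def)
    also have "\<dots> \<le> cum_prob p b"
      unfolding cum_prob_def using that by (intro sum_mono2) auto
    finally show ?thesis .
  qed
  have "action_rank a = action_rank b"
  proof (rule ccontr)
    assume "action_rank a \<noteq> action_rank b"
    then consider "action_rank a < action_rank b" | "action_rank b < action_rank a"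
      by linarith
    then show False
      using le[of a b] le[of b a] assms by cases (auto simp: draw_slot_def)
  qed
  then show ?thesis
    using inj_action_rank by (auto dest: injD)
qed

text \<open>Removes the choice in favour of interval conditions, from which measurability can be
  read off. \<open>SOME b. False\<close> is the value chosen when no slot contains
  \<open>x\<close>.\<close>

lemma draw_eq_iff:
  "draw p x = a \<longleftrightarrow> x \<in> draw_slot p a \<or> ((\<forall>b. x \<notin> draw_slot p b) \<and> a = (SOME b. False))"
proof (cases "\<exists>b. x \<in> draw_slot p b")
  case True
  then have "x \<in> draw_slot p (draw p x)"
    unfolding draw_def by (rule someI_ex)
  then show ?thesis
    using draw_slot_disjoint by blast
next
  case False
  then have "draw p x = (SOME b. False)"
    by (simp add: draw_def)
  with False show ?thesis by auto
qed

lemma measurable_draw: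
  assumes [measurable]: "\<And>a. (\<lambda>z. pmf (p z) a) \<in> borel_measurable M" "x \<in> borel_measurable M"
  shows "Measurable.pred M (\<lambda>z. draw (p z) (x z) = a)"
  unfolding draw_eq_iff draw_slot_def atLeastLessThan_iff cum_prob_def by measurable

abbreviation unit_borel :: "real measure" where
  "unit_borel \<equiv> restrict_space lborel {0..1}"

lemma prob_space_unit_borel: "prob_space unit_borel"
  by (rule prob_spaceI) (simp add: emeasure_restrict_space)

lemma measurable_draw_set: "{x \<in> space unit_borel. draw p x = a} \<in> sets unit_borel"
proof -
  have "Measurable.pred unit_borel (\<lambda>x. draw p x = a)"
    by (rule measurable_draw) (auto intro: measurable_restrict_space1)
  then show ?thesis
    by (simp add: pred_def)
qed

text \<open>Each slot gives a lower bound, and both families sum to one, so all bounds are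
  equalities. The points outside the slots thus need no separate treatment.\<close>

lemma measure_draw: "measure unit_borel {x \<in> space unit_borel. draw p x = a} = pmf p a"
proof -
  interpret prob_space unit_borel
    by (rule prob_space_unit_borel)
  let ?D = "\<lambda>a. {x \<in> space unit_borel. draw p x = a}"
  have le: "pmf p a \<le> prob (?D a)" for a
  proof -
    have "cum_prob p a + pmf p a = (\<Sum>d\<in>insert a {d. action_rank d < action_rank a}. pmf p d)"
      by (simp add: cum_prob_def)
    also have "\<dots> \<le> (\<Sum>d\<in>UNIV. pmf p d)"
      by (intro sum_mono2) auto
    finally have 1: "cum_prob p a + pmf p a \<le> 1"
      by simp
    have 0: "0 \<le> cum_prob p a"
      unfolding cum_prob_def by (intro sum_nonneg) auto
    have sub: "draw_slot p a \<subseteq> {0..1}"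
      using 0 1 by (auto simp: draw_slot_def)
    have "pmf p a = measure lborel (draw_slot p a)"
      by (simp add: draw_slot_def)
    also have "\<dots> = prob (draw_slot p a)"
      using sub by (subst measure_restrict_space) auto
    also have "\<dots> \<le> prob (?D a)"
      using sub by (intro finite_measure_mono measurable_draw_set) (auto simp: draw_eq_iff)
    finally show ?thesis .
  qed
  have "(\<Sum>a\<in>UNIV. prob (?D a)) = prob (\<Union>a\<in>UNIV. ?D a)"
    by (rule finite_measure_finite_Union[symmetric]) (use measurable_draw_set in \<open>auto simp: disjoint_family_on_def\<close>)
  also have "(\<Union>a\<in>UNIV. ?D a) = space unit_borel"
    by auto
  also have "prob (space unit_borel) = 1"
    by (rule prob_space)
  finally have "(\<Sum>a\<in>UNIV. prob (?D a) - pmf p a) = 0"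
    by (simp only: sum_subtractf sum_pmf_UNIV diff_self)
  then have "\<forall>a\<in>UNIV. prob (?D a) - pmf p a = 0"
    using le by (subst (asm) sum_nonneg_eq_0_iff) auto
  then show ?thesis by auto
qed

section \<open>Histories driven by independent uniform variables\<close>

primrec sim :: "('c::finite list \<Rightarrow> 'c pmf) \<Rightarrow> (nat \<Rightarrow> real) \<Rightarrow> nat \<Rightarrow> 'c list" where
  "sim q \<omega> 0 = []"
| "sim q \<omega> (Suc m) = sim q \<omega> m @ [draw (q (sim q \<omega> m)) (\<omega> m)]"

lemma length_sim [simp]: "length (sim q \<omega> n) = n"
  by (induction n) auto

lemma take_sim: "m \<le> n \<Longrightarrow> take m (sim q \<omega> n) = sim q \<omega> m"
  by (induction n) (auto simp: le_Suc_eq)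

text \<open>The kernels have to agree only along the simulated history; this is what later unwinds
  the loop between the two players.\<close>

lemma sim_cong: "(\<And>m. m < n \<Longrightarrow> q (sim q \<omega> m) = q' (sim q \<omega> m)) \<Longrightarrow> sim q \<omega> n = sim q' \<omega> n"
proof (induction n)
  case (Suc n)
  then have eq: "sim q \<omega> n = sim q' \<omega> n"
    by simp
  then show ?case
    using Suc.prems[of n] by (simp flip: eq)
qed simp

text \<open>With \<open>h\<close> fixed, every kernel is evaluated at a prefix of \<open>h\<close>,
  so the event is an intersection of conditions on single coordinates. Measurability and the product
  formula both follow from this.\<close>

lemma sim_eq_iff: "sim q \<omega> n = h \<longleftrightarrow> length h = n \<and> (\<forall>m<n. draw (q (take m h)) (\<omega> m) = h ! m)"
proof (induction n arbitrary: h)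
  case (Suc n)
  show ?case
  proof (cases "length h = Suc n")
    case True
    have h: "h = take n h @ [h ! n]"
      using True by (metis lessI take_Suc_conv_app_nth take_all order_refl)
    have "sim q \<omega> (Suc n) = h \<longleftrightarrow> sim q \<omega> n = take n h \<and> draw (q (take n h)) (\<omega> n) = h ! n"
      by (subst h) auto
    also have "sim q \<omega> n = take n h \<longleftrightarrow> (\<forall>m<n. draw (q (take m h)) (\<omega> m) = h ! m)"
      using True by (simp add: Suc.IH min_def)
    finally show ?thesis
      using True by (auto simp: less_Suc_eq)
  next
    case False
    then show ?thesis
      using length_sim[of q \<omega> "Suc n"] by (metis)
  qed
qed auto

lemma prob_space_cube: "prob_space (cube n)"
  unfolding cube_def by (intro prob_space_PiM prob_space_unit_borel)

lemma measurable_cube_component: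
  assumes "m < n"
  shows "(\<lambda>\<omega>. \<omega> m) \<in> borel_measurable (cube n)"
proof -
  have "(\<lambda>\<omega>. \<omega> m) \<in> measurable (cube n) unit_borel"
    unfolding cube_def using assms by (intro measurable_component_singleton) auto
  then show ?thesis
    by (simp add: measurable_restrict_space2_iff)
qed

lemma measure_sim:
  assumes "n \<le> N" "length h = n"
  shows "measure (cube N) {\<omega> \<in> space (cube N). sim q \<omega> n = h} = lik id q h"
proof -
  interpret product_prob_space "\<lambda>_. unit_borel" "{..<N}"
    by (intro product_prob_spaceI prob_space_unit_borel)
  let ?D = "\<lambda>m. {x \<in> space unit_borel. m < n \<longrightarrow> draw (q (take m h)) x = h ! m}"
  have D: "?D m \<in> sets unit_borel" for m
  proof (cases "m < n")
    case True
    then show ?thesis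
      using measurable_draw_set[of "q (take m h)" "h ! m"] by (simp only: simp_thms)
  next
    case False
    then have "?D m = space unit_borel"
      by auto
    then show ?thesis
      by (simp only: sets.top)
  qed
  have "{\<omega> \<in> space (cube N). sim q \<omega> n = h} = PiE {..<N} ?D"
  proof -
    have iff: "(\<forall>m\<in>{..<N}. \<omega> m \<in> space unit_borel \<and> (m < n \<longrightarrow> draw (q (take m h)) (\<omega> m) = h ! m)) \<longleftrightarrow>
        (\<forall>m\<in>{..<N}. \<omega> m \<in> space unit_borel) \<and> (\<forall>m<n. draw (q (take m h)) (\<omega> m) = h ! m)" for \<omega>
      using assms(1) by (meson lessThan_iff order_less_le_trans)
    show ?thesis
      unfolding set_eq_iff mem_Collect_eq cube_def space_PiM PiE_iff sim_eq_iff iff using assms(2) by blast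
  qed
  then have "emeasure (cube N) {\<omega> \<in> space (cube N). sim q \<omega> n = h} = (\<Prod>m<N. emeasure unit_borel (?D m))"
    unfolding cube_def using D by (simp add: emeasure_PiM)
  also have "\<dots> = (\<Prod>m<n. emeasure unit_borel (?D m))"
  proof (intro prod.mono_neutral_right ballI)
    fix m assume "m \<in> {..<N} - {..<n}"
    then have "?D m = space unit_borel"
      by auto
    then show "emeasure unit_borel (?D m) = 1"
      by (simp only: M.emeasure_space_1)
  qed (use assms in auto)
  also have "\<dots> = (\<Prod>m<n. ennreal (pmf (q (take m h)) (h ! m)))"
  proof (intro prod.cong refl)
    fix m assume "m \<in> {..<n}"
    then have "?D m = {x \<in> space unit_borel. draw (q (take m h)) x = h ! m}"
      by auto
    then show "emeasure unit_borel (?D m) = ennreal (pmf (q (take m h)) (h ! m))"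
      by (simp only: M.emeasure_eq_measure measure_draw)
  qed
  also have "\<dots> = ennreal (lik id q h)"
    using assms by (simp add: lik_def prod_ennreal)
  finally show ?thesis
    by (simp add: measure_def)
qed


section \<open>Simulating the repeated game in continuous time\<close>

context time_blocks
begin

text \<open>Although given the whole history, at time \<open>r\<close> the control reads only the
  pairs of the blocks before that of \<open>r\<close>.\<close>

definition public_control :: "('c list \<Rightarrow> 'i::finite pmf) \<Rightarrow> 'c list \<Rightarrow> real \<Rightarrow> 'i pmf" where
  "public_control x h = (\<lambda>r. x (take (blk r) h))"

definition observed :: "(real \<Rightarrow> 'j::finite pmf) \<Rightarrow> nat \<Rightarrow> 'j pmf" where
  "observed v m = block_avg (c m) (c (Suc m)) v"

text \<open>
  The player draws, from his own randomness, both his action in the repeated game and an action of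
  the opponent distributed as the average of the opponent's control on the elapsed block; on the
  next block he only plays the mixed action \<open>x\<close>, which depends on his type through the history alone.
\<close>

definition simulate ::
  "(('i \<times> 'j) list \<Rightarrow> 'i pmf) \<Rightarrow> (('i \<times> 'j) list \<Rightarrow> 'i pmf) \<Rightarrow> (nat \<Rightarrow> real) \<Rightarrow>
    (real \<Rightarrow> 'j::finite pmf) \<Rightarrow> real \<Rightarrow> 'i::finite pmf" where
  "simulate s x \<omega> v = public_control x (sim (\<lambda>h. pair_pmf (s h) (observed v (length h))) \<omega> N)"

text \<open>The strategy of the repeated game contained in \<open>f\<close>. On block
  \<open>length h\<close> the public control has just used all of \<open>h\<close>, and by causality
  the answer there is not influenced by what follows. The player's type does not occur, so this is
  one strategy against all types.\<close>

definition response :: "('c list \<Rightarrow> 'i::finite pmf) \<Rightarrow> ((real \<Rightarrow> 'i pmf) \<Rightarrow> (real \<Rightarrow> 'j::finite pmf)) \<Rightarrow> 'c list \<Rightarrow> 'j pmf" where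
  "response x f h = observed (f (public_control x h)) (length h)"

lemma public_control_controls: "public_control x h \<in> controls"
  using step_control[of "\<lambda>m. x (take m h)"] by (simp add: public_control_def)

lemma public_control_agree:
  assumes "m < N" "take m h = take m h'"
  shows "agree (c (Suc m)) (public_control x h) (public_control x h')"
proof (rule agree_pointwise)
  fix r assume "0 \<le> r" "r < c (Suc m)"
  then have "blk r \<le> m"
    using assms by (intro blk_le)
  then have "take (blk r) h = take (blk r) h'"
    using arg_cong[OF assms(2), of "take (blk r)"] by (simp add: min_def)
  then show "public_control x h r = public_control x h' r"
    by (simp add: public_control_def)
qed

lemma observed_cong:
  assumes "m < N" "agree (c (Suc m)) v v'" "v \<in> controls" "v' \<in> controls"
  shows "observed v m = observed v' m"
  unfolding observed_def using assms block_bounds by (intro block_avg_cong) auto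

lemma sim_observed_cong:
  assumes "n \<le> N" "agree (c n) v v'" "v \<in> controls" "v' \<in> controls"
  shows "sim (\<lambda>h. pair_pmf (s h) (observed v (length h))) \<omega> n =
    sim (\<lambda>h. pair_pmf (s h) (observed v' (length h))) \<omega> n"
proof (rule sim_cong)
  fix m assume "m < n"
  then have "observed v m = observed v' m"
    using assms c_mono[of "Suc m" n] by (intro observed_cong agree_mono[OF assms(2)]) auto
  then show "pair_pmf (s (sim (\<lambda>h. pair_pmf (s h) (observed v (length h))) \<omega> m))
      (observed v (length (sim (\<lambda>h. pair_pmf (s h) (observed v (length h))) \<omega> m))) =
    pair_pmf (s (sim (\<lambda>h. pair_pmf (s h) (observed v (length h))) \<omega> m))
      (observed v' (length (sim (\<lambda>h. pair_pmf (s h) (observed v (length h))) \<omega> m)))"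
    by simp
qed

text \<open>Block \<open>m\<close> is played according to the first \<open>m\<close> drawn pairs,
  which need the opponent's averages on earlier blocks only: a delay of one block.\<close>

lemma delayed_simulate:
  fixes s :: "('i::finite \<times> 'j::finite) list \<Rightarrow> 'i pmf"
  shows "delayed N c (simulate s x \<omega>)"
  unfolding delayed_def
proof (intro conjI allI impI ballI)
  fix m and v v' :: "real \<Rightarrow> 'j pmf"
  assume m: "m < N" and v: "v \<in> controls" "v' \<in> controls" "agree (c m) v v'"
  show "agree (c (Suc m)) (simulate s x \<omega> v) (simulate s x \<omega> v')"
    unfolding simulate_def
    using m v by (intro public_control_agree) (simp_all add: take_sim sim_observed_cong[of m v v'])
qed (auto simp: c_0 c_N c_less simulate_def public_control_controls)

lemma measurable_observed: "m < N \<Longrightarrow> (\<lambda>v. pmf (observed v m) j) \<in> borel_measurable control_space"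
  unfolding observed_def using block_bounds by (intro measurable_block_avg)

lemma pmf_pair_pmf: "pmf (pair_pmf p q) a = pmf p (fst a) * pmf q (snd a)"
  by (cases a) (simp add: pmf_pair)

text \<open>The simulated history has countably many values, so joint measurability reduces to the
  events that it equals a given \<open>h\<close>; each is a finite conjunction of conditions on
  draws.\<close>

lemma simulate_random_strategies:
  fixes s :: "('i::finite \<times> 'j::finite) list \<Rightarrow> 'i pmf"
  shows "(N, simulate s x) \<in> random_strategies"
proof -
  let ?M = "cube N \<Otimes>\<^sub>M control_space :: ((nat \<Rightarrow> real) \<times> (real \<Rightarrow> 'j pmf)) measure"
  let ?q = "\<lambda>v h. pair_pmf (s h) (observed v (length h)) :: ('i \<times> 'j) pmf"
  have N: "1 \<le> N"
    using c_0 c_N by (cases N) auto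
  have pred: "Measurable.pred ?M (\<lambda>(\<omega>, v). sim (?q v) \<omega> N = h)" for h :: "('i \<times> 'j) list"
  proof (cases "length h = N")
    case True
    have "Measurable.pred ?M (\<lambda>z. draw (?q (snd z) (take m h)) (fst z m) = h ! m)" if m: "m < N" for m
    proof (rule measurable_draw)
      show "(\<lambda>z. pmf (?q (snd z) (take m h)) a) \<in> borel_measurable ?M" for a
        unfolding pmf_pair_pmf using True m
        by (intro borel_measurable_times borel_measurable_const measurable_compose[OF measurable_snd measurable_observed]) auto
      show "(\<lambda>z. fst z m) \<in> borel_measurable ?M"
        using m by (intro measurable_compose[OF measurable_fst measurable_cube_component])
    qed
    then have "Measurable.pred ?M (\<lambda>z. \<forall>m\<in>{..<N}. draw (?q (snd z) (take m h)) (fst z m) = h ! m)"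
      by (intro pred_intros_finite) auto
    moreover have "(\<lambda>(\<omega>, v). sim (?q v) \<omega> N = h) = (\<lambda>z. \<forall>m\<in>{..<N}. draw (?q (snd z) (take m h)) (fst z m) = h ! m)"
      using True by (auto simp: fun_eq_iff sim_eq_iff)
    ultimately show ?thesis by simp
  next
    case False
    then have "(\<lambda>(\<omega>, v). sim (?q v) \<omega> N = h) = (\<lambda>_. False)"
      by (auto simp: fun_eq_iff sim_eq_iff)
    then show ?thesis by simp
  qed
  have "(\<lambda>(\<omega>, v). sim (?q v) \<omega> N) \<in> measurable ?M (count_space UNIV)"
  proof (rule measurable_count_space_eq2_countable[THEN iffD2], intro conjI ballI)
    fix h :: "('i \<times> 'j) list"
    have "(\<lambda>(\<omega>, v). sim (?q v) \<omega> N) -` {h} \<inter> space ?M = {z \<in> space ?M. (\<lambda>(\<omega>, v). sim (?q v) \<omega> N = h) z}"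
      by auto
    then show "(\<lambda>(\<omega>, v). sim (?q v) \<omega> N) -` {h} \<inter> space ?M \<in> sets ?M"
      using pred[of h] by (simp only: pred_def)
  qed simp_all
  moreover have "public_control x \<in> measurable (count_space UNIV) control_space"
    by (simp add: measurable_count_space_eq1 public_control_controls)
  ultimately have "(\<lambda>z. public_control x ((\<lambda>(\<omega>, v). sim (?q v) \<omega> N) z)) \<in> measurable ?M control_space"
    by (rule measurable_compose)
  then have "(\<lambda>(\<omega>, v). simulate s x \<omega> v) \<in> measurable ?M control_space"
    by (simp add: simulate_def case_prod_unfold)
  moreover have "nonanticipative_with_delay (space (cube N)) (simulate s x)"
    unfolding nonanticipative_with_delay_def
  proof (intro exI[of _ N] exI[of _ c] conjI allI impI ballI)
    fix m \<omega> and v v' :: "real \<Rightarrow> 'j pmf"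
    assume "m < N" "v \<in> controls" "v' \<in> controls" "AE r in lebesgue_on {c 0..c m}. v r = v' r"
    then show "AE r in lebesgue_on {c 0..c (Suc m)}. simulate s x \<omega> v r = simulate s x \<omega> v' r"
      using delayed_simulate[of s x \<omega>] unfolding delayed_def agree_def c_0 by blast
  qed (simp_all add: c_0 c_N c_less)
  ultimately show ?thesis
    using N by (simp add: random_strategies_def)
qed

text \<open>The pair of controls solves a fixed-point equation, yet the history behind it can be
  generated forwards: on each block the opponent's average is the response to the prefix drawn so
  far.\<close>

lemma running_payoff_simulate:
  fixes s :: "('i::finite \<times> 'j::finite) list \<Rightarrow> 'i pmf"
  assumes f: "delayed N' s' f" and uv: "consistent (simulate s x \<omega>) f u v"
  shows "running_payoff g (u, v) = (\<Sum>m<N. (c (Suc m) - c m) *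
    (let h = sim (\<lambda>h. pair_pmf (s h) (response x f h)) \<omega> m in mixed_payoff g (x h) (response x f h)))"
proof -
  let ?q = "\<lambda>v h. pair_pmf (s h) (observed v (length h)) :: ('i \<times> 'j) pmf"
  let ?Q = "\<lambda>h. pair_pmf (s h) (response x f h) :: ('i \<times> 'j) pmf"
  define h where "h = sim (?q v) \<omega> N"
  \<comment> \<open>Almost everywhere equal to \<open>v\<close>, but determined by the history
    \<open>h\<close> through \<open>f\<close>.\<close>
  define w where "w = f (public_control x h)"
  have len: "length h = N"
    by (simp add: h_def)
  note uv = uv[unfolded consistent_def]
  have u: "agree 1 u (public_control x h)"
    using uv by (simp add: simulate_def h_def agree_sym)
  have w: "w \<in> controls"
    using f public_control_controls[of x h] by (simp add: w_def delayed_def)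
  have "agree 1 (f u) w"
    unfolding w_def using u uv by (intro delayed_causal[OF f] public_control_controls) auto
  then have v: "agree 1 v w"
    using uv agree_sym agree_trans by blast
  have h_w: "h = sim (?q w) \<omega> N"
    unfolding h_def using v w uv by (intro sim_observed_cong) (simp_all add: c_N)
  \<comment> \<open>Up to the end of block \<open>m\<close> the public controls of \<open>h\<close>
    and of \<open>take m h\<close> coincide, and causality of \<open>f\<close> carries this over to
    the answers.\<close>
  have obs: "observed w m = response x f (take m h)" if m: "m < N" for m
  proof -
    have "agree (c (Suc m)) w (f (public_control x (take m h)))"
      unfolding w_def using m block_bounds c_bounds[of "Suc m"]
      by (intro delayed_causal[OF f] public_control_controls public_control_agree) auto
    then show ?thesis
      using m len f w by (simp add: response_def observed_cong delayed_def public_control_controls)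
  qed
  \<comment> \<open>The simulation fed by the actual control thus coincides with the one fed by a
    fixed behaviour strategy, whose law is known.\<close>
  have hm: "take m h = sim ?Q \<omega> m" if m: "m \<le> N" for m
  proof -
    have "take n h = sim (?q w) \<omega> n" if "n \<le> N" for n
      unfolding h_w using that by (rule take_sim)
    then have "observed w n = response x f (sim (?q w) \<omega> n)" if "n < m" for n
      using obs[of n] m that by simp
    then have "sim (?q w) \<omega> m = sim ?Q \<omega> m"
      by (intro sim_cong) simp
    then show ?thesis
      unfolding h_w by (simp add: take_sim m)
  qed
  have "running_payoff g (u, v) = running_payoff g (public_control x h, w)"
    using uv w by (intro running_payoff_cong u v public_control_controls) auto
  also have "\<dots> = (\<Sum>m<N. (c (Suc m) - c m) * mixed_payoff g (x (take m h)) (observed w m))"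
    unfolding public_control_def observed_def by (rule running_payoff_step[OF w])
  also have "\<dots> = (\<Sum>m<N. (c (Suc m) - c m) * mixed_payoff g (x (sim ?Q \<omega> m)) (response x f (sim ?Q \<omega> m)))"
    by (intro sum.cong refl) (simp add: obs hm)
  finally show ?thesis
    by (simp add: Let_def)
qed

lemma measurable_response:
  assumes "(m', \<beta>) \<in> random_strategies" "length h < N"
  shows "(\<lambda>\<omega>. pmf (response x (\<beta> \<omega>) h) j) \<in> borel_measurable (cube m')"
proof -
  have "(\<lambda>(\<omega>, u). \<beta> \<omega> u) \<in> measurable (cube m' \<Otimes>\<^sub>M control_space) control_space"
    using assms(1) by (simp add: random_strategies_def)
  from measurable_compose[OF measurable_Pair2' this] public_control_controls[of x h]
  have "(\<lambda>\<omega>. \<beta> \<omega> (public_control x h)) \<in> measurable (cube m') control_space"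
    by (simp add: case_prod_unfold)
  from measurable_compose[OF this measurable_observed[OF assms(2)]] show ?thesis
    by (simp add: response_def)
qed

lemma lik_pair: "lik id (\<lambda>h. pair_pmf (s h) (t h)) h = lik fst s h * lik snd t h"
  by (simp add: lik_def pmf_pair_pmf prod.distrib)

text \<open>For a fixed seed of the opponent the response is a fixed behaviour strategy, so
  integrating over the player's seed gives \<open>public_payoff\<close>. The controls are picked by
  a choice operator; on the product space their payoff equals an explicit measurable function, to
  which Fubini applies.\<close>

lemma integral_simulate:
  fixes s :: "('i::finite \<times> 'j::finite) list \<Rightarrow> 'i pmf"
  assumes \<beta>: "\<beta> \<in> random_strategies"
  shows "(\<integral>\<omega>. running_payoff g (induced_controls (N, simulate s x) \<beta> (fst \<omega>) (snd \<omega>)) \<partial>(cube N \<Otimes>\<^sub>M cube (fst \<beta>))) =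
      (\<integral>\<omega>. (\<Sum>m<N. (c (Suc m) - c m) * public_payoff g s x (response x (snd \<beta> \<omega>)) m) \<partial>cube (fst \<beta>))"
    and "integrable (cube (fst \<beta>)) (\<lambda>\<omega>. \<Sum>m<N. (c (Suc m) - c m) * public_payoff g s x (response x (snd \<beta> \<omega>)) m)"
proof -
  interpret C1: prob_space "cube N"
    by (rule prob_space_cube)
  interpret C2: prob_space "cube (fst \<beta>)"
    by (rule prob_space_cube)
  interpret P: pair_prob_space "cube N" "cube (fst \<beta>)" ..
  obtain m' b where b: "\<beta> = (m', b)"
    by (cases \<beta>)
  obtain B where B: "0 \<le> B" "\<And>i j. \<bar>g i j\<bar> \<le> B"
    using ex_payoff_bound[of "\<lambda>_::unit. \<lambda>_::unit. g"] by metis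
  let ?T = "\<lambda>\<omega>. response x (b \<omega>) :: ('i \<times> 'j) list \<Rightarrow> 'j pmf"
  let ?Q = "\<lambda>\<omega> h. pair_pmf (s h) (?T \<omega> h) :: ('i \<times> 'j) pmf"
  let ?P = "cube N \<Otimes>\<^sub>M cube m'"
  \<comment> \<open>Expansion over finitely many histories reduces measurability to events and mixed
    payoffs, and the integral over \<open>\<omega>\<^sub>1\<close> to
    \<open>measure_sim\<close>.\<close>
  let ?F = "\<lambda>m \<omega>\<^sub>1 \<omega>\<^sub>2. \<Sum>h\<in>hist m. indicator {\<omega>\<^sub>1. sim (?Q \<omega>\<^sub>2) \<omega>\<^sub>1 m = h} \<omega>\<^sub>1 * mixed_payoff g (x h) (?T \<omega>\<^sub>2 h) :: real"
  have T: "(\<lambda>\<omega>. pmf (?T \<omega> h) j) \<in> borel_measurable (cube m')" if "length h < N" for h j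
    using measurable_response[of m' b h] \<beta> that by (simp add: b)
  have mixed_meas: "(\<lambda>\<omega>. mixed_payoff g (x h) (?T \<omega> h)) \<in> borel_measurable (cube m')" if "length h < N" for h
    unfolding mixed_payoff_def using that by (intro borel_measurable_sum borel_measurable_times borel_measurable_const T)
  have rp: "running_payoff g (induced_controls (N, simulate s x) \<beta> \<omega>\<^sub>1 \<omega>\<^sub>2) = (\<Sum>m<N. (c (Suc m) - c m) * ?F m \<omega>\<^sub>1 \<omega>\<^sub>2)"
    if \<omega>: "\<omega>\<^sub>1 \<in> space (cube N)" "\<omega>\<^sub>2 \<in> space (cube m')" for \<omega>\<^sub>1 \<omega>\<^sub>2
  proof -
    obtain u v where uv: "induced_controls (N, simulate s x) \<beta> \<omega>\<^sub>1 \<omega>\<^sub>2 = (u, v)"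
      by (cases "induced_controls (N, simulate s x) \<beta> \<omega>\<^sub>1 \<omega>\<^sub>2")
    have "consistent (simulate s x \<omega>\<^sub>1) (b \<omega>\<^sub>2) u v"
      using consistent_induced_controls[OF simulate_random_strategies[of s x] \<beta>, of \<omega>\<^sub>1 \<omega>\<^sub>2] \<omega> by (simp add: uv[unfolded b] b)
    moreover obtain N' s' where "delayed N' s' (b \<omega>\<^sub>2)"
      using random_strategies_delayed[of m' b \<omega>\<^sub>2] \<beta> \<omega> by (auto simp: b)
    ultimately have "running_payoff g (u, v) = (\<Sum>m<N. (c (Suc m) - c m) *
        (let h = sim (?Q \<omega>\<^sub>2) \<omega>\<^sub>1 m in mixed_payoff g (x h) (?T \<omega>\<^sub>2 h)))"
      by (rule running_payoff_simulate[rotated])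
    moreover have "?F m \<omega>\<^sub>1 \<omega>\<^sub>2 = (let h = sim (?Q \<omega>\<^sub>2) \<omega>\<^sub>1 m in mixed_payoff g (x h) (?T \<omega>\<^sub>2 h))" for m
    proof -
      have "?F m \<omega>\<^sub>1 \<omega>\<^sub>2 = (\<Sum>h\<in>{sim (?Q \<omega>\<^sub>2) \<omega>\<^sub>1 m}. indicator {\<omega>\<^sub>1. sim (?Q \<omega>\<^sub>2) \<omega>\<^sub>1 m = h} \<omega>\<^sub>1 * mixed_payoff g (x h) (?T \<omega>\<^sub>2 h))"
        by (intro sum.mono_neutral_right finite_hist) (auto simp: hist_def)
      then show ?thesis
        by (simp add: Let_def)
    qed
    ultimately show ?thesis
      by (simp only: uv)
  qed
  have ind_meas: "(\<lambda>z. indicator {\<omega>\<^sub>1. sim (?Q (snd z)) \<omega>\<^sub>1 m = h} (fst z) :: real) \<in> borel_measurable ?P"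
    if m: "m < N" "h \<in> hist m" for m h
  proof -
    have len: "length h = m"
      using m by (simp add: hist_def)
    have "Measurable.pred ?P (\<lambda>z. draw (?Q (snd z) (take n h)) (fst z n) = h ! n)" if "n < m" for n
    proof (rule measurable_draw)
      show "(\<lambda>z. pmf (?Q (snd z) (take n h)) a) \<in> borel_measurable ?P" for a
        unfolding pmf_pair_pmf using len m that
        by (intro borel_measurable_times borel_measurable_const measurable_compose[OF measurable_snd T]) auto
      show "(\<lambda>z. fst z n) \<in> borel_measurable ?P"
        using m that by (intro measurable_compose[OF measurable_fst measurable_cube_component]) auto
    qed
    then have "Measurable.pred ?P (\<lambda>z. \<forall>n\<in>{..<m}. draw (?Q (snd z) (take n h)) (fst z n) = h ! n)"
      by (intro pred_intros_finite) auto
    moreover have "sim (?Q \<omega>\<^sub>2) \<omega>\<^sub>1 m = h \<longleftrightarrow> (\<forall>n\<in>{..<m}. draw (?Q \<omega>\<^sub>2 (take n h)) (\<omega>\<^sub>1 n) = h ! n)" for \<omega>\<^sub>1 \<omega>\<^sub>2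
      unfolding sim_eq_iff using len by blast
    ultimately have "Measurable.pred ?P (\<lambda>z. sim (?Q (snd z)) (fst z) m = h)"
      by (simp only:)
    then have "(\<lambda>z. if sim (?Q (snd z)) (fst z) m = h then 1 else 0 :: real) \<in> borel_measurable ?P"
      by (intro measurable_If) auto
    then show ?thesis
      by (simp add: indicator_def of_bool_def)
  qed
  have int: "integrable ?P (\<lambda>(\<omega>\<^sub>1, \<omega>\<^sub>2). indicator {\<omega>\<^sub>1. sim (?Q \<omega>\<^sub>2) \<omega>\<^sub>1 m = h} \<omega>\<^sub>1 * mixed_payoff g (x h) (?T \<omega>\<^sub>2 h))"
    if m: "m < N" "h \<in> hist m" for m h
  proof (rule P.integrable_const_bound[where B=B, unfolded b fst_conv])
    show "AE z in ?P. norm (case z of (\<omega>\<^sub>1, \<omega>\<^sub>2) \<Rightarrow> indicator {\<omega>\<^sub>1. sim (?Q \<omega>\<^sub>2) \<omega>\<^sub>1 m = h} \<omega>\<^sub>1 * mixed_payoff g (x h) (?T \<omega>\<^sub>2 h)) \<le> B"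
      using abs_mixed_payoff_le[of g B, OF B(2)] B(1) by (intro AE_I2) (auto split: prod.split split_indicator)
    show "(\<lambda>(\<omega>\<^sub>1, \<omega>\<^sub>2). indicator {\<omega>\<^sub>1. sim (?Q \<omega>\<^sub>2) \<omega>\<^sub>1 m = h} \<omega>\<^sub>1 * mixed_payoff g (x h) (?T \<omega>\<^sub>2 h)) \<in> borel_measurable ?P"
      unfolding case_prod_unfold using m
      by (intro borel_measurable_times ind_meas measurable_compose[OF measurable_snd mixed_meas]) (auto simp: hist_def)
  qed
  have int2: "integrable ?P (\<lambda>(\<omega>\<^sub>1, \<omega>\<^sub>2). \<Sum>m<N. (c (Suc m) - c m) * ?F m \<omega>\<^sub>1 \<omega>\<^sub>2)"
    using int unfolding case_prod_unfold by (intro Bochner_Integration.integrable_sum integrable_mult_right) auto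
  have inner: "(\<integral>\<omega>\<^sub>1. (\<Sum>m<N. (c (Suc m) - c m) * ?F m \<omega>\<^sub>1 \<omega>\<^sub>2) \<partial>cube N) = (\<Sum>m<N. (c (Suc m) - c m) * public_payoff g s x (?T \<omega>\<^sub>2) m)"
    for \<omega>\<^sub>2
  proof -
    have meas: "{\<omega>\<^sub>1 \<in> space (cube N). sim (?Q \<omega>\<^sub>2) \<omega>\<^sub>1 m = h} \<in> sets (cube N)" if "m < N" "h \<in> hist m" for m h
    proof -
      have "Measurable.pred (cube N) (\<lambda>\<omega>. draw (?Q \<omega>\<^sub>2 (take n h)) (\<omega> n) = h ! n)" if "n < m" for n
        using that \<open>m < N\<close> by (intro measurable_draw measurable_cube_component) auto
      then have "Measurable.pred (cube N) (\<lambda>\<omega>. \<forall>n\<in>{..<m}. draw (?Q \<omega>\<^sub>2 (take n h)) (\<omega> n) = h ! n)"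
        by (intro pred_intros_finite) auto
      moreover have "sim (?Q \<omega>\<^sub>2) \<omega> m = h \<longleftrightarrow> (\<forall>n\<in>{..<m}. draw (?Q \<omega>\<^sub>2 (take n h)) (\<omega> n) = h ! n)" for \<omega>
        unfolding sim_eq_iff using that(2) by (auto simp only: hist_def mem_Collect_eq)
      ultimately show ?thesis
        by (simp only: pred_def)
    qed
    have I: "(\<integral>\<omega>\<^sub>1. indicator {\<omega>\<^sub>1. sim (?Q \<omega>\<^sub>2) \<omega>\<^sub>1 m = h} \<omega>\<^sub>1 * mixed_payoff g (x h) (?T \<omega>\<^sub>2 h) \<partial>cube N) =
        lik fst s h * lik snd (?T \<omega>\<^sub>2) h * mixed_payoff g (x h) (?T \<omega>\<^sub>2 h)" if m: "m < N" "h \<in> hist m" for m h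
      using measure_sim[of m N h "?Q \<omega>\<^sub>2"] m by (simp add: lik_pair hist_def Int_def conj_commute)
    have J: "integrable (cube N) (\<lambda>\<omega>\<^sub>1. indicator {\<omega>\<^sub>1. sim (?Q \<omega>\<^sub>2) \<omega>\<^sub>1 m = h} \<omega>\<^sub>1 * mixed_payoff g (x h) (?T \<omega>\<^sub>2 h))"
      if m: "m < N" "h \<in> hist m" for m h
      using meas[OF m] by (intro integrable_mult_left) (simp add: integrable_indicator_iff Int_def conj_commute C1.emeasure_eq_measure)
    have F: "integrable (cube N) (\<lambda>\<omega>\<^sub>1. ?F m \<omega>\<^sub>1 \<omega>\<^sub>2)" "(\<integral>\<omega>\<^sub>1. ?F m \<omega>\<^sub>1 \<omega>\<^sub>2 \<partial>cube N) = public_payoff g s x (?T \<omega>\<^sub>2) m"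
      if m: "m < N" for m
    proof -
      show "integrable (cube N) (\<lambda>\<omega>\<^sub>1. ?F m \<omega>\<^sub>1 \<omega>\<^sub>2)"
        by (intro Bochner_Integration.integrable_sum J m)
      show "(\<integral>\<omega>\<^sub>1. ?F m \<omega>\<^sub>1 \<omega>\<^sub>2 \<partial>cube N) = public_payoff g s x (?T \<omega>\<^sub>2) m"
        unfolding public_payoff_def by (subst Bochner_Integration.integral_sum) (auto intro!: J m sum.cong simp only: I[OF m])
    qed
    have "(\<integral>\<omega>\<^sub>1. (\<Sum>m<N. (c (Suc m) - c m) * ?F m \<omega>\<^sub>1 \<omega>\<^sub>2) \<partial>cube N) = (\<Sum>m<N. \<integral>\<omega>\<^sub>1. (c (Suc m) - c m) * ?F m \<omega>\<^sub>1 \<omega>\<^sub>2 \<partial>cube N)"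
      by (intro Bochner_Integration.integral_sum integrable_mult_right F) simp
    also have "\<dots> = (\<Sum>m<N. (c (Suc m) - c m) * public_payoff g s x (?T \<omega>\<^sub>2) m)"
      by (intro sum.cong refl) (simp only: integral_mult_right_zero F(2) lessThan_iff)
    finally show ?thesis .
  qed
  have "(\<integral>\<omega>. running_payoff g (induced_controls (N, simulate s x) \<beta> (fst \<omega>) (snd \<omega>)) \<partial>(cube N \<Otimes>\<^sub>M cube (fst \<beta>))) =
      (\<integral>(\<omega>\<^sub>1, \<omega>\<^sub>2). (\<Sum>m<N. (c (Suc m) - c m) * ?F m \<omega>\<^sub>1 \<omega>\<^sub>2) \<partial>?P)"
    unfolding b fst_conv by (intro Bochner_Integration.integral_cong refl) (auto simp: space_pair_measure rp[unfolded b])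
  also have "\<dots> = (\<integral>\<omega>\<^sub>2. (\<Sum>m<N. (c (Suc m) - c m) * public_payoff g s x (?T \<omega>\<^sub>2) m) \<partial>cube m')"
    using P.integral_snd[unfolded b fst_conv, OF int2] by (simp only: inner)
  finally show "(\<integral>\<omega>. running_payoff g (induced_controls (N, simulate s x) \<beta> (fst \<omega>) (snd \<omega>)) \<partial>(cube N \<Otimes>\<^sub>M cube (fst \<beta>))) =
      (\<integral>\<omega>. (\<Sum>m<N. (c (Suc m) - c m) * public_payoff g s x (response x (snd \<beta> \<omega>)) m) \<partial>cube (fst \<beta>))"
    by (simp add: b)
  show "integrable (cube (fst \<beta>)) (\<lambda>\<omega>. \<Sum>m<N. (c (Suc m) - c m) * public_payoff g s x (response x (snd \<beta> \<omega>)) m)"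
    using P.integrable_snd[unfolded b fst_conv, OF int2] by (simp only: inner b fst_conv snd_conv)
qed

end


section \<open>Comparison of the values\<close>

text \<open>Non-integrable functions have integral \<open>0\<close>, so the bound also covers
  payoffs of controls selected by choice, before anything is known about their
  measurability.\<close>

lemma (in prob_space) abs_integral_le:
  fixes f :: "'a \<Rightarrow> real"
  assumes "0 \<le> B" "\<And>x. x \<in> space M \<Longrightarrow> \<bar>f x\<bar> \<le> B"
  shows "\<bar>\<integral>x. f x \<partial>M\<bar> \<le> B"
proof (cases "integrable M f")
  case True
  have "\<bar>\<integral>x. f x \<partial>M\<bar> \<le> (\<integral>x. \<bar>f x\<bar> \<partial>M)"
    by (rule integral_abs_bound)
  also have "\<dots> \<le> B"
    using True assms by (intro integral_le_const integrable_abs AE_I2) auto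
  finally show ?thesis .
next
  case False
  with assms(1) show ?thesis
    by (simp add: not_integrable_integral_eq)
qed

lemma abs_running_payoff_le:
  assumes "0 \<le> B" "\<And>i j. \<bar>g i j\<bar> \<le> B"
  shows "\<bar>running_payoff g p\<bar> \<le> B"
  unfolding running_payoff_def case_prod_unfold
  by (intro prob_space.abs_integral_le[OF prob_space_unit_lebesgue] assms(1) abs_mixed_payoff_le assms(2))

lemma prob_space_cube_pair: "prob_space (cube m \<Otimes>\<^sub>M cube n)"
proof -
  interpret C1: prob_space "cube m"
    by (rule prob_space_cube)
  interpret C2: prob_space "cube n"
    by (rule prob_space_cube)
  interpret P: pair_prob_space "cube m" "cube n" ..
  show ?thesis
    by (rule P.prob_space_axioms)
qed

lemma abs_ct_payoff_le:
  assumes "0 \<le> B" "\<And>k l i j. \<bar>G k l i j\<bar> \<le> B"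
  shows "\<bar>ct_payoff G \<pi> \<alpha> \<beta>\<bar> \<le> B"
  unfolding ct_payoff_def
  by (intro abs_sum_pmf_le prob_space.abs_integral_le[OF prob_space_cube_pair] assms(1) abs_running_payoff_le assms(2))

lemma (in prob_space) exists_le_expectation:
  fixes X :: "'a \<Rightarrow> real"
  assumes "integrable M X"
  shows "\<exists>\<omega>\<in>space M. X \<omega> \<le> expectation X"
proof (rule ccontr)
  assume "\<not> (\<exists>\<omega>\<in>space M. X \<omega> \<le> expectation X)"
  then have "expectation X < expectation X"
    by (intro expectation_greater assms AE_I2) auto
  then show False by simp
qed

definition (in time_blocks) block_weight :: "nat \<Rightarrow> real" where
  "block_weight m = (if m < N then c (Suc m) - c m else 0)"

text \<open>Against the simulation the opponent faces a repeated game with the block lengths as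
  weights; there \<sigma> guarantees \<open>r\<close>, and playing the mixture costs the
  regret.\<close>

lemma (in time_blocks) ct_payoff_simulate_ge:
  fixes G :: "'k::finite \<Rightarrow> 'l::finite \<Rightarrow> 'i::finite \<Rightarrow> 'j::finite \<Rightarrow> real"
  assumes B: "0 \<le> B" "\<And>k l i j. \<bar>G k l i j\<bar> \<le> B" and x: "bayes_mixture \<sigma> x" and \<kappa>: "0 < \<kappa>"
    and r: "\<And>\<tau>. r \<le> weighted_payoff G \<pi> block_weight \<sigma> \<tau>"
    and \<beta>: "\<And>l. \<beta> l \<in> random_strategies"
  shows "r - B * (1 / (2 * \<kappa>) + \<kappa> / 2 * real CARD('k) * (\<Sum>m<N. (c (Suc m) - c m)\<^sup>2))
    \<le> ct_payoff G \<pi> (\<lambda>k. (N, simulate (\<sigma> k) x)) \<beta>"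
proof -
  let ?d = "\<lambda>m. c (Suc m) - c m"
  let ?err = "B * (1 / (2 * \<kappa>) + \<kappa> / 2 * real CARD('k) * (\<Sum>m<N. (?d m)\<^sup>2))"
  let ?T = "\<lambda>l \<omega>. response x (snd (\<beta> l) \<omega>) :: ('i \<times> 'j) list \<Rightarrow> 'j pmf"
  define Z where "Z k l \<omega> = (\<Sum>m<N. ?d m * public_payoff (G k l) (\<sigma> k) x (?T l \<omega>) m)" for k l \<omega>
  \<comment> \<open>Type \<open>l\<close> does not know \<open>k\<close>, so one seed has to serve
    against all types of the player: the sum over \<open>k\<close> is taken before the seed is
    chosen.\<close>
  define Y where "Y l \<omega> = (\<Sum>k\<in>UNIV. pmf \<pi> (k, l) * Z k l \<omega>)" for l \<omega>
  have Z_int: "integrable (cube (fst (\<beta> l))) (Z k l)" for k l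
    unfolding Z_def by (rule integral_simulate(2)[OF \<beta>])
  have Y_int: "integrable (cube (fst (\<beta> l))) (Y l)" for l
    unfolding Y_def by (intro Bochner_Integration.integrable_sum integrable_mult_right Z_int)
  \<comment> \<open>At some seed the opponent does at least as well as on average; fixing it turns
    \<open>\<beta> l\<close> into a behaviour strategy through \<open>response\<close>.\<close>
  have "\<forall>l. \<exists>\<omega>. Y l \<omega> \<le> (\<integral>\<omega>. Y l \<omega> \<partial>cube (fst (\<beta> l)))"
    using prob_space.exists_le_expectation[OF prob_space_cube Y_int] by blast
  then obtain \<omega> where \<omega>: "\<And>l. Y l (\<omega> l) \<le> (\<integral>\<omega>. Y l \<omega> \<partial>cube (fst (\<beta> l)))"
    by metis
  have "r \<le> weighted_payoff G \<pi> block_weight \<sigma> (\<lambda>l. ?T l (\<omega> l))"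
    by (rule r)
  also have "\<dots> = (\<Sum>(k, l)\<in>UNIV. pmf \<pi> (k, l) * (\<Sum>m<N. ?d m * stage_payoff (G k l) (\<sigma> k) (?T l (\<omega> l)) m))"
  proof -
    have "(\<Sum>m. block_weight m * a m) = (\<Sum>m<N. ?d m * a m)" for a
      by (subst suminf_finite[of "{..<N}"]) (auto simp: block_weight_def)
    then show ?thesis
      by (simp add: weighted_payoff_def)
  qed
  also have "\<dots> \<le> (\<Sum>(k, l)\<in>UNIV. pmf \<pi> (k, l) * (Z k l (\<omega> l) + ?err))"
  proof (intro sum_mono, clarify, intro mult_left_mono)
    fix k l
    have "0 \<le> ?d m" if "m < N" for m
      using block_bounds(2)[OF that] by simp
    then have "(\<Sum>m<N. block_weight m * stage_payoff (G k l) (\<sigma> k) (?T l (\<omega> l)) m)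
        - B * (1 / (2 * \<kappa>) + \<kappa> / 2 * real CARD('k) * (\<Sum>m<N. (block_weight m)\<^sup>2))
        \<le> (\<Sum>m<N. block_weight m * public_payoff (G k l) (\<sigma> k) x (?T l (\<omega> l)) m)"
      by (intro public_payoff_ge x \<kappa> B) (simp add: block_weight_def)
    then show "(\<Sum>m<N. ?d m * stage_payoff (G k l) (\<sigma> k) (?T l (\<omega> l)) m) \<le> Z k l (\<omega> l) + ?err"
      by (simp add: Z_def block_weight_def)
  qed auto
  also have "\<dots> = (\<Sum>(k, l)\<in>UNIV. pmf \<pi> (k, l) * Z k l (\<omega> l)) + (\<Sum>a\<in>UNIV. pmf \<pi> a) * ?err"
    unfolding sum_distrib_right sum.distrib[symmetric] by (intro sum.cong) (auto simp: distrib_left)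
  also have "(\<Sum>(k, l)\<in>UNIV. pmf \<pi> (k, l) * Z k l (\<omega> l)) = (\<Sum>l\<in>UNIV. Y l (\<omega> l))"
    unfolding Y_def sum_UNIV_prod prod.case by (rule sum.swap)
  also have "\<dots> \<le> (\<Sum>l\<in>UNIV. \<integral>\<omega>. Y l \<omega> \<partial>cube (fst (\<beta> l)))"
    by (intro sum_mono \<omega>)
  also have "\<dots> = (\<Sum>l\<in>UNIV. \<Sum>k\<in>UNIV. pmf \<pi> (k, l) * (\<integral>\<omega>. Z k l \<omega> \<partial>cube (fst (\<beta> l))))"
    unfolding Y_def
    by (intro sum.cong refl, subst Bochner_Integration.integral_sum) (auto intro!: integrable_mult_right Z_int)
  also have "\<dots> = (\<Sum>(k, l)\<in>UNIV. pmf \<pi> (k, l) * (\<integral>\<omega>. Z k l \<omega> \<partial>cube (fst (\<beta> l))))"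
    unfolding sum_UNIV_prod prod.case by (rule sum.swap)
  also have "\<dots> = ct_payoff G \<pi> (\<lambda>k. (N, simulate (\<sigma> k) x)) \<beta>"
    unfolding ct_payoff_def Z_def fst_conv integral_simulate(1)[OF \<beta>] ..
  finally show ?thesis
    by simp
qed

section \<open>Block lengths approximating the stage weights\<close>

lemma pmf_le_weight_norm: "pmf \<theta> m \<le> weight_norm \<theta>"
  unfolding weight_norm_def by (intro cSUP_upper bdd_aboveI2[where M=1]) (auto simp: pmf_le_1)

lemma weight_norm_pos: "0 < weight_norm \<theta>"
proof -
  obtain m where "m \<in> set_pmf \<theta>"
    using set_pmf_not_empty[of \<theta>] by blast
  then have "0 < pmf \<theta> m"
    by (rule pmf_positive)
  with pmf_le_weight_norm[of \<theta> m] show ?thesis by simp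
qed

text \<open>
  The weights are truncated and perturbed so that all blocks have positive length and fill \<open>[0,1]\<close>.
\<close>

lemma approximating_blocks:
  fixes \<theta> :: "nat pmf"
  assumes "0 < e"
  shows "\<exists>N c. time_blocks N c \<and> (\<Sum>m. \<bar>pmf \<theta> m - time_blocks.block_weight N c m\<bar>) \<le> e \<and>
    (\<Sum>m<N. (c (Suc m) - c m)\<^sup>2) \<le> weight_norm \<theta> + e"
proof -
  \<comment> \<open>A quarter, because the error is at most \<open>t + \<eta> * T + \<rho>\<close>
    with \<open>t \<le> \<eta>\<close>, \<open>T \<le> 1\<close> and
    \<open>\<rho> \<le> 2 * \<eta>\<close>; the cap keeps \<open>1 - \<eta>\<close>
    positive.\<close>
  define \<eta> where "\<eta> = min (e / 4) (1 / 2)"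
  have \<eta>: "0 < \<eta>" "\<eta> < 1" "4 * \<eta> \<le> e"
    using assms by (auto simp: \<eta>_def)
  note sm = sums_summable[OF pmf_nat_sums[of \<theta>]]
  obtain N\<^sub>0 where N\<^sub>0: "\<forall>n\<ge>N\<^sub>0. norm (\<Sum>m. pmf \<theta> (m + n)) < \<eta>"
    using suminf_exist_split[OF \<eta>(1) sm] by blast
  define N where "N = Suc N\<^sub>0"
  define T where "T = (\<Sum>m<N. pmf \<theta> m)"
  define t where "t = (\<Sum>m. pmf \<theta> (m + N))"
  have t: "t \<le> \<eta>" "0 \<le> t" "t = 1 - T"
  proof -
    show "t \<le> \<eta>"
      using N\<^sub>0[rule_format, of N] by (simp add: t_def N_def)
    show "0 \<le> t"
      unfolding t_def by (intro suminf_nonneg summable_ignore_initial_segment[OF sm]) simp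
    show "t = 1 - T"
      using suminf_split_initial_segment[OF sm, of N] sums_unique[OF pmf_nat_sums[of \<theta>]] by (simp add: t_def T_def)
  qed
  \<comment> \<open>The mass to be spread evenly over the blocks. The factor
    \<open>1 - \<eta>\<close> makes it positive even if the first \<open>N\<close> weights already
    sum to one.\<close>
  define \<rho> where "\<rho> = 1 - (1 - \<eta>) * T"
  have \<rho>: "0 < \<rho>" "\<rho> \<le> 2 * \<eta>"
  proof -
    have eq: "\<rho> = \<eta> + (1 - \<eta>) * t"
      by (simp add: \<rho>_def t(3) algebra_simps)
    have "0 \<le> (1 - \<eta>) * t" "(1 - \<eta>) * t \<le> 1 * t"
      using \<eta> t(2) by (intro mult_nonneg_nonneg mult_right_mono; simp)+
    then show "0 < \<rho>" "\<rho> \<le> 2 * \<eta>"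
      using eq \<eta> t(1) by linarith+
  qed
  define d where "d m = (1 - \<eta>) * pmf \<theta> m + \<rho> / N" for m
  define c where "c n = (\<Sum>m<n. d m)" for n
  have N: "0 < real N"
    by (simp add: N_def)
  have d_pos: "0 < d m" for m
    unfolding d_def using \<eta> \<rho> N by (intro add_nonneg_pos mult_nonneg_nonneg divide_pos_pos) auto
  have c_d: "c (Suc m) - c m = d m" for m
    by (simp add: c_def)
  have c_N: "c N = 1"
    using N by (simp add: c_def d_def sum.distrib \<rho>_def T_def flip: sum_distrib_left)
  interpret time_blocks N c
    by standard (use c_N d_pos c_d in \<open>auto simp: c_def\<close>)
  have "summable (\<lambda>m. \<bar>pmf \<theta> m - block_weight m\<bar>)"
  proof (rule summable_comparison_test'[OF sm])
    fix m assume "N \<le> m"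
    then show "norm \<bar>pmf \<theta> m - block_weight m\<bar> \<le> pmf \<theta> m"
      by (simp add: block_weight_def)
  qed
  then have "(\<Sum>m. \<bar>pmf \<theta> m - block_weight m\<bar>) =
      (\<Sum>m. \<bar>pmf \<theta> (m + N) - block_weight (m + N)\<bar>) + (\<Sum>m<N. \<bar>pmf \<theta> m - block_weight m\<bar>)"
    by (rule suminf_split_initial_segment)
  also have "(\<Sum>m. \<bar>pmf \<theta> (m + N) - block_weight (m + N)\<bar>) = t"
    by (simp add: block_weight_def t_def)
  also have "(\<Sum>m<N. \<bar>pmf \<theta> m - block_weight m\<bar>) \<le> (\<Sum>m<N. \<eta> * pmf \<theta> m + \<rho> / N)"
  proof (rule sum_mono)
    fix m assume "m \<in> {..<N}"
    then have "pmf \<theta> m - block_weight m = \<eta> * pmf \<theta> m - \<rho> / N"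
      by (simp add: block_weight_def c_d d_def algebra_simps)
    then show "\<bar>pmf \<theta> m - block_weight m\<bar> \<le> \<eta> * pmf \<theta> m + \<rho> / N"
      using \<eta> \<rho> N by (auto simp: abs_le_iff)
  qed
  also have "\<dots> = \<eta> * T + \<rho>"
    using N by (simp add: sum.distrib T_def flip: sum_distrib_left)
  also have "t + (\<eta> * T + \<rho>) \<le> e"
  proof -
    have "\<eta> * T \<le> \<eta> * 1"
      using t \<eta> by (intro mult_left_mono) auto
    then show ?thesis
      using t \<rho> \<eta> by linarith
  qed
  finally have 1: "(\<Sum>m. \<bar>pmf \<theta> m - block_weight m\<bar>) \<le> e"
    by simp
  have d_le: "d m \<le> weight_norm \<theta> + e" for m
  proof -
    have "(1 - \<eta>) * pmf \<theta> m \<le> 1 * weight_norm \<theta>"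
      using \<eta> pmf_le_weight_norm[of \<theta> m] by (intro mult_mono) auto
    moreover have "\<rho> / N \<le> \<rho> / 1"
      using \<rho> by (intro divide_left_mono) (auto simp: N_def)
    ultimately show ?thesis
      unfolding d_def using \<rho> \<eta> by linarith
  qed
  \<comment> \<open>The largest length comes out as a factor, and the remaining lengths sum to
    one.\<close>
  have "(\<Sum>m<N. (c (Suc m) - c m)\<^sup>2) \<le> (\<Sum>m<N. (weight_norm \<theta> + e) * d m)"
    unfolding c_d power2_eq_square using d_le d_pos by (intro sum_mono mult_right_mono) (auto intro: less_imp_le)
  also have "\<dots> = weight_norm \<theta> + e"
    using c_N by (simp add: c_def flip: sum_distrib_left)
  finally show ?thesis
    using 1 time_blocks_axioms by blast
qed

text \<open>The first term pays for replacing \<theta> by block lengths. The second is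
  \<open>B * (1 / (2 * \<kappa>) + \<kappa> / 2 * n * (2 * \<delta>))\<close> at
  \<open>\<kappa> = 1 / sqrt (2 * \<delta>)\<close>.\<close>

definition ct_error :: "real \<Rightarrow> real \<Rightarrow> real \<Rightarrow> real" where
  "ct_error B n \<delta> = B * \<delta> + B * (1 + n) / 2 * sqrt (2 * \<delta>)"

theorem ct_guarantee:
  fixes G :: "'k::finite \<Rightarrow> 'l::finite \<Rightarrow> 'i::finite \<Rightarrow> 'j::finite \<Rightarrow> real"
  assumes B: "0 \<le> B" "\<And>k l i j. \<bar>G k l i j\<bar> \<le> B"
    and r: "\<And>\<tau>. r \<le> weighted_payoff G \<pi> (pmf \<theta>) \<sigma> \<tau>"
  shows "\<exists>\<alpha>. (\<forall>k. \<alpha> k \<in> random_strategies) \<and> (\<forall>\<beta>. (\<forall>l. \<beta> l \<in> random_strategies) \<longrightarrow>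
    r - ct_error B (real CARD('k)) (weight_norm \<theta>) \<le> ct_payoff G \<pi> \<alpha> \<beta>)"
proof -
  let ?\<delta> = "weight_norm \<theta>"
  \<comment> \<open>The norm itself serves as the tolerance, whence the bound twice the norm on the
    squares.\<close>
  obtain N c where Nc: "time_blocks N c" "(\<Sum>m. \<bar>pmf \<theta> m - time_blocks.block_weight N c m\<bar>) \<le> ?\<delta>"
    "(\<Sum>m<N. (c (Suc m) - c m)\<^sup>2) \<le> ?\<delta> + ?\<delta>"
    using approximating_blocks[OF weight_norm_pos] by blast
  interpret time_blocks N c
    by (rule Nc(1))
  obtain x where x: "bayes_mixture \<sigma> x"
    using bayes_mixture_exists by blast
  define q where "q = sqrt (2 * ?\<delta>)"
  have q: "0 < q" "q * q = 2 * ?\<delta>"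
    using weight_norm_pos[of \<theta>] by (auto simp: q_def)
  define \<kappa> where "\<kappa> = 1 / q"
  have \<kappa>: "0 < \<kappa>"
    using q by (simp add: \<kappa>_def)
  have w: "summable block_weight" "\<And>m. 0 \<le> block_weight m"
    using block_bounds(2) summable_finite[of "{..<N}" block_weight] by (auto simp: block_weight_def less_imp_le)
  have r': "r - B * ?\<delta> \<le> weighted_payoff G \<pi> block_weight \<sigma> \<tau>" for \<tau>
  proof -
    have "\<bar>weighted_payoff G \<pi> (pmf \<theta>) \<sigma> \<tau> - weighted_payoff G \<pi> block_weight \<sigma> \<tau>\<bar>
        \<le> B * (\<Sum>m. \<bar>pmf \<theta> m - block_weight m\<bar>)"
      by (intro weighted_payoff_diff_le B w sums_summable[OF pmf_nat_sums]) simp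
    also have "\<dots> \<le> B * ?\<delta>"
      by (intro mult_left_mono Nc(2) B(1))
    finally show ?thesis
      using r[of \<tau>] by linarith
  qed
  have err: "B * ?\<delta> + B * (1 / (2 * \<kappa>) + \<kappa> / 2 * real CARD('k) * (\<Sum>m<N. (c (Suc m) - c m)\<^sup>2))
      \<le> ct_error B (real CARD('k)) ?\<delta>"
  proof -
    have "\<kappa> / 2 * real CARD('k) * (\<Sum>m<N. (c (Suc m) - c m)\<^sup>2) \<le> \<kappa> / 2 * real CARD('k) * (q * q)"
      using Nc(3) \<kappa> by (intro mult_left_mono) (auto simp: q)
    also have "\<dots> = real CARD('k) * q / 2"
      using q(1) by (simp add: \<kappa>_def)
    finally have le: "\<kappa> / 2 * real CARD('k) * (\<Sum>m<N. (c (Suc m) - c m)\<^sup>2) \<le> real CARD('k) * q / 2" .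
    have "(1 + real CARD('k)) / 2 * q = 1 / (2 * \<kappa>) + real CARD('k) * q / 2"
      using q(1) by (simp add: \<kappa>_def field_simps)
    with le have "1 / (2 * \<kappa>) + \<kappa> / 2 * real CARD('k) * (\<Sum>m<N. (c (Suc m) - c m)\<^sup>2) \<le> (1 + real CARD('k)) / 2 * q"
      by simp
    from mult_left_mono[OF this B(1)] show ?thesis
      by (simp add: ct_error_def q_def)
  qed
  show ?thesis
  proof (intro exI[of _ "\<lambda>k. (N, simulate (\<sigma> k) x)"] conjI allI impI)
    show "(N, simulate (\<sigma> k) x) \<in> random_strategies" for k
      by (rule simulate_random_strategies)
    fix \<beta> :: "'l \<Rightarrow> ('i, 'j) strategy" assume "\<forall>l. \<beta> l \<in> random_strategies"
    then have \<beta>: "\<beta> l \<in> random_strategies" for l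
      by simp
    show "r - ct_error B (real CARD('k)) ?\<delta> \<le> ct_payoff G \<pi> (\<lambda>k. (N, simulate (\<sigma> k) x)) \<beta>"
      using ct_payoff_simulate_ge[OF B x \<kappa> r', of \<beta>] \<beta> err by fastforce
  qed
qed

section \<open>Exchanging the players\<close>

lemma hist_map_swap: "bij_betw (map prod.swap) (hist n) (hist n)"
  by (rule bij_betwI[where g="map prod.swap"]) (auto simp: hist_def o_def)

lemma lik_map_swap:
  "lik fst (\<lambda>h. t (map prod.swap h)) h = lik snd t (map prod.swap h)"
  "lik snd (\<lambda>h. s (map prod.swap h)) h = lik fst s (map prod.swap h)"
  by (auto simp: lik_def take_map intro!: prod.cong)

abbreviation swapped_game :: "('k \<Rightarrow> 'l \<Rightarrow> 'i \<Rightarrow> 'j \<Rightarrow> real) \<Rightarrow> 'l \<Rightarrow> 'k \<Rightarrow> 'j \<Rightarrow> 'i \<Rightarrow> real" where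
  "swapped_game G \<equiv> (\<lambda>l k j i. - G k l i j)"

lemma mixed_payoff_swap: "mixed_payoff (\<lambda>j i. - g i j) b a = - mixed_payoff g a b"
  unfolding mixed_payoff_def by (subst sum.swap) (simp add: sum_negf mult_ac)

lemma stage_payoff_swap:
  "stage_payoff (\<lambda>j i. - g i j) (\<lambda>h. t (map prod.swap h)) (\<lambda>h. s (map prod.swap h)) m = - stage_payoff g s t m"
proof -
  have "stage_payoff (\<lambda>j i. - g i j) (\<lambda>h. t (map prod.swap h)) (\<lambda>h. s (map prod.swap h)) m =
      (\<Sum>h\<in>hist m. - (lik fst s (map prod.swap h) * lik snd t (map prod.swap h) *
        mixed_payoff g (s (map prod.swap h)) (t (map prod.swap h))))"
    unfolding stage_payoff_def lik_map_swap mixed_payoff_swap by (intro sum.cong) auto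
  also have "\<dots> = (\<Sum>h\<in>hist m. - (lik fst s h * lik snd t h * mixed_payoff g (s h) (t h)))"
    by (rule sum.reindex_bij_betw[OF hist_map_swap])
  finally show ?thesis
    by (simp add: stage_payoff_def sum_negf)
qed

lemma pmf_map_swap: "pmf (map_pmf prod.swap \<pi>) (l, k) = pmf \<pi> (k, l)"
  using pmf_map_inj'[of prod.swap \<pi> "(k, l)"] by simp

lemma sum_prod_swap: "(\<Sum>(l, k)\<in>UNIV. f k l) = (\<Sum>(k, l)\<in>UNIV. f k l)"
  for f :: "'k::finite \<Rightarrow> 'l::finite \<Rightarrow> real"
  unfolding sum_UNIV_prod prod.case by (rule sum.swap)

lemma weighted_payoff_swap:
  assumes "summable w" "\<And>m. 0 \<le> w m"
  shows "weighted_payoff (swapped_game G) (map_pmf prod.swap \<pi>) w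
    (\<lambda>l h. \<tau> l (map prod.swap h)) (\<lambda>k h. \<sigma> k (map prod.swap h)) = - weighted_payoff G \<pi> w \<sigma> \<tau>"
proof -
  obtain B where B: "0 \<le> B" "\<And>k l i j. \<bar>G k l i j\<bar> \<le> B"
    using ex_payoff_bound by blast
  have "(\<Sum>m. w m * - stage_payoff (G k l) (\<sigma> k) (\<tau> l) m) = - (\<Sum>m. w m * stage_payoff (G k l) (\<sigma> k) (\<tau> l) m)" for k l
    using suminf_minus[OF summable_weighted(2)[OF assms abs_stage_payoff_le[of "G k l", OF B(2)]]] by simp
  then have "weighted_payoff (swapped_game G) (map_pmf prod.swap \<pi>) w
      (\<lambda>l h. \<tau> l (map prod.swap h)) (\<lambda>k h. \<sigma> k (map prod.swap h)) =
    (\<Sum>(l, k)\<in>UNIV. - (pmf \<pi> (k, l) * (\<Sum>m. w m * stage_payoff (G k l) (\<sigma> k) (\<tau> l) m)))"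
    unfolding weighted_payoff_def stage_payoff_swap pmf_map_swap by simp
  then show ?thesis
    by (subst (asm) sum_prod_swap) (simp add: weighted_payoff_def case_prod_unfold sum_negf)
qed

lemma integral_pair_swap:
  fixes f :: "'a \<Rightarrow> 'b \<Rightarrow> real"
  assumes "sigma_finite_measure M" "sigma_finite_measure M'"
  shows "(\<integral>z. f (snd z) (fst z) \<partial>(M' \<Otimes>\<^sub>M M)) = (\<integral>z. f (fst z) (snd z) \<partial>(M \<Otimes>\<^sub>M M'))"
proof -
  interpret pair_sigma_finite M M'
    using assms by (rule pair_sigma_finite.intro)
  show ?thesis
  proof (cases "integrable (M \<Otimes>\<^sub>M M') (\<lambda>z. f (fst z) (snd z))")
    case True
    then show ?thesis
      using integral_product_swap[of "\<lambda>z. f (fst z) (snd z)"] by (simp add: case_prod_unfold)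
  next
    case False
    then have "\<not> integrable (M' \<Otimes>\<^sub>M M) (\<lambda>z. f (snd z) (fst z))"
      using integrable_product_swap_iff[of "\<lambda>z. f (fst z) (snd z)"] by (simp add: case_prod_unfold)
    with False show ?thesis
      by (simp add: not_integrable_integral_eq)
  qed
qed

lemma running_payoff_swap: "running_payoff (\<lambda>j i. - g i j) (v, u) = - running_payoff g (u, v)"
  by (simp add: running_payoff_def mixed_payoff_swap)

text \<open>The choice operator may pick different pairs for the two orders of the players;
  uniqueness up to null sets makes their payoffs equal.\<close>

lemma running_payoff_induced_swap:
  assumes \<alpha>: "\<alpha> \<in> random_strategies" and \<beta>: "\<beta> \<in> random_strategies"
    and \<omega>: "\<omega>\<^sub>1 \<in> space (cube (fst \<alpha>))" "\<omega>\<^sub>2 \<in> space (cube (fst \<beta>))"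
  shows "running_payoff (\<lambda>j i. - g i j) (induced_controls \<beta> \<alpha> \<omega>\<^sub>2 \<omega>\<^sub>1) = - running_payoff g (induced_controls \<alpha> \<beta> \<omega>\<^sub>1 \<omega>\<^sub>2)"
proof -
  obtain u v u' v' where ind: "induced_controls \<alpha> \<beta> \<omega>\<^sub>1 \<omega>\<^sub>2 = (u, v)" "induced_controls \<beta> \<alpha> \<omega>\<^sub>2 \<omega>\<^sub>1 = (v', u')"
    by (metis surj_pair)
  have c: "consistent (snd \<alpha> \<omega>\<^sub>1) (snd \<beta> \<omega>\<^sub>2) u v" "consistent (snd \<alpha> \<omega>\<^sub>1) (snd \<beta> \<omega>\<^sub>2) u' v'"
    using consistent_induced_controls[OF \<alpha> \<beta> \<omega>] consistent_induced_controls[OF \<beta> \<alpha> \<omega>(2,1)] ind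
    by (auto simp: consistent_def)
  obtain N s N' s' where "delayed N s (snd \<alpha> \<omega>\<^sub>1)" "delayed N' s' (snd \<beta> \<omega>\<^sub>2)"
    using random_strategies_delayed[of "fst \<alpha>" "snd \<alpha>" \<omega>\<^sub>1] random_strategies_delayed[of "fst \<beta>" "snd \<beta>" \<omega>\<^sub>2] \<alpha> \<beta> \<omega>
    by (metis prod.collapse)
  from consistent_unique[OF this c] c have "running_payoff g (u, v) = running_payoff g (u', v')"
    by (intro running_payoff_cong) (auto simp: consistent_def)
  then show ?thesis
    by (simp add: ind running_payoff_swap)
qed

lemma ct_payoff_swap:
  assumes \<alpha>: "\<And>k. \<alpha> k \<in> random_strategies" and \<beta>: "\<And>l. \<beta> l \<in> random_strategies"
  shows "ct_payoff (swapped_game G) (map_pmf prod.swap \<pi>) \<beta> \<alpha> = - ct_payoff G \<pi> \<alpha> \<beta>"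
proof -
  have sf: "sigma_finite_measure (cube n)" for n
  proof -
    interpret prob_space "cube n"
      by (rule prob_space_cube)
    show ?thesis ..
  qed
  have "(\<integral>\<omega>. running_payoff (\<lambda>j i. - G k l i j) (induced_controls (\<beta> l) (\<alpha> k) (fst \<omega>) (snd \<omega>))
        \<partial>(cube (fst (\<beta> l)) \<Otimes>\<^sub>M cube (fst (\<alpha> k)))) =
      - (\<integral>\<omega>. running_payoff (G k l) (induced_controls (\<alpha> k) (\<beta> l) (fst \<omega>) (snd \<omega>))
        \<partial>(cube (fst (\<alpha> k)) \<Otimes>\<^sub>M cube (fst (\<beta> l))))" for k l
  proof -
    have "(\<integral>\<omega>. running_payoff (\<lambda>j i. - G k l i j) (induced_controls (\<beta> l) (\<alpha> k) (fst \<omega>) (snd \<omega>))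
        \<partial>(cube (fst (\<beta> l)) \<Otimes>\<^sub>M cube (fst (\<alpha> k)))) =
      (\<integral>\<omega>. - running_payoff (G k l) (induced_controls (\<alpha> k) (\<beta> l) (snd \<omega>) (fst \<omega>))
        \<partial>(cube (fst (\<beta> l)) \<Otimes>\<^sub>M cube (fst (\<alpha> k))))"
      using running_payoff_induced_swap[OF \<alpha> \<beta>]
      by (intro Bochner_Integration.integral_cong refl) (auto simp: space_pair_measure)
    also have "\<dots> = - (\<integral>\<omega>. running_payoff (G k l) (induced_controls (\<alpha> k) (\<beta> l) (snd \<omega>) (fst \<omega>))
        \<partial>(cube (fst (\<beta> l)) \<Otimes>\<^sub>M cube (fst (\<alpha> k))))"
      by (rule Bochner_Integration.integral_minus)
    also have "\<dots> = - (\<integral>\<omega>. running_payoff (G k l) (induced_controls (\<alpha> k) (\<beta> l) (fst \<omega>) (snd \<omega>))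
        \<partial>(cube (fst (\<alpha> k)) \<Otimes>\<^sub>M cube (fst (\<beta> l))))"
      using integral_pair_swap[OF sf sf, where f="\<lambda>a b. running_payoff (G k l) (induced_controls (\<alpha> k) (\<beta> l) a b)"] by simp
    finally show ?thesis .
  qed
  then have "ct_payoff (swapped_game G) (map_pmf prod.swap \<pi>) \<beta> \<alpha> =
    (\<Sum>(l, k)\<in>UNIV. - (pmf \<pi> (k, l) * (\<integral>\<omega>. running_payoff (G k l) (induced_controls (\<alpha> k) (\<beta> l) (fst \<omega>) (snd \<omega>))
        \<partial>(cube (fst (\<alpha> k)) \<Otimes>\<^sub>M cube (fst (\<beta> l))))))"
    unfolding ct_payoff_def pmf_map_swap by simp
  then show ?thesis
    by (subst (asm) sum_prod_swap) (simp add: ct_payoff_def case_prod_unfold sum_negf)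
qed

text \<open>Player 2 is the maximizer of the negated game in which the entries of every action pair
  are exchanged.\<close>

theorem ct_guarantee2:
  fixes G :: "'k::finite \<Rightarrow> 'l::finite \<Rightarrow> 'i::finite \<Rightarrow> 'j::finite \<Rightarrow> real"
  assumes B: "0 \<le> B" "\<And>k l i j. \<bar>G k l i j\<bar> \<le> B"
    and r: "\<And>\<sigma>. weighted_payoff G \<pi> (pmf \<theta>) \<sigma> \<tau> \<le> r"
  shows "\<exists>\<beta>. (\<forall>l. \<beta> l \<in> random_strategies) \<and> (\<forall>\<alpha>. (\<forall>k. \<alpha> k \<in> random_strategies) \<longrightarrow>
    ct_payoff G \<pi> \<alpha> \<beta> \<le> r + ct_error B (real CARD('l)) (weight_norm \<theta>))"
proof -
  have "- r \<le> weighted_payoff (swapped_game G) (map_pmf prod.swap \<pi>) (pmf \<theta>) (\<lambda>l h. \<tau> l (map prod.swap h)) \<sigma>'" for \<sigma>'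
    using r[of "\<lambda>k h. \<sigma>' k (map prod.swap h)"]
      weighted_payoff_swap[OF sums_summable[OF pmf_nat_sums[of \<theta>]], of G \<pi> \<tau> "\<lambda>k h. \<sigma>' k (map prod.swap h)"]
    by (simp add: o_def)
  then obtain \<beta> where \<beta>: "\<And>l. \<beta> l \<in> random_strategies"
    "\<And>\<alpha>. (\<forall>k. \<alpha> k \<in> random_strategies) \<Longrightarrow>
      - r - ct_error B (real CARD('l)) (weight_norm \<theta>) \<le> ct_payoff (swapped_game G) (map_pmf prod.swap \<pi>) \<beta> \<alpha>"
    using ct_guarantee[of B "swapped_game G" "- r" "map_pmf prod.swap \<pi>" \<theta> "\<lambda>l h. \<tau> l (map prod.swap h)"] B by auto
  show ?thesis
  proof (intro exI[of _ \<beta>] conjI allI impI \<beta>(1))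
    fix \<alpha> :: "'k \<Rightarrow> ('j, 'i) strategy" assume \<alpha>: "\<forall>k. \<alpha> k \<in> random_strategies"
    show "ct_payoff G \<pi> \<alpha> \<beta> \<le> r + ct_error B (real CARD('l)) (weight_norm \<theta>)"
      using \<beta>(2)[OF \<alpha>] ct_payoff_swap[of \<alpha> \<beta> G \<pi>] \<alpha> \<beta>(1) by simp
  qed
qed

section \<open>Passage to vanishing weights\<close>

text \<open>Uniform weights on longer and longer horizons have arbitrarily small norm; without this
  the limit would not be unique.\<close>

lemma vanishing_weights_neq_bot: "vanishing_weights \<noteq> bot"
  unfolding vanishing_weights_def
proof (rule filtercomap_neq_bot)
  fix P :: "real \<Rightarrow> bool" assume "eventually P (nhds 0)"
  then obtain e where e: "e > 0" "\<And>x. dist x 0 < e \<Longrightarrow> P x"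
    by (auto simp: eventually_nhds_metric)
  obtain n where n: "inverse (real (Suc n)) < e"
    using reals_Archimedean[OF e(1)] by blast
  let ?\<theta> = "pmf_of_set {..n}"
  have "weight_norm ?\<theta> \<le> inverse (real (Suc n))"
    unfolding weight_norm_def by (intro cSUP_least) (auto simp: pmf_of_set indicator_def divide_simps)
  with n weight_norm_pos[of ?\<theta>] have "P (weight_norm ?\<theta>)"
    by (intro e(2)) (simp add: dist_real_def)
  then show "\<exists>\<theta>. P (weight_norm \<theta>)" ..
qed

lemma tendsto_weight_norm: "(weight_norm \<longlongrightarrow> 0) vanishing_weights"
  unfolding vanishing_weights_def by (rule filterlim_filtercomap)

lemma repeated_is_value: "is_value UNIV UNIV (weighted_payoff G \<pi> (pmf \<theta>)) (repeated_value G \<pi> \<theta>)"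
  and repeated_has_value: "repeated_has_value G \<pi> \<theta>"
proof -
  have "has_value UNIV UNIV (weighted_payoff G \<pi> (pmf \<theta>))"
    by (rule weighted_payoff_has_value[OF sums_summable[OF pmf_nat_sums]]) simp
  then obtain w where w: "is_value UNIV UNIV (weighted_payoff G \<pi> (pmf \<theta>)) w"
    by (auto simp: has_value_def)
  have eq: "repeated_payoff G \<pi> \<theta> = weighted_payoff G \<pi> (pmf \<theta>)"
    by (intro ext repeated_payoff_eq)
  show "is_value UNIV UNIV (weighted_payoff G \<pi> (pmf \<theta>)) (repeated_value G \<pi> \<theta>)"
    using w game_value_eq(2)[OF w] by (simp add: repeated_value_def eq)
  show "repeated_has_value G \<pi> \<theta>"
    using game_value_eq(1)[OF w] by (simp add: repeated_has_value_def eq)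
qed

lemma is_value_near_optimal:
  fixes g :: "'a \<Rightarrow> 'b \<Rightarrow> real"
  assumes "is_value UNIV UNIV g w" and bd: "\<And>a b. \<bar>g a b\<bar> \<le> C" and "0 < e"
  shows "\<exists>a. \<forall>b. w - e \<le> g a b" "\<exists>b. \<forall>a. g a b \<le> w + e"
proof -
  have bdd: "bdd_below (range (g a))" "bdd_above (range (\<lambda>a. g a b))" for a b
    using bd by (auto intro!: bdd_belowI2[where m="-C"] bdd_aboveI2[where M=C] simp: abs_le_iff minus_le_iff)
  have "w - e < (SUP a. INF b. g a b)"
    using assms by (simp add: is_value_def)
  then obtain a where "w - e < (INF b. g a b)"
    by (subst (asm) less_cSUP_iff) (auto intro!: bdd_aboveI2[where M=C] intro: cINF_lower2[OF bdd(1) UNIV_I] simp: abs_le_iff bd[unfolded abs_le_iff])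
  then show "\<exists>a. \<forall>b. w - e \<le> g a b"
    using cINF_lower[OF bdd(1) UNIV_I] by (metis less_imp_le order_trans)
  have "(INF b. SUP a. g a b) < w + e"
    using assms by (simp add: is_value_def)
  then obtain b where "(SUP a. g a b) < w + e"
    using cInf_lessD[of "range (\<lambda>b. SUP a. g a b)" "w + e"] by auto
  then show "\<exists>b. \<forall>a. g a b \<le> w + e"
    using cSUP_upper[OF UNIV_I bdd(2)] by (metis less_imp_le order_trans)
qed

text \<open>The continuous-time game does not involve \<theta>, while its lower and upper values are
  compared with the repeated value for every \<theta>. Vanishing weights therefore close the gap
  between them, and the same estimate yields convergence of the repeated values to the common
  number.\<close>

theorem corollary3p8:
  fixes G :: "'k::finite \<Rightarrow> 'l::finite \<Rightarrow> 'i::finite \<Rightarrow> 'j::finite \<Rightarrow> real"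
    and \<pi> :: "('k \<times> 'l) pmf"
  shows "ct_has_value G \<pi> \<and>
    (\<forall>\<theta>. repeated_has_value G \<pi> \<theta>) \<and>
    (repeated_value G \<pi> \<longlongrightarrow> asymptotic_value G \<pi>) vanishing_weights \<and>
    ct_value G \<pi> = asymptotic_value G \<pi>"
proof -
  obtain B where B: "0 \<le> B" "\<And>k l i j. \<bar>G k l i j\<bar> \<le> B"
    using ex_payoff_bound by blast
  let ?A = "{\<alpha> :: 'k \<Rightarrow> ('j, 'i) strategy. \<forall>k. \<alpha> k \<in> random_strategies}"
  let ?B = "{\<beta> :: 'l \<Rightarrow> ('i, 'j) strategy. \<forall>l. \<beta> l \<in> random_strategies}"
  let ?lo = "SUP \<alpha>\<in>?A. INF \<beta>\<in>?B. ct_payoff G \<pi> \<alpha> \<beta>" and ?up = "INF \<beta>\<in>?B. SUP \<alpha>\<in>?A. ct_payoff G \<pi> \<alpha> \<beta>"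
  note bd = abs_ct_payoff_le[of B G, OF B]
  \<comment> \<open>The leading \<delta> pays for near-optimal strategies in the repeated game; both
    players' errors are added to obtain one symmetric bound.\<close>
  define err where "err \<delta> = \<delta> + ct_error B (real CARD('k)) \<delta> + ct_error B (real CARD('l)) \<delta>" for \<delta>
  have rep_bd: "\<bar>weighted_payoff G \<pi> (pmf \<theta>) \<sigma> \<tau>\<bar> \<le> B" for \<theta> \<sigma> \<tau>
    using abs_weighted_payoff_le[of G B "pmf \<theta>" \<pi> \<sigma> \<tau>] B sums_summable[OF pmf_nat_sums[of \<theta>]]
      sums_unique[OF pmf_nat_sums[of \<theta>]] by simp
  have err_nonneg: "0 \<le> ct_error B (real n) (weight_norm \<theta>)" for n \<theta>
    unfolding ct_error_def using B(1) weight_norm_pos[of \<theta>] by (intro add_nonneg_nonneg mult_nonneg_nonneg divide_nonneg_nonneg) auto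
  have g1: "\<exists>\<alpha>\<in>?A. \<forall>\<beta>\<in>?B. repeated_value G \<pi> \<theta> - err (weight_norm \<theta>) \<le> ct_payoff G \<pi> \<alpha> \<beta>" for \<theta>
  proof -
    obtain \<sigma> where "\<forall>\<tau>. repeated_value G \<pi> \<theta> - weight_norm \<theta> \<le> weighted_payoff G \<pi> (pmf \<theta>) \<sigma> \<tau>"
      using is_value_near_optimal(1)[OF repeated_is_value rep_bd weight_norm_pos] by blast
    then obtain \<alpha> where \<alpha>: "\<forall>k. \<alpha> k \<in> random_strategies" "\<And>\<beta>. (\<forall>l. \<beta> l \<in> random_strategies) \<Longrightarrow>
        repeated_value G \<pi> \<theta> - weight_norm \<theta> - ct_error B (real CARD('k)) (weight_norm \<theta>) \<le> ct_payoff G \<pi> \<alpha> \<beta>"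
      using ct_guarantee[of B G "repeated_value G \<pi> \<theta> - weight_norm \<theta>" \<pi> \<theta> \<sigma>] B by blast
    moreover have "weight_norm \<theta> + ct_error B (real CARD('k)) (weight_norm \<theta>) \<le> err (weight_norm \<theta>)"
      using err_nonneg[of "CARD('l)" \<theta>] by (simp add: err_def)
    ultimately have "repeated_value G \<pi> \<theta> - err (weight_norm \<theta>) \<le> ct_payoff G \<pi> \<alpha> \<beta>"
      if "\<forall>l. \<beta> l \<in> random_strategies" for \<beta>
      using \<alpha>(2)[OF that] by linarith
    with \<alpha>(1) show ?thesis
      by blast
  qed
  have g2: "\<exists>\<beta>\<in>?B. \<forall>\<alpha>\<in>?A. ct_payoff G \<pi> \<alpha> \<beta> \<le> repeated_value G \<pi> \<theta> + err (weight_norm \<theta>)" for \<theta>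
  proof -
    obtain \<tau> where "\<forall>\<sigma>. weighted_payoff G \<pi> (pmf \<theta>) \<sigma> \<tau> \<le> repeated_value G \<pi> \<theta> + weight_norm \<theta>"
      using is_value_near_optimal(2)[OF repeated_is_value rep_bd weight_norm_pos] by blast
    then obtain \<beta> where \<beta>: "\<forall>l. \<beta> l \<in> random_strategies" "\<And>\<alpha>. (\<forall>k. \<alpha> k \<in> random_strategies) \<Longrightarrow>
        ct_payoff G \<pi> \<alpha> \<beta> \<le> repeated_value G \<pi> \<theta> + weight_norm \<theta> + ct_error B (real CARD('l)) (weight_norm \<theta>)"
      using ct_guarantee2[of B G \<pi> \<theta> \<tau> "repeated_value G \<pi> \<theta> + weight_norm \<theta>"] B by blast
    moreover have "weight_norm \<theta> + ct_error B (real CARD('l)) (weight_norm \<theta>) \<le> err (weight_norm \<theta>)"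
      using err_nonneg[of "CARD('k)" \<theta>] by (simp add: err_def)
    ultimately have "ct_payoff G \<pi> \<alpha> \<beta> \<le> repeated_value G \<pi> \<theta> + err (weight_norm \<theta>)"
      if "\<forall>k. \<alpha> k \<in> random_strategies" for \<alpha>
      using \<beta>(2)[OF that] by linarith
    with \<beta>(1) show ?thesis
      by blast
  qed
  have ne: "?A \<noteq> {}" "?B \<noteq> {}"
    using g1[of undefined] g2[of undefined] by auto
  have lo: "repeated_value G \<pi> \<theta> - err (weight_norm \<theta>) \<le> ?lo" for \<theta>
    using g1[of \<theta>] guarantee_le_sup_inf[of ?A ?B "ct_payoff G \<pi>" B] bd ne(2) by blast
  have up: "?up \<le> repeated_value G \<pi> \<theta> + err (weight_norm \<theta>)" for \<theta>
  proof -
    obtain \<beta> where \<beta>: "\<beta> \<in> ?B" "\<And>\<alpha>. \<alpha> \<in> ?A \<Longrightarrow> ct_payoff G \<pi> \<alpha> \<beta> \<le> repeated_value G \<pi> \<theta> + err (weight_norm \<theta>)"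
      using g2[of \<theta>] by blast
    obtain \<alpha> where \<alpha>: "\<alpha> \<in> ?A"
      using ne by blast
    have "?up \<le> (SUP \<alpha>\<in>?A. ct_payoff G \<pi> \<alpha> \<beta>)"
    proof (intro cINF_lower \<beta>(1) bdd_belowI2[where m="-B"])
      fix \<beta>
      have "-B \<le> ct_payoff G \<pi> \<alpha> \<beta>"
        using bd[of \<pi> \<alpha> \<beta>] by linarith
      also have "\<dots> \<le> (SUP \<alpha>\<in>?A. ct_payoff G \<pi> \<alpha> \<beta>)"
        using bd by (intro cSUP_upper \<alpha> bdd_aboveI2[where M=B]) (auto simp: abs_le_iff)
      finally show "-B \<le> (SUP \<alpha>\<in>?A. ct_payoff G \<pi> \<alpha> \<beta>)" .
    qed
    also have "\<dots> \<le> repeated_value G \<pi> \<theta> + err (weight_norm \<theta>)"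
      by (intro cSUP_least ne(1) \<beta>(2))
    finally show ?thesis .
  qed
  have lo_up: "?lo \<le> ?up"
    by (rule sup_inf_le_inf_sup[OF ne bd])
  have err_lim: "((\<lambda>\<theta>. err (weight_norm \<theta>)) \<longlongrightarrow> 0) vanishing_weights"
  proof -
    have "((\<lambda>\<theta>. err (weight_norm \<theta>)) \<longlongrightarrow> err 0) vanishing_weights"
      unfolding err_def ct_error_def by (intro tendsto_intros tendsto_weight_norm)
    then show ?thesis
      by (simp add: err_def ct_error_def)
  qed
  have "?up - ?lo \<le> 0 + 0"
  proof (rule tendsto_lowerbound[OF tendsto_add[OF err_lim err_lim] _ vanishing_weights_neq_bot])
    show "\<forall>\<^sub>F \<theta> in vanishing_weights. ?up - ?lo \<le> err (weight_norm \<theta>) + err (weight_norm \<theta>)"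
    proof (rule always_eventually, rule allI)
      fix \<theta>
      show "?up - ?lo \<le> err (weight_norm \<theta>) + err (weight_norm \<theta>)"
        using lo[of \<theta>] up[of \<theta>] by linarith
    qed
  qed
  with lo_up have eq: "?up = ?lo"
    by simp
  then have val: "is_value ?A ?B (ct_payoff G \<pi>) ?lo"
    by (simp add: is_value_def)
  have "((\<lambda>\<theta>. repeated_value G \<pi> \<theta> - ?lo) \<longlongrightarrow> 0) vanishing_weights"
  proof (rule Lim_null_comparison[OF _ err_lim], rule always_eventually, rule allI)
    fix \<theta>
    show "norm (repeated_value G \<pi> \<theta> - ?lo) \<le> err (weight_norm \<theta>)"
      using lo[of \<theta>] up[of \<theta>] unfolding eq real_norm_def by linarith
  qed
  then have lim: "(repeated_value G \<pi> \<longlongrightarrow> ?lo) vanishing_weights"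
    by (rule LIM_zero_cancel)
  then have "asymptotic_value G \<pi> = ?lo"
    unfolding asymptotic_value_def by (intro tendsto_Lim vanishing_weights_neq_bot)
  then show ?thesis
    using lim game_value_eq[OF val] repeated_has_value[of G \<pi>] by (simp add: ct_has_value_def ct_value_def)
qed

end
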